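(* Let $\boldsymbol E(\cdot,t)\in\boldsymbol H(\mathrm{curl},\Omega)$, $t>0$, be the solution of the variational problem $$\int_\Omega\varepsilon\,\partial_t^2\boldsymbol E\cdot\bar{\boldsymbol w}\,d\boldsymbol x=-\int_\Omega\mu^{-1}(\nabla\times\boldsymbol E)\cdot(\nabla\times\bar{\boldsymbol w})\,d\boldsymbol x-\int_\Omega\boldsymbol F\cdot\bar{\boldsymbol w}\,d\boldsymbol x-\sum_{j=1}^2\langle\mathscr C_j[\boldsymbol E_{\Gamma_j}],\boldsymbol w_{\Gamma_j}\rangle_{\Gamma_j},\quad\forall\,\boldsymbol w\in\boldsymbol H(\mathrm{curl},\Omega),$$ with initial conditions $\boldsymbol E|_{t=0}=\boldsymbol E_0$ and $\partial_t\boldsymbol E|_{t=0}=\boldsymbol E_1$ in $\Omega$. If $\boldsymbol E_0,\boldsymbol E_1\in\boldsymbol L^2(\Omega)$ and $\boldsymbol F\in\boldsymbol L^1(0,T;\boldsymbol L^2(\Omega))$, then $\boldsymbol E\in\boldsymbol L^\infty(0,T;\boldsymbol L^2(\Omega))$. Moreover, for any $T>0$, $$\|\boldsymbol E\|_{\boldsymbol L^\infty(0,T;\boldsymbol L^2(\Omega))}\lesssim\|\boldsymbol E_0\|_{\boldsymbol L^2(\Omega)}+T\|\boldsymbol E_1\|_{\boldsymbol L^2(\Omega)}+T\|\boldsymbol F\|_{\boldsymbol L^1(0,T;\boldsymbol L^2(\Omega))}$$ and $$\|\boldsymbol E\|_{\boldsymbol L^2(0,T;\boldsymbol L^2(\Omega))}\lesssim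 T^{1/2}\big(\|\boldsymbol E_0\|_{\boldsymbol L^2(\Omega)}+T\|\boldsymbol E_1\|_{\boldsymbol L^2(\Omega)}+T\|\boldsymbol F\|_{\boldsymbol L^1(0,T;\boldsymbol L^2(\Omega))}\big).$$
   Context: Geometry: $h_2<h_1$ are real constants, $\Omega=\{(x,y,z)^\top\in\mathbb R^3:h_2<z<h_1\}$, $\Gamma_j=\{z=h_j\}$, $\Omega_1=\{z>h_1\}$, $\Omega_2=\{z<h_2\}$, with unit outward normals $\boldsymbol n_1=(0,0,1)^\top$ on $\Gamma_1$ and $\boldsymbol n_2=(0,0,-1)^\top$ on $\Gamma_2$. Coefficients: $\varepsilon,\mu\in L^\infty(\mathbb R^3)$ are real-valued with $0<\varepsilon_{\min}\le\varepsilon\le\varepsilon_{\max}<\infty$ and $0<\mu_{\min}\le\mu\le\mu_{\max}<\infty$, and $\varepsilon=\varepsilon_j$, $\mu=\mu_j$ are constant in $\Omega_j$, $j=1,2$. Spaces: $\boldsymbol H(\mathrm{curl},\Omega)=\{\boldsymbol u\in\boldsymbol L^2(\Omega):\nabla\times\boldsymbol u\in\boldsymbol L^2(\Omega)\}$, where $\boldsymbol L^2(\Omega)$ denotes complex square-integrable $3$-vector fields. The tangential component on $\Gamma_j$ is $\boldsymbol u_{\Gamma_j}=\boldsymbol n_j\times(\boldsymbol u\times\boldsymbol n_j)=(u_1(x,y,h_j),u_2(x,y,h_j),0)^\top$. $\langle\boldsymbol u,\boldsymbol v\rangle_{\Gamma_j}=\int_{\Gamma_j}\boldsymbol u\cdot\bar{\boldsymbol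 v}\,d\gamma_j=\int_{\mathbb R^2}(\hat u_1\bar{\hat v}_1+\hat u_2\bar{\hat v}_2)\,d\boldsymbol\xi$ (extended by duality between tangential trace spaces), where $\hat u(\boldsymbol\xi)=\frac1{2\pi}\int_{\mathbb R^2}u(\boldsymbol\rho)e^{-\mathrm i\boldsymbol\rho\cdot\boldsymbol\xi}d\boldsymbol\rho$. Boundary operator: for $s=s_1+\mathrm is_2$ with $s_1>0$, let $\beta_j(\boldsymbol\xi)=(\varepsilon_j\mu_js^2+|\boldsymbol\xi|^2)^{1/2}$ with $\mathrm{Re}\,\beta_j>0$. For a tangential field $\boldsymbol u=(u_1,u_2,0)^\top$ on $\Gamma_j$, $\mathscr B_j[\boldsymbol u]=(v_1,v_2,0)^\top$ with $$\hat v_1=\frac{1}{\mu_js\beta_j}\big[\varepsilon_j\mu_js^2\hat u_1+\xi_2(\xi_2\hat u_1-\xi_1\hat u_2)\big],\qquad \hat v_2=\frac{1}{\mu_js\beta_j}\big[\varepsilon_j\mu_js^2\hat u_2+\xi_1(\xi_1\hat u_2-\xi_2\hat u_1)\big].$$ $\mathscr C_j=\mathscr L^{-1}\circ s\mathscr B_j\circ\mathscr L$, where $\mathscr L(\boldsymbol u)(s)=\int_0^\infty e^{-st}\boldsymbol u(t)\,dt$ is the Laplace transform in time. The variational problem is the weak form of $\varepsilon\partial_t^2\boldsymbol E=-\nabla\times(\mu^{-1}\nabla\times\boldsymbol E)-\boldsymbol F$ in $\Omega$, $t>0$, with boundary condition $\mu_j^{-1}(\nabla\times\boldsymbol E)\times\boldsymbol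 n_j+\mathscr C_j[\boldsymbol E_{\Gamma_j}]=0$ on $\Gamma_j$. In the underlying Maxwell system, $\boldsymbol F=\partial_t\boldsymbol J$ and $\boldsymbol E_1=\varepsilon^{-1}(\nabla\times\boldsymbol H_0-\boldsymbol J|_{t=0})$, where $\boldsymbol J$ is the electric current density and $\boldsymbol E_0,\boldsymbol H_0$ are the initial electric and magnetic fields, all compactly supported in $\Omega$. $a\lesssim b$ means $a\le Cb$ with a positive constant $C$ independent of $T$ and of $\boldsymbol E_0,\boldsymbol E_1,\boldsymbol F$. *)

theory Defs
  imports "HOL-Analysis.Analysis" "HOL-Probability.Essential_Supremum"
begin

text \<open>
  Elements of the Lebesgue and Sobolev spaces below are represented by Borel functions (every
  class has a Borel representative); all identities between them are a.e. or integral identities.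
  Indices \<open>j\<close> range over \<open>{1, 2}\<close>.
\<close>

section \<open>Geometry\<close>

definition slab :: "(nat \<Rightarrow> real) \<Rightarrow> (real^3) set" where
  "slab h = {x. h 2 < x $ 3 \<and> x $ 3 < h 1}"

definition outer_region :: "(nat \<Rightarrow> real) \<Rightarrow> nat \<Rightarrow> (real^3) set" where
  "outer_region h j = (if j = 1 then {x. h 1 < x $ 3} else {x. x $ 3 < h 2})"

text \<open>Third component of the unit outward normal on the plane \<open>x $ 3 = h j\<close>.\<close>
definition normal_sign :: "nat \<Rightarrow> complex" where
  "normal_sign j = (if j = 1 then 1 else -1)"

text \<open>The product $a \cdot \bar b$, linear in the first argument.\<close>
definition cdot :: "complex^'n \<Rightarrow> complex^'n \<Rightarrow> complex" where
  "cdot a b = (\<Sum>i\<in>UNIV. a $ i * cnj (b $ i))"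

section \<open>Lebesgue and Bochner spaces\<close>

definition L2_space :: "('a::euclidean_space) set \<Rightarrow> ('a \<Rightarrow> complex^'n) set" where
  "L2_space D = {u. set_borel_measurable lborel D u \<and> set_integrable lborel D (\<lambda>x. (norm (u x))\<^sup>2)}"

definition L2_norm :: "('a::euclidean_space) set \<Rightarrow> ('a \<Rightarrow> complex^'n) \<Rightarrow> real" where
  "L2_norm D u = sqrt (LINT x:D|lborel. (norm (u x))\<^sup>2)"

text \<open>
  Bochner spaces over a time set \<open>I\<close> with values in a space \<open>X\<close> of functions on \<open>D\<close> with norm \<open>N\<close>
  (\<open>L2_space D\<close> or one of the weighted $L^2$ trace spaces below).  For such separable spaces,
  strong measurability in time amounts to having a jointly measurable representative.
\<close>
definition bochner_measurable ::
    "real set \<Rightarrow> ('a::euclidean_space) set \<Rightarrow> ('a \<Rightarrow> complex^'n) set \<Rightarrow> (real \<Rightarrow> 'a \<Rightarrow> complex^'n) \<Rightarrow> bool" where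
  "bochner_measurable I D X U \<longleftrightarrow>
     set_borel_measurable lborel (I \<times> D) (\<lambda>p. U (fst p) (snd p)) \<and> (AE t\<in>I in lborel. U t \<in> X)"

definition bochner_L1 ::
    "real set \<Rightarrow> ('a::euclidean_space) set \<Rightarrow> ('a \<Rightarrow> complex^'n) set \<Rightarrow> (('a \<Rightarrow> complex^'n) \<Rightarrow> real)
       \<Rightarrow> (real \<Rightarrow> 'a \<Rightarrow> complex^'n) set" where
  "bochner_L1 I D X N = {U. bochner_measurable I D X U \<and> set_integrable lborel I (\<lambda>t. N (U t))}"

definition L1_L2 :: "real \<Rightarrow> ('a::euclidean_space) set \<Rightarrow> (real \<Rightarrow> 'a \<Rightarrow> complex^'n) set" where
  "L1_L2 T D = bochner_L1 {0<..<T} D (L2_space D) (L2_norm D)"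

definition L1_L2_norm :: "real \<Rightarrow> ('a::euclidean_space) set \<Rightarrow> (real \<Rightarrow> 'a \<Rightarrow> complex^'n) \<Rightarrow> real" where
  "L1_L2_norm T D U = (LINT t:{0<..<T}|lborel. L2_norm D (U t))"

definition L2_L2 :: "real \<Rightarrow> ('a::euclidean_space) set \<Rightarrow> (real \<Rightarrow> 'a \<Rightarrow> complex^'n) set" where
  "L2_L2 T D = {U. bochner_measurable {0<..<T} D (L2_space D) U \<and>
     set_integrable lborel {0<..<T} (\<lambda>t. (L2_norm D (U t))\<^sup>2)}"

definition L2_L2_norm :: "real \<Rightarrow> ('a::euclidean_space) set \<Rightarrow> (real \<Rightarrow> 'a \<Rightarrow> complex^'n) \<Rightarrow> real" where
  "L2_L2_norm T D U = sqrt (LINT t:{0<..<T}|lborel. (L2_norm D (U t))\<^sup>2)"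

definition Linf_L2_norm :: "real \<Rightarrow> ('a::euclidean_space) set \<Rightarrow> (real \<Rightarrow> 'a \<Rightarrow> complex^'n) \<Rightarrow> ereal" where
  "Linf_L2_norm T D U = esssup (restrict_space lborel {0<..<T}) (\<lambda>t. ereal (L2_norm D (U t)))"

definition Linf_L2 :: "real \<Rightarrow> ('a::euclidean_space) set \<Rightarrow> (real \<Rightarrow> 'a \<Rightarrow> complex^'n) set" where
  "Linf_L2 T D = {U. bochner_measurable {0<..<T} D (L2_space D) U \<and> Linf_L2_norm T D U < \<infinity>}"

section \<open>Weak curl\<close>

primrec C_k :: "nat \<Rightarrow> ('a::euclidean_space \<Rightarrow> 'b::real_normed_vector) \<Rightarrow> bool" where
  "C_k 0 f \<longleftrightarrow> continuous_on UNIV f"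
| "C_k (Suc k) f \<longleftrightarrow> f differentiable_on UNIV \<and>
     (\<forall>b\<in>Basis. C_k k (\<lambda>x. frechet_derivative f (at x) b))"

definition test_fields :: "(real^3) set \<Rightarrow> (real^3 \<Rightarrow> complex^3) set" where
  "test_fields D = {\<phi>. (\<forall>k. C_k k \<phi>) \<and> compact (closure {x. \<phi> x \<noteq> 0}) \<and> closure {x. \<phi> x \<noteq> 0} \<subseteq> D}"

definition partial :: "3 \<Rightarrow> (real^3 \<Rightarrow> complex^3) \<Rightarrow> real^3 \<Rightarrow> complex^3" where
  "partial i \<phi> x = frechet_derivative \<phi> (at x) (axis i 1)"

definition classical_curl :: "(real^3 \<Rightarrow> complex^3) \<Rightarrow> real^3 \<Rightarrow> complex^3" where
  "classical_curl \<phi> x = vector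
     [partial 2 \<phi> x $ 3 - partial 3 \<phi> x $ 2,
      partial 3 \<phi> x $ 1 - partial 1 \<phi> x $ 3,
      partial 1 \<phi> x $ 2 - partial 2 \<phi> x $ 1]"

text \<open>\<open>has_curl D u c\<close>: \<open>u\<close> belongs to \<open>H(curl, D)\<close> and \<open>c\<close> is (a representative of) its distributional curl.\<close>
definition has_curl :: "(real^3) set \<Rightarrow> (real^3 \<Rightarrow> complex^3) \<Rightarrow> (real^3 \<Rightarrow> complex^3) \<Rightarrow> bool" where
  "has_curl D u c \<longleftrightarrow> u \<in> L2_space D \<and> c \<in> L2_space D \<and>
     (\<forall>\<phi>\<in>test_fields D.
        (LINT x:D|lborel. cdot (c x) (\<phi> x)) = (LINT x:D|lborel. cdot (u x) (classical_curl \<phi> x)))"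

definition Hcurl :: "(real^3) set \<Rightarrow> (real^3 \<Rightarrow> complex^3) set" where
  "Hcurl D = {u. \<exists>c. has_curl D u c}"

section \<open>Tangential traces on the bounding planes\<close>

text \<open>
  A tangential field on a plane is represented by the Fourier transform
  $\hat g : \mathbb{R}^2 \to \mathbb{C}^2$ of its two tangential components.  The spaces
  $H^{-1/2}(\mathrm{curl})$ and $H^{-1/2}(\mathrm{div})$ are then weighted $L^2$ spaces, and their
  duality, extending the $L^2$ product, is the absolutely convergent integral \<open>trace_pairing\<close>.
\<close>

definition fourier2 :: "(real^2 \<Rightarrow> complex^2) \<Rightarrow> real^2 \<Rightarrow> complex^2" where
  "fourier2 f \<xi> = complex_of_real (1 / (2 * pi)) *s
     (LINT \<rho>|lborel. exp (- \<i> * complex_of_real (\<rho> \<bullet> \<xi>)) *s f \<rho>)"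

definition Hcurl_trace_density :: "(real^2 \<Rightarrow> complex^2) \<Rightarrow> real^2 \<Rightarrow> real" where
  "Hcurl_trace_density g \<xi> = (1 + (norm \<xi>)\<^sup>2) powr (- 1 / 2) *
     ((norm (g \<xi>))\<^sup>2 + (cmod (\<xi> $ 1 * g \<xi> $ 2 - \<xi> $ 2 * g \<xi> $ 1))\<^sup>2)"

definition Hcurl_trace :: "(real^2 \<Rightarrow> complex^2) set" where
  "Hcurl_trace = {g. g \<in> borel_measurable lborel \<and> integrable lborel (Hcurl_trace_density g)}"

definition Hcurl_trace_norm :: "(real^2 \<Rightarrow> complex^2) \<Rightarrow> real" where
  "Hcurl_trace_norm g = sqrt (LINT \<xi>|lborel. Hcurl_trace_density g \<xi>)"

definition Hdiv_trace_density :: "(real^2 \<Rightarrow> complex^2) \<Rightarrow> real^2 \<Rightarrow> real" where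
  "Hdiv_trace_density g \<xi> = (1 + (norm \<xi>)\<^sup>2) powr (- 1 / 2) *
     ((norm (g \<xi>))\<^sup>2 + (cmod (\<xi> $ 1 * g \<xi> $ 1 + \<xi> $ 2 * g \<xi> $ 2))\<^sup>2)"

definition Hdiv_trace :: "(real^2 \<Rightarrow> complex^2) set" where
  "Hdiv_trace = {g. g \<in> borel_measurable lborel \<and> integrable lborel (Hdiv_trace_density g)}"

definition Hdiv_trace_norm :: "(real^2 \<Rightarrow> complex^2) \<Rightarrow> real" where
  "Hdiv_trace_norm g = sqrt (LINT \<xi>|lborel. Hdiv_trace_density g \<xi>)"

definition trace_pairing :: "(real^2 \<Rightarrow> complex^2) \<Rightarrow> (real^2 \<Rightarrow> complex^2) \<Rightarrow> complex" where
  "trace_pairing g k = (LINT \<xi>|lborel. cdot (g \<xi>) (k \<xi>))"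

text \<open>The tangential components of a continuous field on the plane \<open>x $ 3 = a\<close>.\<close>
definition plane_restriction :: "real \<Rightarrow> (real^3 \<Rightarrow> complex^3) \<Rightarrow> real^2 \<Rightarrow> complex^2" where
  "plane_restriction a \<phi> \<rho> =
     vector [\<phi> (vector [\<rho> $ 1, \<rho> $ 2, a]) $ 1, \<phi> (vector [\<rho> $ 1, \<rho> $ 2, a]) $ 2]"

text \<open>The tangential components of $n_j \times g$ for tangential \<open>g\<close>.\<close>
definition normal_cross :: "nat \<Rightarrow> complex^2 \<Rightarrow> complex^2" where
  "normal_cross j g = vector [- normal_sign j * g $ 2, normal_sign j * g $ 1]"

text \<open>
  \<open>g j\<close> is the tangential trace $n_j \times (u \times n_j)$ of \<open>u\<close> on the plane \<open>x $ 3 = h j\<close>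
  (in Fourier representation), where \<open>c\<close> is the curl of \<open>u\<close>.  As usual for $H(\mathrm{curl})$ fields,
  the traces are characterised by Green's formula
  $\int_\Omega (\nabla \times u) \cdot \bar\phi - u \cdot (\nabla \times \bar\phi)
     = \sum_j \langle n_j \times u, \phi \rangle_{\Gamma_j}$.
\<close>
definition tangential_traces ::
    "(nat \<Rightarrow> real) \<Rightarrow> (real^3 \<Rightarrow> complex^3) \<Rightarrow> (real^3 \<Rightarrow> complex^3) \<Rightarrow> (nat \<Rightarrow> real^2 \<Rightarrow> complex^2) \<Rightarrow> bool" where
  "tangential_traces h u c g \<longleftrightarrow>
     (\<forall>j\<in>{1, 2}. g j \<in> Hcurl_trace) \<and>
     (\<forall>\<phi>\<in>test_fields UNIV.
        (LINT x:slab h|lborel. cdot (c x) (\<phi> x) - cdot (u x) (classical_curl \<phi> x))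
        = (\<Sum>j\<in>{1, 2}. trace_pairing (\<lambda>\<xi>. normal_cross j (g j \<xi>)) (fourier2 (plane_restriction (h j) \<phi>))))"

section \<open>The boundary operators\<close>

text \<open>
  \<open>csqrt\<close> is the root with positive real part here: for \<open>Re s > 0\<close> and \<open>e, m > 0\<close> the radicand avoids
  the closed negative real axis.
\<close>
definition beta :: "real \<Rightarrow> real \<Rightarrow> complex \<Rightarrow> real^2 \<Rightarrow> complex" where
  "beta e m s \<xi> = csqrt (complex_of_real (e * m) * s\<^sup>2 + complex_of_real ((norm \<xi>)\<^sup>2))"

definition B_op :: "real \<Rightarrow> real \<Rightarrow> complex \<Rightarrow> (real^2 \<Rightarrow> complex^2) \<Rightarrow> real^2 \<Rightarrow> complex^2" where
  "B_op e m s g \<xi> = (1 / (complex_of_real m * s * beta e m s \<xi>)) *s vector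
     [complex_of_real (e * m) * s\<^sup>2 * g \<xi> $ 1 + \<xi> $ 2 * (\<xi> $ 2 * g \<xi> $ 1 - \<xi> $ 1 * g \<xi> $ 2),
      complex_of_real (e * m) * s\<^sup>2 * g \<xi> $ 2 + \<xi> $ 1 * (\<xi> $ 1 * g \<xi> $ 2 - \<xi> $ 2 * g \<xi> $ 1)]"

definition laplace :: "(real \<Rightarrow> real^2 \<Rightarrow> complex^2) \<Rightarrow> complex \<Rightarrow> real^2 \<Rightarrow> complex^2" where
  "laplace u s \<xi> = (LINT t:{0<..}|lborel. exp (- s * complex_of_real t) *s u t \<xi>)"

definition laplace_transformable ::
    "real \<Rightarrow> (real^2 \<Rightarrow> complex^2) set \<Rightarrow> ((real^2 \<Rightarrow> complex^2) \<Rightarrow> real) \<Rightarrow> (real \<Rightarrow> real^2 \<Rightarrow> complex^2) \<Rightarrow> bool" where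
  "laplace_transformable \<sigma>0 X N u \<longleftrightarrow>
     (\<forall>\<sigma>>\<sigma>0. (\<lambda>t \<xi>. exp (- \<sigma> * t) *\<^sub>R u t \<xi>) \<in> bochner_L1 {0<..} UNIV X N)"

text \<open>
  \<open>is_C_op e m u v\<close> means $v = (\mathcal{L}^{-1} \circ s\mathcal{B} \circ \mathcal{L})[u]$, where the
  inverse Laplace transform of \<open>G\<close> is the (a.e. unique) Laplace transformable \<open>v\<close> with transform \<open>G\<close>
  on some half-plane \<open>Re s > \<sigma>0\<close>.  As \<open>s * B\<close> maps $H^{-1/2}(\mathrm{curl})$ to
  $H^{-1/2}(\mathrm{div})$, these are the value spaces of \<open>u\<close> and \<open>v\<close>.
\<close>
definition is_C_op :: "real \<Rightarrow> real \<Rightarrow> (real \<Rightarrow> real^2 \<Rightarrow> complex^2) \<Rightarrow> (real \<Rightarrow> real^2 \<Rightarrow> complex^2) \<Rightarrow> bool" where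
  "is_C_op e m u v \<longleftrightarrow> (\<exists>\<sigma>0\<ge>0.
     laplace_transformable \<sigma>0 Hcurl_trace Hcurl_trace_norm u \<and>
     laplace_transformable \<sigma>0 Hdiv_trace Hdiv_trace_norm v \<and>
     (\<forall>s. Re s > \<sigma>0 \<longrightarrow> (AE \<xi> in lborel. laplace v s \<xi> = s *s B_op e m s (laplace u s) \<xi>)))"

section \<open>The variational problem\<close>

text \<open>
  \<open>y'' = r\<close> a.e. on $(0,\infty)$ with \<open>y' 0 = y1\<close>: \<open>y\<close> is continuously differentiable on $[0,\infty)$
  and \<open>y'\<close> is locally absolutely continuous with derivative \<open>r\<close>.
\<close>
definition second_time_derivative :: "(real \<Rightarrow> complex) \<Rightarrow> complex \<Rightarrow> (real \<Rightarrow> complex) \<Rightarrow> bool" where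
  "second_time_derivative y y1 r \<longleftrightarrow> (\<exists>y'. \<forall>t\<ge>0.
     (y has_vector_derivative y' t) (at t within {0..}) \<and>
     set_integrable lborel {0..t} r \<and>
     y' t = y1 + (LINT \<tau>:{0..t}|lborel. r \<tau>))"

text \<open>
  Weak solutions: $\partial_t^2 E$ is understood in the usual weak sense, i.e.
  $\int_\Omega \varepsilon\, \partial_t^2 E \cdot \bar w$ is the second time derivative of
  $\int_\Omega \varepsilon E \cdot \bar w$ for each fixed \<open>w\<close>.  If \<open>E\<close> is twice weakly differentiable in
  time with values in $L^2(\Omega)$, this is the literal integral.  In time, \<open>E\<close> is only required
  to be locally integrable on $[0,\infty)$ with values in $H(\mathrm{curl},\Omega)$.
  \<open>curlE\<close>, \<open>u j\<close>, \<open>v j\<close> are the curl of \<open>E\<close>, its tangential traces, and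
  $\mathcal{C}_j[E_{\Gamma_j}]$; the parameters \<open>ej\<close>, \<open>mj\<close> are the constant values of \<open>eps\<close>, \<open>mu\<close>
  in the two outer half-spaces.
\<close>
definition variational_solution ::
    "(nat \<Rightarrow> real) \<Rightarrow> (real^3 \<Rightarrow> real) \<Rightarrow> (real^3 \<Rightarrow> real) \<Rightarrow> (nat \<Rightarrow> real) \<Rightarrow> (nat \<Rightarrow> real) \<Rightarrow>
     (real^3 \<Rightarrow> complex^3) \<Rightarrow> (real^3 \<Rightarrow> complex^3) \<Rightarrow> (real \<Rightarrow> real^3 \<Rightarrow> complex^3) \<Rightarrow>
     (real \<Rightarrow> real^3 \<Rightarrow> complex^3) \<Rightarrow> bool" where
  "variational_solution h eps mu ej mj E0 E1 F E \<longleftrightarrow>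
     (\<forall>t>0. E t \<in> Hcurl (slab h)) \<and>
     (AE x\<in>slab h in lborel. E 0 x = E0 x) \<and>
     (AE t\<in>{0<..} in lborel. F t \<in> L2_space (slab h)) \<and>
     (\<exists>curlE u v.
        (\<forall>t>0. has_curl (slab h) (E t) (curlE t)) \<and>
        (\<forall>T>0. E \<in> L1_L2 T (slab h) \<and> curlE \<in> L1_L2 T (slab h)) \<and>
        (\<forall>t>0. tangential_traces h (E t) (curlE t) (\<lambda>j. u j t)) \<and>
        (\<forall>j\<in>{1, 2}. is_C_op (ej j) (mj j) (u j) (v j)) \<and>
        (\<forall>w curlw k. has_curl (slab h) w curlw \<longrightarrow> tangential_traces h w curlw k \<longrightarrow>
           second_time_derivative
             (\<lambda>t. LINT x:slab h|lborel. eps x *\<^sub>R cdot (E t x) (w x))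
             (LINT x:slab h|lborel. eps x *\<^sub>R cdot (E1 x) (w x))
             (\<lambda>t. - (LINT x:slab h|lborel. inverse (mu x) *\<^sub>R cdot (curlE t x) (curlw x))
                  - (LINT x:slab h|lborel. cdot (F t x) (w x))
                  - (\<Sum>j\<in>{1, 2}. trace_pairing (v j t) (k j)))))"

end

theory Submission
  imports Defs "HOL-Probability.Probability" "HOL-Real_Asymp.Real_Asymp"
begin

text \<open>
  The energy argument tests the equation with \<open>E\<close> and integrates it once in time, so that the boundary
  terms become \<open>\<langle>B E, E\<rangle>\<close>, with a kernel of positive type.  Since \<open>E\<close> is only integrable in time, everything is
  mollified in time by a causal kernel \<open>\<rho>\<close> of mass one with primitive \<open>R\<close>: writing the equation with the fixed
  test function \<open>E(r)\<close>, weighting it by \<open>\<rho>(t - s) \<rho>(t - r)\<close> and integrating over \<open>s\<close>, \<open>r\<close> and \<open>t\<close> gives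
  an exact energy identity for \<open>\<rho> * E\<close>, whose right-hand side is at most
  \<open>sup \<parallel>\<rho> * E\<parallel> (\<parallel>E0\<parallel> + T \<parallel>E1\<parallel> + T \<parallel>F\<parallel>)\<close> because \<open>\<integral>\<rho> = 1\<close> and \<open>0 \<le> R \<le> 1\<close>.  The resulting bound
  is uniform in the width of \<open>\<rho>\<close> and passes to the limit after pairing with \<open>E(t)\<close>.

  For the sign of the boundary term, at a fixed frequency \<open>\<xi>\<close> the components along and across \<open>\<xi>\<close> decouple,
  with symbols proportional to \<open>s / sqrt (s\<^sup>2 + \<kappa>\<^sup>2)\<close> and \<open>sqrt (s\<^sup>2 + \<kappa>\<^sup>2) / s\<close>.  Both are positive
  superpositions, over \<open>\<omega> = sqrt (\<kappa>\<^sup>2 + z\<^sup>2)\<close>, of the Laplace transforms \<open>s / (s\<^sup>2 + \<omega>\<^sup>2)\<close> of \<open>cos (\<omega> t)\<close>, and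
  convolution with a cosine is positive.  Hence only Laplace transforms at real (even integer) \<open>s\<close>
  are needed.
\<close>

subsection \<open>Integrable functions of time with values in \<open>L\<^sup>2\<close>\<close>

text \<open>Testing with the field at the same time is not possible: a product of two functions that
  are merely integrable in time need not be integrable. At two independent times it is integrable on
  the plane by Fubini, and the double mollification only sees that plane. Hence every quadratic term
  is kept as a function of a pair of times. The restriction to integer \<open>s\<close> is forced by
  the order of quantifiers in \<open>is_C_op\<close>: the exceptional null set of frequencies
  depends on \<open>s\<close>, and a common one is at hand only for countably many \<open>s\<close>.
  Positivity at a fixed frequency therefore rests on a uniqueness theorem for integer arguments, not
  on Plancherel along a vertical line. The multiplier of the component across \<open>\<xi>\<close>
  grows like \<open>s\<close>, so it is not the transform of a function. The comparison is made
  after \<open>v\<close> is convolved with \<open>R\<close>, which supplies a factor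
  \<open>1 / s\<close>, and \<open>u\<close> with \<open>\<rho>\<close>, whose two bounded
  derivatives make the superposition over \<omega> converge. For this component the superposition
  also has an atom at \<omega> = 0, the term \<open>c0\<close> below.\<close>

abbreviation lborel2 :: "('a::euclidean_space \<times> 'b::euclidean_space) measure" where
  "lborel2 \<equiv> lborel \<Otimes>\<^sub>M lborel"

definition l2n :: "'x measure \<Rightarrow> ('x \<Rightarrow> 'b::euclidean_space) \<Rightarrow> real" where
  "l2n M f = sqrt (LINT x|M. (norm (f x))\<^sup>2)"

definition sq_integrable :: "'x measure \<Rightarrow> ('x \<Rightarrow> 'b::euclidean_space) \<Rightarrow> bool" where
  "sq_integrable M f \<longleftrightarrow> f \<in> borel_measurable M \<and> integrable M (\<lambda>x. (norm (f x))\<^sup>2)"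

text \<open>Stands for the Bochner space L^1(R; L^2(M)), with joint measurability in place of strong
  measurability. \<open>M\<close> is general because the same estimates are applied to fields over
  space and to traces over frequencies.\<close>

definition time_L2 :: "'x measure \<Rightarrow> (real \<Rightarrow> 'x \<Rightarrow> 'b::euclidean_space) \<Rightarrow> bool" where
  "time_L2 M a \<longleftrightarrow> (\<lambda>p. a (fst p) (snd p)) \<in> borel_measurable (lborel \<Otimes>\<^sub>M M) \<and>
     (AE t in lborel. sq_integrable M (a t)) \<and> integrable lborel (\<lambda>t. l2n M (a t))"

lemma l2n_nonneg [simp]: "0 \<le> l2n M f"
  by (simp add: l2n_def)

lemma l2n_power2: "(l2n M f)\<^sup>2 = (LINT x|M. f x \<bullet> f x)"
  by (simp add: l2n_def power2_norm_eq_inner)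

lemma Cauchy_Schwarz_norm:
  fixes f :: "'x \<Rightarrow> 'b::euclidean_space" and g :: "'x \<Rightarrow> 'c::euclidean_space"
  assumes "sq_integrable M f" "sq_integrable M g"
  shows "integrable M (\<lambda>x. norm (f x) * norm (g x))"
    and "(LINT x|M. norm (f x) * norm (g x)) \<le> l2n M f * l2n M g"
proof -
  have [measurable]: "f \<in> borel_measurable M" "g \<in> borel_measurable M"
    and f2: "integrable M (\<lambda>x. (norm (f x))\<^sup>2)" and g2: "integrable M (\<lambda>x. (norm (g x))\<^sup>2)"
    using assms by (auto simp: sq_integrable_def)
  show I: "integrable M (\<lambda>x. norm (f x) * norm (g x))"
  proof (rule Bochner_Integration.integrable_bound[OF Bochner_Integration.integrable_add[OF f2 g2]])
    have "norm (f x) * norm (g x) \<le> (norm (f x))\<^sup>2 + (norm (g x))\<^sup>2" for x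
    proof -
      have "2 * norm (f x) * norm (g x) \<le> (norm (f x))\<^sup>2 + (norm (g x))\<^sup>2" by (rule sum_squares_bound)
      moreover have "0 \<le> norm (f x) * norm (g x)" by simp
      ultimately show ?thesis by linarith
    qed
    then show "AE x in M. norm (norm (f x) * norm (g x)) \<le> norm ((norm (f x))\<^sup>2 + (norm (g x))\<^sup>2)"
      by auto
  qed auto
  have "ennreal ((LINT x|M. norm (f x) * norm (g x))\<^sup>2) = (\<integral>\<^sup>+x. ennreal (norm (f x)) * ennreal (norm (g x)) \<partial>M)\<^sup>2"
    by (subst ennreal_power[symmetric]) (auto simp: nn_integral_eq_integral[OF I] ennreal_mult[symmetric] intro!: integral_nonneg)
  also have "\<dots> \<le> (\<integral>\<^sup>+x. (ennreal (norm (f x)))\<^sup>2 \<partial>M) * (\<integral>\<^sup>+x. (ennreal (norm (g x)))\<^sup>2 \<partial>M)"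
    by (rule Cauchy_Schwarz_nn_integral) auto
  also have "\<dots> = ennreal ((l2n M f * l2n M g)\<^sup>2)"
    by (simp add: ennreal_power nn_integral_eq_integral[OF f2] nn_integral_eq_integral[OF g2]
        power_mult_distrib l2n_def ennreal_mult)
  finally have "(LINT x|M. norm (f x) * norm (g x))\<^sup>2 \<le> (l2n M f * l2n M g)\<^sup>2"
    by (simp add: ennreal_le_iff)
  then show "(LINT x|M. norm (f x) * norm (g x)) \<le> l2n M f * l2n M g"
    by (rule power2_le_imp_le) simp
qed

lemma Cauchy_Schwarz_inner:
  fixes f g :: "'x \<Rightarrow> 'b::euclidean_space"
  assumes "sq_integrable M f" "sq_integrable M g"
  shows "integrable M (\<lambda>x. f x \<bullet> g x)"
    and "\<bar>LINT x|M. f x \<bullet> g x\<bar> \<le> l2n M f * l2n M g"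
proof -
  have [measurable]: "f \<in> borel_measurable M" "g \<in> borel_measurable M"
    using assms by (auto simp: sq_integrable_def)
  note CS = Cauchy_Schwarz_norm[OF assms]
  show I: "integrable M (\<lambda>x. f x \<bullet> g x)"
    by (rule Bochner_Integration.integrable_bound[OF CS(1)]) (auto simp: Cauchy_Schwarz_ineq2)
  have "\<bar>LINT x|M. f x \<bullet> g x\<bar> \<le> (LINT x|M. \<bar>f x \<bullet> g x\<bar>)"
    by (rule integral_abs_bound)
  also have "\<dots> \<le> (LINT x|M. norm (f x) * norm (g x))"
    using I by (intro integral_mono) (auto simp: CS(1) Cauchy_Schwarz_ineq2)
  finally show "\<bar>LINT x|M. f x \<bullet> g x\<bar> \<le> l2n M f * l2n M g" using CS(2) by linarith
qed

section \<open>Pairings of fields at two independent times\<close>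

lemma sigma_finite_lborel2: "sigma_finite_measure (lborel2 :: (real \<times> real) measure)"
  by (simp add: lborel_prod lborel.sigma_finite_measure_axioms)

lemma time_L2_measurable [measurable_dest]:
  "time_L2 M a \<Longrightarrow> (\<lambda>p. a (fst p) (snd p)) \<in> borel_measurable (lborel \<Otimes>\<^sub>M M)"
  by (simp add: time_L2_def)

lemma time_L2_compose:
  assumes "time_L2 M a" and [measurable]: "f \<in> measurable N lborel" "g \<in> measurable N M"
  shows "(\<lambda>z. a (f z) (g z)) \<in> borel_measurable N"
  using measurable_compose[OF _ time_L2_measurable[OF assms(1)], of "\<lambda>z. (f z, g z)" N] by simp

lemma AE_pair_fst:
  assumes "sigma_finite_measure M2" "AE x in M1. P x"
  shows "AE p in M1 \<Otimes>\<^sub>M M2. P (fst p)"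
proof -
  interpret sigma_finite_measure M2 by fact
  obtain N where N: "N \<in> sets M1" "emeasure M1 N = 0" "{x\<in>space M1. \<not> P x} \<subseteq> N"
    using assms(2) unfolding eventually_ae_filter by auto
  show ?thesis
  proof (rule AE_I)
    show "{p \<in> space (M1 \<Otimes>\<^sub>M M2). \<not> P (fst p)} \<subseteq> N \<times> space M2"
      using N(3) by (auto simp: space_pair_measure)
  qed (use N in \<open>auto simp: emeasure_pair_measure_Times\<close>)
qed

lemma AE_pair_snd:
  assumes "sigma_finite_measure M2" "AE x in M2. P x"
  shows "AE p in M1 \<Otimes>\<^sub>M M2. P (snd p)"
proof -
  interpret sigma_finite_measure M2 by fact
  obtain N where N: "N \<in> sets M2" "emeasure M2 N = 0" "{x\<in>space M2. \<not> P x} \<subseteq> N"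
    using assms(2) unfolding eventually_ae_filter by auto
  show ?thesis
  proof (rule AE_I)
    show "{p \<in> space (M1 \<Otimes>\<^sub>M M2). \<not> P (snd p)} \<subseteq> space M1 \<times> N"
      using N(3) by (auto simp: space_pair_measure)
  qed (use N in \<open>auto simp: emeasure_pair_measure_Times\<close>)
qed

text \<open>Cauchy-Schwarz in the space variable bounds the inner integral by
  \<open>l2n M (a s) * l2n M (b r)\<close>, a product of integrable functions of two separate times.
  On the line \<open>s = r\<close> the same product could fail to be integrable.\<close>

lemma integrable_time_product_norm:
  fixes a :: "real \<Rightarrow> 'x \<Rightarrow> 'b::euclidean_space" and b :: "real \<Rightarrow> 'x \<Rightarrow> 'c::euclidean_space"
  assumes "sigma_finite_measure M" and a: "time_L2 M a" and b: "time_L2 M b"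
  shows "integrable (lborel2 \<Otimes>\<^sub>M M) (\<lambda>z. norm (a (fst (fst z)) (snd z)) * norm (b (snd (fst z)) (snd z)))"
proof -
  interpret M: sigma_finite_measure M by fact
  interpret S: sigma_finite_measure "lborel2 :: (real \<times> real) measure"
    by (rule sigma_finite_lborel2)
  interpret P: pair_sigma_finite "lborel2 :: (real \<times> real) measure" M ..
  have [measurable]: "(\<lambda>z. a (fst (fst z)) (snd z)) \<in> borel_measurable (lborel2 \<Otimes>\<^sub>M M)"
     "(\<lambda>z. b (snd (fst z)) (snd z)) \<in> borel_measurable (lborel2 \<Otimes>\<^sub>M M)"
    by (auto intro!: time_L2_compose[OF a] time_L2_compose[OF b])
  have A: "AE t in lborel. sq_integrable M (a t)" "integrable lborel (\<lambda>t. l2n M (a t))"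
    and B: "AE t in lborel. sq_integrable M (b t)" "integrable lborel (\<lambda>t. l2n M (b t))"
    using a b by (auto simp: time_L2_def)
  have aeA: "AE p in lborel2. sq_integrable M (a (fst p))"
    and aeB: "AE p in lborel2. sq_integrable M (b (snd p))"
    by (auto intro!: AE_pair_fst[where P="\<lambda>t. sq_integrable M (a t)"] AE_pair_snd[where P="\<lambda>t. sq_integrable M (b t)"] A B lborel.sigma_finite_measure_axioms)
  have bd: "integrable lborel2 (\<lambda>p. l2n M (a (fst p)) * l2n M (b (snd p)))"
    using lborel_pair.Fubini_integrable[of "\<lambda>p. l2n M (a (fst p)) * l2n M (b (snd p))"] A(2) B(2)
    by (auto simp: abs_mult)
  show ?thesis
  proof (rule P.Fubini_integrable)
    show "AE p in lborel2. integrable M (\<lambda>x. norm (a (fst (fst (p, x))) (snd (p, x))) * norm (b (snd (fst (p, x))) (snd (p, x))))"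
      using aeA aeB by eventually_elim (simp add: Cauchy_Schwarz_norm)
    show "integrable lborel2 (\<lambda>p. LINT x|M. norm (norm (a (fst (fst (p, x))) (snd (p, x))) * norm (b (snd (fst (p, x))) (snd (p, x)))))"
    proof (rule Bochner_Integration.integrable_bound[OF bd])
      show "AE p in lborel2. norm (LINT x|M. norm (norm (a (fst (fst (p, x))) (snd (p, x))) * norm (b (snd (fst (p, x))) (snd (p, x)))))
        \<le> norm (l2n M (a (fst p)) * l2n M (b (snd p)))"
        using aeA aeB by eventually_elim (auto simp: abs_mult Cauchy_Schwarz_norm)
    qed measurable
  qed measurable
qed

definition cross :: "'x measure \<Rightarrow> (real \<Rightarrow> 'x \<Rightarrow> 'b::euclidean_space) \<Rightarrow> (real \<Rightarrow> 'x \<Rightarrow> 'b) \<Rightarrow> real \<times> real \<Rightarrow> real" where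
  "cross M a b p = (LINT x|M. a (fst p) x \<bullet> b (snd p) x)"

text \<open>A bounded kernel preserves the integrability of the triple integrand, so Fubini moves
  the space integral outside the two time integrals.\<close>

lemma
  fixes a b :: "real \<Rightarrow> 'x \<Rightarrow> 'b::euclidean_space" and k :: "real \<times> real \<Rightarrow> real"
  assumes M: "sigma_finite_measure M" and a: "time_L2 M a" and b: "time_L2 M b"
    and k [measurable]: "k \<in> borel_measurable lborel2" and K: "\<And>p. \<bar>k p\<bar> \<le> K"
  shows integrable_cross_kernel: "integrable lborel2 (\<lambda>p. k p * cross M a b p)" (is ?I)
    and integrable_inner_kernel:
      "integrable M (\<lambda>x. LINT p|lborel2. k p * (a (fst p) x \<bullet> b (snd p) x))" (is ?J)
    and integral_cross_kernel:
      "(LINT p|lborel2. k p * cross M a b p) =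
        (LINT x|M. LINT p|lborel2. k p * (a (fst p) x \<bullet> b (snd p) x))" (is ?E)
proof -
  interpret M: sigma_finite_measure M by fact
  interpret S: sigma_finite_measure "lborel2 :: (real \<times> real) measure"
    by (rule sigma_finite_lborel2)
  interpret P: pair_sigma_finite "lborel2 :: (real \<times> real) measure" M ..
  have [measurable]: "(\<lambda>z. a (fst (fst z)) (snd z)) \<in> borel_measurable (lborel2 \<Otimes>\<^sub>M M)"
     "(\<lambda>z. b (snd (fst z)) (snd z)) \<in> borel_measurable (lborel2 \<Otimes>\<^sub>M M)"
    by (auto intro!: time_L2_compose[OF a] time_L2_compose[OF b])
  define G where "G = (\<lambda>p x. k p * (a (fst p) x \<bullet> b (snd p) x))"
  have G: "integrable (lborel2 \<Otimes>\<^sub>M M) (case_prod G)"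
  proof (rule Bochner_Integration.integrable_bound[OF integrable_mult_right[OF integrable_time_product_norm[OF M a b], of K]])
    show "case_prod G \<in> borel_measurable (lborel2 \<Otimes>\<^sub>M M)"
      unfolding G_def split_beta' by measurable
    have "\<bar>k p * (a (fst p) x \<bullet> b (snd p) x)\<bar> \<le> \<bar>K * (norm (a (fst p) x) * norm (b (snd p) x))\<bar>" for p x
      unfolding abs_mult by (intro mult_mono order_trans[OF K]) (auto simp: abs_mult[symmetric] Cauchy_Schwarz_ineq2)
    then show "AE z in lborel2 \<Otimes>\<^sub>M M. norm (case_prod G z) \<le> norm (K * (norm (a (fst (fst z)) (snd z)) * norm (b (snd (fst z)) (snd z))))"
      by (auto simp: G_def split_beta')
  qed
  show ?I using P.integrable_fst[OF G] by (simp add: G_def cross_def)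
  show ?J using P.integrable_snd[OF G] by (simp add: G_def)
  show ?E using P.integral_fst[OF G] P.integral_snd[OF G] by (simp add: G_def cross_def)
qed

lemma integrable_cross:
  assumes "sigma_finite_measure M" "time_L2 M a" "time_L2 M b"
  shows "integrable lborel2 (cross M a b)"
  using integrable_cross_kernel[OF assms, of "\<lambda>_. 1" 1] by simp

lemma time_L2_const:
  assumes "sq_integrable M w" "h \<in> borel_measurable borel" "integrable lborel h"
  shows "time_L2 M (\<lambda>t x. h t *\<^sub>R w x)"
proof -
  have [measurable]: "w \<in> borel_measurable M" "h \<in> borel_measurable borel"
    and w: "integrable M (\<lambda>x. (norm (w x))\<^sup>2)"
    using assms by (auto simp: sq_integrable_def)
  have "l2n M (\<lambda>x. h t *\<^sub>R w x) = \<bar>h t\<bar> * l2n M w" for t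
    by (simp add: l2n_def power_mult_distrib real_sqrt_mult)
  moreover have "sq_integrable M (\<lambda>x. h t *\<^sub>R w x)" for t
    unfolding sq_integrable_def by (simp add: power_mult_distrib w)
  ultimately show ?thesis
    unfolding time_L2_def using assms(3) by (auto intro!: integrable_mult_left)
qed

text \<open>The indicator of a set \<open>A i\<close> of finite measure, spread over the time
  interval [0,1], is an admissible second factor in \<open>integrable_time_product_norm\<close>; for
  almost every \<open>x\<close> that product is integrable in both times, and the second factor is
  then removed.\<close>

lemma AE_integrable_time:
  fixes a :: "real \<Rightarrow> 'x \<Rightarrow> 'b::euclidean_space"
  assumes M: "sigma_finite_measure M" and a: "time_L2 M a"
  shows "AE x in M. integrable lborel (\<lambda>t. a t x)"
proof -
  interpret M: sigma_finite_measure M by fact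
  interpret S: sigma_finite_measure "lborel2 :: (real \<times> real) measure"
    by (rule sigma_finite_lborel2)
  interpret P: pair_sigma_finite "lborel2 :: (real \<times> real) measure" M ..
  obtain A :: "nat \<Rightarrow> 'x set" where A: "range A \<subseteq> sets M" "(\<Union>i. A i) = space M" "\<And>i. emeasure M (A i) \<noteq> \<infinity>"
    using M.sigma_finite by metis
  have "AE x in M. x \<in> A i \<longrightarrow> integrable lborel (\<lambda>t. a t x)" for i
  proof -
    have [measurable]: "A i \<in> sets M" using A(1) by auto
    have "sq_integrable M (\<lambda>x. indicator (A i) x :: real)"
    proof -
      have "(\<lambda>x. (norm (indicator (A i) x :: real))\<^sup>2) = indicator (A i)"
        by (auto simp: indicator_def)
      then show ?thesis
        using A(3)[of i] unfolding sq_integrable_def by (auto intro!: integrable_real_indicator simp: top.not_eq_extremum)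
    qed
    then have "time_L2 M (\<lambda>t x. indicator {0..1::real} t *\<^sub>R (indicator (A i) x :: real))"
      by (rule time_L2_const) auto
    from P.AE_integrable_snd[OF integrable_time_product_norm[OF M a this, unfolded split_beta'[symmetric, where f="\<lambda>p x. norm (a (fst p) x) * norm (indicator {0..1::real} (snd p) *\<^sub>R (indicator (A i) x :: real))"]]]
    have "AE x in M. integrable lborel2 (\<lambda>p. norm (a (fst p) x) * norm (indicator {0..1::real} (snd p) *\<^sub>R (indicator (A i) x :: real)))"
      by simp
    then show ?thesis
    proof (eventually_elim, intro impI)
      fix x assume x: "x \<in> A i" and I: "integrable lborel2 (\<lambda>p. norm (a (fst p) x) * norm (indicator {0..1::real} (snd p) *\<^sub>R (indicator (A i) x :: real)))"
      have "x \<in> space M" using x A by auto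
      then have [measurable]: "(\<lambda>t. a t x) \<in> borel_measurable lborel"
        by (intro time_L2_compose[OF a]) auto
      have "integrable lborel2 (\<lambda>(s, t). norm (a s x) * indicator {0..1::real} t)"
        using I x by (simp add: split_beta')
      from lborel_pair.AE_integrable_snd[OF this]
      have ae: "AE t in lborel. integrable lborel (\<lambda>s. norm (a s x) * indicator {0..1::real} t)" .
      \<comment> \<open>Integrability in \<open>s\<close> holds for almost every \<open>t\<close>,
        and [0,1] is not a null set; so some \<open>t\<close> in it qualifies, and there the
        indicator is 1.\<close>
      have "\<exists>t\<in>{0..1}. integrable lborel (\<lambda>s. norm (a s x) * indicator {0..1::real} t)"
      proof (rule ccontr)
        assume "\<not> ?thesis"
        then have "AE t in lborel. t \<notin> {0..1::real}"
          using ae by (auto elim!: eventually_mono)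
        then have "emeasure lborel {0..1::real} = 0"
          by (subst (asm) AE_iff_null_sets[symmetric]) (auto dest: null_setsD1)
        then show False by simp
      qed
      then have "integrable lborel (\<lambda>s. norm (a s x))" by auto
      then show "integrable lborel (\<lambda>t. a t x)"
        by (subst (asm) integrable_norm_iff) auto
    qed
  qed
  then have "AE x in M. \<forall>i. x \<in> A i \<longrightarrow> integrable lborel (\<lambda>t. a t x)"
    unfolding AE_all_countable by blast
  with AE_space show ?thesis
    by eventually_elim (use A(2) in auto)
qed

lemma integral_inner_product:
  fixes u v :: "real \<Rightarrow> 'b::euclidean_space"
  assumes u: "integrable lborel u" and v: "integrable lborel v"
  shows "integrable lborel2 (\<lambda>p. u (fst p) \<bullet> v (snd p))"
    and "(LINT p|lborel2. u (fst p) \<bullet> v (snd p)) = (LINT s|lborel. u s) \<bullet> (LINT t|lborel. v t)"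
proof -
  have [measurable]: "u \<in> borel_measurable borel" "v \<in> borel_measurable borel"
    using u v by (auto dest: borel_measurable_integrable)
  have I1: "integrable lborel2 (\<lambda>p. norm (u (fst p)) * norm (v (snd p)))"
    using lborel_pair.Fubini_integrable[of "\<lambda>p. norm (u (fst p)) * norm (v (snd p))"] u v
    by (auto simp: abs_mult)
  show I: "integrable lborel2 (\<lambda>p. u (fst p) \<bullet> v (snd p))"
    by (rule Bochner_Integration.integrable_bound[OF I1]) (auto simp: Cauchy_Schwarz_ineq2)
  show "(LINT p|lborel2. u (fst p) \<bullet> v (snd p)) = (LINT s|lborel. u s) \<bullet> (LINT t|lborel. v t)"
    using u v by (subst lborel_pair.integral_fst'[OF I, symmetric]) simp
qed

lemma integrable_bounded_scale:
  fixes u :: "real \<Rightarrow> 'b::euclidean_space"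
  assumes "integrable lborel u" "f \<in> borel_measurable borel" "\<And>t. \<bar>f t\<bar> \<le> K"
  shows "integrable lborel (\<lambda>t. f t *\<^sub>R u t)"
proof -
  have [measurable]: "u \<in> borel_measurable borel" "f \<in> borel_measurable borel" using assms by auto
  show ?thesis
    by (rule Bochner_Integration.integrable_bound[OF integrable_scaleR_right[OF assms(1), of K]])
      (auto intro!: mult_right_mono AE_I2 order_trans[OF assms(3)])
qed

text \<open>A kernel of product form lets the double time integral factor into an inner product of
  two time averages. For equal fields and kernels this is the squared norm of an average, which is
  how nonnegative terms are recognised later.\<close>

lemma
  fixes a b :: "real \<Rightarrow> 'x \<Rightarrow> 'b::euclidean_space" and f g :: "real \<Rightarrow> real"
  assumes M: "sigma_finite_measure M" and a: "time_L2 M a" and b: "time_L2 M b"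
    and [measurable]: "f \<in> borel_measurable borel" "g \<in> borel_measurable borel"
    and K: "\<And>t. \<bar>f t\<bar> \<le> K" "\<And>t. \<bar>g t\<bar> \<le> L"
  shows integrable_cross_tensor:
      "integrable lborel2 (\<lambda>p. f (fst p) * g (snd p) * cross M a b p)" (is ?I)
    and integral_cross_tensor:
      "(LINT p|lborel2. f (fst p) * g (snd p) * cross M a b p) =
        (LINT x|M. (LINT s|lborel. f s *\<^sub>R a s x) \<bullet> (LINT t|lborel. g t *\<^sub>R b t x))" (is ?E)
    and integrable_inner_tensor:
      "integrable M (\<lambda>x. (LINT s|lborel. f s *\<^sub>R a s x) \<bullet> (LINT t|lborel. g t *\<^sub>R b t x))" (is ?J)
proof -
  have K': "\<bar>f (fst p) * g (snd p)\<bar> \<le> K * L" for p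
    unfolding abs_mult by (intro mult_mono K) (auto intro: order_trans[OF _ K(1)])
  note cr = M a b _ K'
  show ?I by (rule integrable_cross_kernel[OF cr]) measurable
  have ae: "AE x in M. (LINT p|lborel2. f (fst p) * g (snd p) * (a (fst p) x \<bullet> b (snd p) x))
      = (LINT s|lborel. f s *\<^sub>R a s x) \<bullet> (LINT t|lborel. g t *\<^sub>R b t x)"
    using AE_integrable_time[OF M a] AE_integrable_time[OF M b]
  proof eventually_elim
    case (elim x)
    have "integrable lborel (\<lambda>s. f s *\<^sub>R a s x)" "integrable lborel (\<lambda>t. g t *\<^sub>R b t x)"
      using elim by (auto intro!: integrable_bounded_scale K)
    from integral_inner_product(2)[OF this] show ?case by (simp add: mult.assoc mult.left_commute)
  qed
  have [measurable]: "(\<lambda>x. LINT s|lborel. f s *\<^sub>R a s x) \<in> borel_measurable M"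
    "(\<lambda>x. LINT s|lborel. g s *\<^sub>R b s x) \<in> borel_measurable M"
    by (auto intro!: lborel.borel_measurable_lebesgue_integral borel_measurable_scaleR time_L2_compose[OF a] time_L2_compose[OF b] simp: split_beta')
  have J: "integrable M (\<lambda>x. LINT p|lborel2. f (fst p) * g (snd p) * (a (fst p) x \<bullet> b (snd p) x))"
    by (rule integrable_inner_kernel[OF cr]) measurable
  show ?J
  proof (rule integrable_cong_AE_imp[OF J])
    show "AE x in M. (LINT p|lborel2. f (fst p) * g (snd p) * (a (fst p) x \<bullet> b (snd p) x)) =
        (LINT s|lborel. f s *\<^sub>R a s x) \<bullet> (LINT t|lborel. g t *\<^sub>R b t x)"
      by (rule ae)
  qed measurable
  have "(LINT p|lborel2. f (fst p) * g (snd p) * cross M a b p)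
      = (LINT x|M. LINT p|lborel2. f (fst p) * g (snd p) * (a (fst p) x \<bullet> b (snd p) x))"
    by (rule integral_cross_kernel[OF cr]) measurable
  also have "\<dots> = (LINT x|M. (LINT s|lborel. f s *\<^sub>R a s x) \<bullet> (LINT t|lborel. g t *\<^sub>R b t x))"
    by (rule integral_cong_AE[OF borel_measurable_integrable[OF J] _ ae]) measurable
  finally show ?E .
qed

text \<open>The case of equal factors in \<open>integrable_inner_tensor\<close>, a qualitative form
  of the Minkowski integral inequality.\<close>

lemma sq_integrable_time_integral:
  fixes a :: "real \<Rightarrow> 'x \<Rightarrow> 'b::euclidean_space"
  assumes "sigma_finite_measure M" "time_L2 M a" "f \<in> borel_measurable borel" "\<And>t. \<bar>f t\<bar> \<le> K"
  shows "sq_integrable M (\<lambda>x. LINT s|lborel. f s *\<^sub>R a s x)"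
  unfolding sq_integrable_def
proof
  have [measurable]: "f \<in> borel_measurable borel" by fact
  show "(\<lambda>x. LINT s|lborel. f s *\<^sub>R a s x) \<in> borel_measurable M"
    by (auto intro!: lborel.borel_measurable_lebesgue_integral borel_measurable_scaleR time_L2_compose[OF assms(2)] simp: split_beta')
  show "integrable M (\<lambda>x. (norm (LINT s|lborel. f s *\<^sub>R a s x))\<^sup>2)"
    using integrable_inner_tensor[OF assms(1,2,2) assms(3,3) assms(4,4)] by (simp add: power2_norm_eq_inner)
qed

text \<open>The fixed field \<open>w\<close> is spread over the time interval [0,1] with total mass
  one, so that the result for two times also covers a pairing with a single time.\<close>

lemma
  fixes b :: "real \<Rightarrow> 'x \<Rightarrow> 'b::euclidean_space"
  assumes M: "sigma_finite_measure M" and w: "sq_integrable M w" and b: "time_L2 M b"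
    and g: "g \<in> borel_measurable borel" "\<And>t. \<bar>g t\<bar> \<le> L"
  shows integrable_inner_time: "integrable lborel (\<lambda>t. g t * (LINT x|M. w x \<bullet> b t x))"
    and integral_inner_time: "(LINT t|lborel. g t * (LINT x|M. w x \<bullet> b t x)) = (LINT x|M. w x \<bullet> (LINT t|lborel. g t *\<^sub>R b t x))"
proof -
  define a where "a = (\<lambda>s x. indicator {0..1::real} s *\<^sub>R w x)"
  have a: "time_L2 M a" unfolding a_def by (rule time_L2_const[OF w]) auto
  have one: "(\<lambda>_. 1 :: real) \<in> borel_measurable borel" "\<And>t::real. \<bar>1::real\<bar> \<le> 1" by auto
  have cr: "1 * g (snd p) * cross M a b p = indicator {0..1} (fst p) * (g (snd p) * (LINT x|M. w x \<bullet> b (snd p) x))" for p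
    by (simp add: cross_def a_def)
  note I = integrable_cross_tensor[OF M a b one(1) g(1) one(2) g(2), unfolded cr]
  note E = integral_cross_tensor[OF M a b one(1) g(1) one(2) g(2), unfolded cr]
  have avg: "(LINT s|lborel. indicator {0..1::real} s * c) = c" for c :: real by simp
  have I': "integrable lborel2 (\<lambda>(s, t). indicator {0..1::real} s * (g t * (LINT x|M. w x \<bullet> b t x)))"
    using I by (simp add: split_beta')
  show "integrable lborel (\<lambda>t. g t * (LINT x|M. w x \<bullet> b t x))"
    using lborel_pair.integrable_snd[OF I'] unfolding avg .
  show "(LINT t|lborel. g t * (LINT x|M. w x \<bullet> b t x)) = (LINT x|M. w x \<bullet> (LINT t|lborel. g t *\<^sub>R b t x))"
    using lborel_pair.integral_snd[OF I'] E unfolding avg by (simp add: split_beta' a_def)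
qed

subsection \<open>Convolution and Laplace transform on the half-line\<close>

definition conv :: "(real \<Rightarrow> real) \<Rightarrow> (real \<Rightarrow> real) \<Rightarrow> real \<Rightarrow> real" where
  "conv k f t = (LINT \<tau>|lborel. k (t - \<tau>) * f \<tau>)"

definition lap :: "(real \<Rightarrow> real) \<Rightarrow> real \<Rightarrow> real" where
  "lap f s = (LINT t|lborel. exp (- s * t) * f t)"

lemma integrable_conv_pair:
  assumes u: "integrable lborel u" and v: "integrable lborel (v :: real \<Rightarrow> real)"
  shows "integrable lborel2 (\<lambda>(\<tau>, t). u (t - \<tau>) * v \<tau> :: real)"
proof (rule lborel_pair.Fubini_integrable)
  have [measurable]: "u \<in> borel_measurable borel" "v \<in> borel_measurable borel" using u v by auto
  show "(\<lambda>(\<tau>, t). u (t - \<tau>) * v \<tau>) \<in> borel_measurable lborel2" by measurable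
  have sh: "integrable lborel (\<lambda>t. u (t - \<tau>))" for \<tau>
    using lborel_integrable_real_affine[OF u, of 1 "- \<tau>"] by simp
  have shi: "(LINT t|lborel. \<bar>u (t - \<tau>)\<bar>) = (LINT t|lborel. \<bar>u t\<bar>)" for \<tau>
    using lborel_integral_real_affine[of 1 "\<lambda>t. \<bar>u t\<bar>" "- \<tau>"] by simp
  show "integrable lborel (\<lambda>x. LBINT y. norm (case (x, y) of (\<tau>, t) \<Rightarrow> u (t - \<tau>) * v \<tau>))"
    by (simp add: abs_mult shi v)
  show "AE x in lborel. integrable lborel (\<lambda>y. case (x, y) of (\<tau>, t) \<Rightarrow> u (t - \<tau>) * v \<tau>)"
    using sh by simp
qed

lemma
  assumes u: "integrable lborel u" and v: "integrable lborel v"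
  shows integrable_conv: "integrable lborel (conv u v)"
    and integral_conv: "(LINT t|lborel. conv u v t) = (LINT t|lborel. u t) * (LINT t|lborel. v t)"
proof -
  note P = integrable_conv_pair[OF u v]
  show "integrable lborel (conv u v)"
    using lborel_pair.integrable_snd[OF P] by (simp add: conv_def[abs_def])
  have sh: "(LINT t|lborel. u (t - \<tau>)) = (LINT t|lborel. u t)" for \<tau>
    using lborel_integral_real_affine[of 1 u "- \<tau>"] by simp
  show "(LINT t|lborel. conv u v t) = (LINT t|lborel. u t) * (LINT t|lborel. v t)"
    using lborel_pair.integral_snd[OF P] lborel_pair.integral_fst[OF P]
    by (simp add: conv_def[abs_def] sh)
qed

lemma conv_exp: "exp (- s * t) * conv k f t = conv (\<lambda>t. exp (- s * t) * k t) (\<lambda>t. exp (- s * t) * f t) t"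
proof -
  have "exp (- s * t) * (k (t - \<tau>) * f \<tau>) = (exp (- s * (t - \<tau>)) * k (t - \<tau>)) * (exp (- s * \<tau>) * f \<tau>)" for \<tau>
    by (simp add: exp_diff exp_minus field_simps)
  then show ?thesis
    unfolding conv_def integral_mult_right_zero[symmetric] by presburger
qed

lemma
  assumes "integrable lborel (\<lambda>t. exp (- s * t) * k t)" "integrable lborel (\<lambda>t. exp (- s * t) * f t)"
  shows integrable_exp_conv: "integrable lborel (\<lambda>t. exp (- s * t) * conv k f t)"
    and lap_conv: "lap (conv k f) s = lap k s * lap f s"
  unfolding lap_def conv_exp using integrable_conv[OF assms] integral_conv[OF assms] by simp_all

section \<open>Uniqueness of the Laplace transform from its values at integers\<close>

text \<open>Positive and negative part of \<open>h\<close> are densities of two finite measures with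
  the same distribution function. Equal measures have densities that agree almost everywhere, and
  the two parts of a number agree only if both are 0.\<close>

lemma AE_zero_of_Iic:
  fixes h :: "real \<Rightarrow> real"
  assumes h: "integrable lborel h" and 0: "\<And>a. (LINT t|lborel. indicator {..a} t * h t) = 0"
  shows "AE t in lborel. h t = 0"
proof -
  have [measurable]: "h \<in> borel_measurable borel" using h by auto
  have pos: "integrable lborel (\<lambda>t. max 0 (h t))" and neg: "integrable lborel (\<lambda>t. max 0 (- h t))"
    using h by (auto intro!: integrable_max)
  define M1 where "M1 = density lborel (\<lambda>t. ennreal (max 0 (h t)))"
  define M2 where "M2 = density lborel (\<lambda>t. ennreal (max 0 (- h t)))"
  have em: "emeasure (density lborel (\<lambda>t. ennreal (g t))) A = ennreal (LINT t|lborel. indicator A t * g t)"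
    if "integrable lborel g" "\<And>t. 0 \<le> g t" and [measurable]: "A \<in> sets borel" for g :: "real \<Rightarrow> real" and A
  proof -
    have [measurable]: "g \<in> borel_measurable borel" using that by auto
    have "integrable lborel (\<lambda>t. indicator A t * g t)"
      using integrable_mult_indicator[OF _ that(1), of A] by simp
    then show ?thesis
      by (subst emeasure_density) (auto simp: nn_integral_eq_integral[symmetric] that ennreal_mult' mult.commute ennreal_indicator intro!: nn_integral_cong)
  qed
  have fin: "finite_borel_measure M1" "finite_borel_measure M2"
    unfolding finite_borel_measure_def finite_borel_measure_axioms_def M1_def M2_def
    by (auto intro!: finite_measureI simp: em[OF pos] em[OF neg] simp del: ennreal_max_0 ennreal_max_0')
  have "cdf M1 a = cdf M2 a" for a
  proof -
    have "(LINT t|lborel. indicator {..a} t * max 0 (h t)) - (LINT t|lborel. indicator {..a} t * max 0 (- h t))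
        = (LINT t|lborel. indicator {..a} t * max 0 (h t) - indicator {..a} t * max 0 (- h t))"
      using integrable_mult_indicator[OF _ pos, of "{..a}"] integrable_mult_indicator[OF _ neg, of "{..a}"]
      by (intro Bochner_Integration.integral_diff[symmetric]) auto
    also have "\<dots> = (LINT t|lborel. indicator {..a} t * h t)"
      by (intro Bochner_Integration.integral_cong) (auto simp: indicator_def)
    finally show ?thesis
      unfolding cdf_def measure_def M1_def M2_def by (simp add: em[OF pos] em[OF neg] 0 del: ennreal_max_0 ennreal_max_0')
  qed
  then have "M1 = M2" using cdf_unique'[OF fin] by auto
  then have "AE t in lborel. ennreal (max 0 (h t)) = ennreal (max 0 (- h t))"
    unfolding M1_def M2_def by (subst (asm) sigma_finite_measure.density_unique_iff[OF lborel.sigma_finite_measure_axioms]) auto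
  then show ?thesis
    by eventually_elim (auto simp: max_def split: if_splits)
qed

text \<open>With \<open>x = exp (- t)\<close> the assumption says that \<open>h\<close> annihilates
  every monomial on [0,1]; Weierstrass approximation extends this to continuous functions.\<close>

lemma exp_moments_zero_continuous:
  fixes h G :: "real \<Rightarrow> real"
  assumes h: "integrable lborel h" and h0: "\<And>t. t < 0 \<Longrightarrow> h t = 0"
    and mom: "\<And>n::nat. (LINT t|lborel. exp (- real n * t) * h t) = 0"
    and G: "continuous_on {0..1} G"
  shows "(LINT t|lborel. G (exp (- t)) * h t) = 0"
proof -
  have [measurable]: "h \<in> borel_measurable borel" using h by auto
  define L where "L = (LINT t|lborel. \<bar>h t\<bar>)"
  \<comment> \<open>\<open>G\<close> is controlled on [0,1] only; \<open>H\<close> is a Borel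
    function that agrees with it at \<open>exp (- t)\<close> for every \<open>t\<close> where
    \<open>h\<close> can be nonzero.\<close>
  define H where "H x = (if x \<in> {0..1} then G x else 0)" for x
  have [measurable]: "H \<in> borel_measurable borel"
    unfolding H_def using borel_measurable_continuous_on_if[of "{0..1}" G "\<lambda>_. 0::real"] G by auto
  have H: "H (exp (- t)) * h t = G (exp (- t)) * h t" for t
    using h0[of t] by (cases "t < 0") (auto simp: H_def)
  have "\<exists>B. \<forall>x\<in>{0..1}. \<bar>G x\<bar> \<le> B"
    using compact_imp_bounded[OF compact_continuous_image[OF G]] unfolding bounded_iff by auto
  then obtain B where B: "\<And>x. x \<in> {0..1} \<Longrightarrow> \<bar>G x\<bar> \<le> B" by blast
  have IG: "integrable lborel (\<lambda>t. G (exp (- t)) * h t)"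
  proof (rule Bochner_Integration.integrable_bound[OF integrable_mult_right[OF h, of B]])
    show "(\<lambda>t. G (exp (- t)) * h t) \<in> borel_measurable lborel"
      unfolding H[symmetric] by measurable
    show "AE t in lborel. norm (G (exp (- t)) * h t) \<le> norm (B * h t)"
    proof (rule AE_I2)
      fix t show "norm (G (exp (- t)) * h t) \<le> norm (B * h t)"
        using h0[of t] B[of "exp (- t)"] by (cases "t < 0") (auto simp: abs_mult intro!: mult_right_mono)
    qed
  qed
  have ee: "exp (- real n * t) = exp (- t) ^ n" for n and t :: real
    by (simp add: exp_of_nat_mult[symmetric])
  have In: "integrable lborel (\<lambda>t. exp (- t) ^ n * h t)" for n
  proof (rule Bochner_Integration.integrable_bound[OF h])
    show "AE t in lborel. norm (exp (- t) ^ n * h t) \<le> norm (h t)"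
    proof (rule AE_I2)
      fix t show "norm (exp (- t) ^ n * h t) \<le> norm (h t)"
        using h0[of t] by (cases "t < 0") (auto simp: abs_mult power_le_one intro!: mult_left_le_one_le)
    qed
  qed measurable
  have "\<bar>LINT t|lborel. G (exp (- t)) * h t\<bar> \<le> e * L" if e: "e > 0" for e
  proof -
    obtain g where g: "real_polynomial_function g" "\<And>x. x \<in> {0..1} \<Longrightarrow> \<bar>G x - g x\<bar> < e"
      using Stone_Weierstrass_real_polynomial_function[OF _ G e] by auto
    then obtain a and n :: nat where gs: "g = (\<lambda>x. \<Sum>i\<le>n. a i * x ^ i)"
      unfolding real_polynomial_function_iff_sum by auto
    have gg: "g (exp (- t)) * h t = (\<Sum>i\<le>n. a i * (exp (- t) ^ i * h t))" for t
      by (simp add: gs sum_distrib_right mult.assoc)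
    have Ig: "integrable lborel (\<lambda>t. g (exp (- t)) * h t)"
      unfolding gg using In by auto
    have "(LINT t|lborel. g (exp (- t)) * h t) = (\<Sum>i\<le>n. a i * (LINT t|lborel. exp (- t) ^ i * h t))"
      unfolding gg using In by (subst Bochner_Integration.integral_sum) auto
    also have "\<dots> = 0" using mom unfolding ee by simp
    finally have "\<bar>LINT t|lborel. G (exp (- t)) * h t\<bar> = \<bar>LINT t|lborel. G (exp (- t)) * h t - g (exp (- t)) * h t\<bar>"
      by (simp add: Bochner_Integration.integral_diff[OF IG Ig])
    also have "\<dots> \<le> (LINT t|lborel. \<bar>G (exp (- t)) * h t - g (exp (- t)) * h t\<bar>)"
      by (rule integral_abs_bound)
    also have "\<dots> \<le> (LINT t|lborel. e * \<bar>h t\<bar>)"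
    proof (rule integral_mono)
      fix t show "\<bar>G (exp (- t)) * h t - g (exp (- t)) * h t\<bar> \<le> e * \<bar>h t\<bar>"
        using h0[of t] g(2)[of "exp (- t)"] e unfolding left_diff_distrib[symmetric]
        by (cases "t < 0") (auto simp: abs_mult intro!: mult_right_mono)
    qed (use IG Ig h in auto)
    finally show ?thesis by (simp add: L_def)
  qed
  moreover have "L \<ge> 0" by (simp add: L_def)
  \<comment> \<open>The tolerance is divided by \<open>L + 1\<close> rather than \<open>L\<close>,
    since \<open>L\<close> may be 0.\<close>
  moreover have "e / (L + 1) * L \<le> e" if "e > 0" for e
    using that \<open>L \<ge> 0\<close> by (simp add: field_simps)
  ultimately have le: "\<bar>LINT t|lborel. G (exp (- t)) * h t\<bar> \<le> e" if "e > 0" for e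
    using that by (meson add_nonneg_pos divide_pos_pos order_trans zero_less_one)
  show ?thesis
    using field_le_epsilon[of "\<bar>LINT t|lborel. G (exp (- t)) * h t\<bar>" 0] le by auto
qed

text \<open>A theorem of Lerch type. Absorbing \<open>exp (- N t)\<close> into the function turns
  the values at the integers from \<open>N\<close> on into the complete sequence of moments,
  starting with the zeroth.\<close>

lemma lap_unique:
  fixes h :: "real \<Rightarrow> real"
  assumes h: "integrable lborel (\<lambda>t. exp (- real N * t) * h t)" and h0: "\<And>t. t < 0 \<Longrightarrow> h t = 0"
    and lap: "\<And>n. n \<ge> N \<Longrightarrow> lap h (real n) = 0"
  shows "AE t in lborel. h t = 0"
proof -
  define g where "g t = exp (- real N * t) * h t" for t
  have g: "integrable lborel g" and g0: "\<And>t. t < 0 \<Longrightarrow> g t = 0"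
    unfolding g_def using h h0 by auto
  have [measurable]: "g \<in> borel_measurable borel" using g by auto
  have mom: "(LINT t|lborel. exp (- real n * t) * g t) = 0" for n
  proof -
    have "exp (- real n * t) * g t = exp (- real (n + N) * t) * h t" for t
      unfolding g_def mult.assoc[symmetric] exp_add[symmetric] by (simp add: ring_distribs)
    then show ?thesis using lap[of "n + N"] unfolding lap_def by simp
  qed
  have "(LINT t|lborel. indicator {..a} t * g t) = 0" for a
  proof -
    \<comment> \<open>Continuous ramps in \<open>x = exp (- t)\<close>. They equal 1 from
      \<open>exp (- a)\<close> on, so their limit is the indicator of \<open>t \<le> a\<close> with
      its end point, and the common bound 1 permits dominated convergence.\<close>
    define G where "G = (\<lambda>n x. min 1 (max 0 (1 + real n * (x - exp (- a)))))"
    have G1: "\<bar>G n x\<bar> \<le> 1" for n x by (auto simp: G_def)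
    have "(\<lambda>n. LINT t|lborel. G n (exp (- t)) * g t) \<longlonglongrightarrow> (LINT t|lborel. indicator {..a} t * g t)"
    proof (rule integral_dominated_convergence[where w = "\<lambda>t. \<bar>g t\<bar>"])
      show "AE t in lborel. (\<lambda>n. G n (exp (- t)) * g t) \<longlonglongrightarrow> indicator {..a} t * g t"
      proof (rule AE_I2)
        fix t
        show "(\<lambda>n. G n (exp (- t)) * g t) \<longlonglongrightarrow> indicator {..a} t * g t"
        proof (cases "t \<le> a")
          case True
          then have "G n (exp (- t)) = 1" for n by (simp add: G_def)
          with True show ?thesis by simp
        next
          case False
          then have "exp (- a) - exp (- t) > 0" by simp
          then obtain N where N: "1 < real N * (exp (- a) - exp (- t))"
            using reals_Archimedean3 by blast
          have "G n (exp (- t)) = 0" if "n \<ge> N" for n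
          proof -
            have "real N * (exp (- a) - exp (- t)) \<le> real n * (exp (- a) - exp (- t))"
              using that False by (intro mult_right_mono) auto
            with N show ?thesis by (auto simp: G_def algebra_simps)
          qed
          then have "\<forall>\<^sub>F n in sequentially. G n (exp (- t)) * g t = 0"
            unfolding eventually_sequentially by auto
          with False show ?thesis by (simp add: tendsto_eventually)
        qed
      qed
      show "AE t in lborel. norm (G n (exp (- t)) * g t) \<le> \<bar>g t\<bar>" for n
        using G1 by (auto simp: abs_mult intro!: mult_left_le_one_le)
      show "(\<lambda>t. G n (exp (- t)) * g t) \<in> borel_measurable lborel" for n
        unfolding G_def by measurable
    qed (use g in auto)
    moreover have "(LINT t|lborel. G n (exp (- t)) * g t) = 0" for n
    proof (rule exp_moments_zero_continuous[OF g _ mom])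
      show "continuous_on {0..1} (G n)" unfolding G_def by (intro continuous_intros)
    qed (rule g0)
    ultimately show ?thesis by (simp add: LIMSEQ_const_iff)
  qed
  from AE_zero_of_Iic[OF g this] show ?thesis
    by eventually_elim (simp add: g_def)
qed

section \<open>Averaging two-time kernels over an interval of observation times\<close>

lemma
  fixes X :: "real \<times> real \<Rightarrow> real"
  assumes X: "integrable lborel2 X"
    and [measurable]: "g \<in> borel_measurable borel" "l \<in> borel_measurable borel"
    and K: "\<And>t. \<bar>g t\<bar> \<le> K" "\<And>t. \<bar>l t\<bar> \<le> L"
  shows integrable_time_average:
      "set_integrable lborel {0..T} (\<lambda>t. LINT p|lborel2. g (t - fst p) * l (t - snd p) * X p)" (is ?I)
    and integral_time_average:
      "(LINT t:{0..T}|lborel. LINT p|lborel2. g (t - fst p) * l (t - snd p) * X p) =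
        (LINT p|lborel2. (LINT t:{0..T}|lborel. g (t - fst p) * l (t - snd p)) * X p)" (is ?E)
    and integrable_time_average_kernel:
      "integrable lborel2 (\<lambda>p. (LINT t:{0..T}|lborel. g (t - fst p) * l (t - snd p)) * X p)" (is ?J)
proof -
  interpret S: sigma_finite_measure "lborel2 :: (real \<times> real) measure"
    by (simp add: lborel_prod lborel.sigma_finite_measure_axioms)
  interpret P: pair_sigma_finite "lborel :: real measure" "lborel2 :: (real \<times> real) measure" ..
  have [measurable]: "X \<in> borel_measurable lborel2" using X by auto
  define G where "G = (\<lambda>t p. indicator {0..T} t * (g (t - fst p) * l (t - snd p) * X p))"
  have GI: "integrable (lborel \<Otimes>\<^sub>M lborel2) (case_prod G)"
  proof (rule P.Fubini_integrable)
    have Kp: "0 \<le> K" "0 \<le> L" using K(1)[of 0] K(2)[of 0] by linarith+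
    have bd: "\<bar>g a * l b * x\<bar> \<le> K * L * \<bar>x\<bar>" for a b x
      unfolding abs_mult by (intro mult_mono K Kp) (auto intro!: mult_nonneg_nonneg Kp order_trans[OF _ K(2)])
    show meas: "case_prod G \<in> borel_measurable (lborel \<Otimes>\<^sub>M lborel2)"
      unfolding G_def split_beta' by measurable
    have Xa: "integrable lborel2 (\<lambda>p. K * L * \<bar>X p\<bar>)" using X by auto
    have sec: "integrable lborel2 (\<lambda>p. case_prod G (t, p))" for t
      by (rule Bochner_Integration.integrable_bound[OF Xa])
        (use bd Kp in \<open>auto simp: G_def indicator_def abs_mult intro!: AE_I2\<close>)
    then show "AE t in lborel. integrable lborel2 (\<lambda>p. case_prod G (t, p))" by simp
    have "integrable lborel (\<lambda>t. indicator {0..T} t * (LINT p|lborel2. K * L * \<bar>X p\<bar>))"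
      by (intro integrable_mult_left integrable_real_indicator) (auto simp: emeasure_lborel_Icc_eq)
    then show "integrable lborel (\<lambda>t. LINT p|lborel2. norm (case_prod G (t, p)))"
    proof (rule Bochner_Integration.integrable_bound)
      show "(\<lambda>t. LINT p|lborel2. norm (case_prod G (t, p))) \<in> borel_measurable lborel"
        using meas by (intro lborel_pair.borel_measurable_lebesgue_integral) simp
      show "AE t in lborel. norm (LINT p|lborel2. norm (case_prod G (t, p)))
          \<le> norm (indicator {0..T} t * (LINT p|lborel2. K * L * \<bar>X p\<bar>))"
      proof (rule AE_I2)
        fix t
        show "norm (LINT p|lborel2. norm (case_prod G (t, p)))
          \<le> norm (indicator {0..T} t * (LINT p|lborel2. K * L * \<bar>X p\<bar>))"
        proof (cases "t \<in> {0..T}")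
          case True
          have "(LINT p|lborel2. norm (case_prod G (t, p))) \<le> (LINT p|lborel2. K * L * \<bar>X p\<bar>)"
            by (intro integral_mono integrable_norm sec Xa) (use bd True in \<open>auto simp: G_def\<close>)
          then show ?thesis using True by (auto intro!: order_trans[OF _ abs_ge_self])
        qed (simp add: G_def)
      qed
    qed
  qed
  have c: "G t p = indicator {0..T} t *\<^sub>R (g (t - fst p) * l (t - snd p)) * X p" for t p
    by (simp add: G_def)
  show ?I using P.integrable_fst[OF GI] by (simp add: G_def set_integrable_def)
  show ?J using P.integrable_snd[OF GI] unfolding c set_lebesgue_integral_def by simp
  have "(LINT t:{0..T}|lborel. LINT p|lborel2. g (t - fst p) * l (t - snd p) * X p)
      = (LINT t|lborel. LINT p|lborel2. G t p)"
    unfolding set_lebesgue_integral_def by (simp add: G_def)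
  also have "\<dots> = (LINT p|lborel2. LINT t|lborel. G t p)"
    using P.integral_fst[OF GI] P.integral_snd[OF GI] by simp
  finally show ?E unfolding c set_lebesgue_integral_def by simp
qed

lemma integral_pair_swap:
  fixes f :: "real \<times> real \<Rightarrow> real"
  assumes "f \<in> borel_measurable lborel2"
  shows "(LINT p|lborel2. f (snd p, fst p)) = (LINT p|lborel2. f p)"
  using lborel_pair.integral_product_swap[OF assms] by (simp add: split_beta')

text \<open>Since \<open>X\<close> is symmetric, the kernel may be symmetrised in the two times, and
  then it is the \<open>t\<close> derivative of \<open>k (t - s) * k (t - r)\<close>. This is the
  two-time form of \<open>(u', u) = (1/2) d/dt (u, u)\<close>.\<close>

lemma integral_time_average_symmetric:
  fixes X :: "real \<times> real \<Rightarrow> real"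
  assumes X: "integrable lborel2 X"
    and sym: "\<And>s r. X (s, r) = X (r, s)" and supp: "\<And>s r. s < 0 \<or> r < 0 \<Longrightarrow> X (s, r) = 0"
    and k: "\<And>t. (k has_real_derivative k' t) (at t)" "continuous_on UNIV k'" "\<And>t. t \<le> 0 \<Longrightarrow> k t = 0"
    and K: "\<And>t. \<bar>k t\<bar> \<le> K" "\<And>t. \<bar>k' t\<bar> \<le> L" and T: "0 \<le> T"
  shows "(LINT t:{0..T}|lborel. LINT p|lborel2. k' (t - fst p) * k (t - snd p) * X p) =
        (LINT p|lborel2. k (T - fst p) * k (T - snd p) * X p) / 2"
proof -
  have kc: "continuous_on UNIV k" using k(1) by (intro DERIV_continuous_on) (auto intro: has_field_derivative_at_within)
  have [measurable]: "k \<in> borel_measurable borel" "k' \<in> borel_measurable borel"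
    using kc k(2) by (auto intro: borel_measurable_continuous_onI)
  have [measurable]: "X \<in> borel_measurable lborel2" using X by auto
  define Q where "Q p = (LINT t:{0..T}|lborel. k' (t - fst p) * k (t - snd p))" for p
  have [measurable]: "Q \<in> borel_measurable lborel2"
    unfolding Q_def[abs_def] set_lebesgue_integral_def by measurable
  have meas: "k' \<in> borel_measurable borel" "k \<in> borel_measurable borel" by measurable
  note I = integrable_time_average_kernel[OF X meas K(2) K(1), of T, folded Q_def]
  have IQ: "integrable lborel2 (\<lambda>p. Q (snd p, fst p) * X p)"
    using lborel_pair.integrable_product_swap[OF I] sym by (simp add: split_beta')
  have Qs: "Q p * X p + Q (snd p, fst p) * X p = k (T - fst p) * k (T - snd p) * X p" for p
  proof (cases "fst p < 0 \<or> snd p < 0")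
    case True then show ?thesis using supp[of "fst p" "snd p"] by auto
  next
    case False
    define D where "D = (\<lambda>t. k' (t - fst p) * k (t - snd p) + k' (t - snd p) * k (t - fst p))"
    have cont: "continuous_on A (\<lambda>t. k' (t - c))" "continuous_on A (\<lambda>t. k (t - c))" for A c
      by (auto intro!: continuous_on_compose2[OF k(2)] continuous_on_compose2[OF kc] continuous_intros)
    have si: "set_integrable lborel {0..T} (\<lambda>t. k' (t - a) * k (t - b))" for a b
      by (intro borel_integrable_atLeastAtMost' continuous_on_mult cont)
    have "Q p + Q (snd p, fst p) = (LINT t:{0..T}|lborel. D t)"
      unfolding Q_def D_def by (simp add: set_integral_add(2)[OF si si])
    also have "\<dots> = k (T - fst p) * k (T - snd p) - k (0 - fst p) * k (0 - snd p)"
      unfolding set_lebesgue_integral_def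
    proof (rule integral_FTC_Icc[OF T, where F = "\<lambda>t. k (t - fst p) * k (t - snd p)"])
      fix x
      have "((\<lambda>t. k (t - c)) has_real_derivative k' (x - c)) (at x)" for c
        using DERIV_shift[of k "k' (x - c)" x "- c"] k(1)[of "x - c"] by simp
      note d = this[THEN has_field_derivative_at_within]
      have "((\<lambda>t. k (t - fst p) * k (t - snd p)) has_real_derivative D x) (at x within {0..T})"
        by (rule derivative_eq_intros d refl)+ (simp add: D_def)
      then show "((\<lambda>t. k (t - fst p) * k (t - snd p)) has_vector_derivative D x) (at x within {0..T})"
        by (simp add: has_real_derivative_iff_has_vector_derivative)
      show "continuous_on {0..T} D" unfolding D_def by (intro continuous_intros cont)
    qed
    \<comment> \<open>The boundary term at time 0 disappears because \<open>k\<close> is causal and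
      only nonnegative times are left in this case.\<close>
    also have "k (0 - fst p) = 0" using False by (intro k(3)) auto
    finally show ?thesis by (simp add: ring_distribs(2)[symmetric])
  qed
  have "(LINT p|lborel2. Q (snd p, fst p) * X p) = (LINT p|lborel2. Q p * X p)"
    using integral_pair_swap[of "\<lambda>p. Q p * X p"] sym by simp
  moreover have "(LINT p|lborel2. Q p * X p) + (LINT p|lborel2. Q (snd p, fst p) * X p)
      = (LINT p|lborel2. k (T - fst p) * k (T - snd p) * X p)"
    using Bochner_Integration.integral_add[OF I IQ] unfolding Qs by simp
  moreover have "(LINT t:{0..T}|lborel. LINT p|lborel2. k' (t - fst p) * k (t - snd p) * X p)
      = (LINT p|lborel2. Q p * X p)"
    using integral_time_average[OF X meas K(2) K(1), of T] by (simp add: Q_def)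
  ultimately show ?thesis by simp
qed

subsection \<open>Positivity of cosine kernels\<close>

lemma integral_FTC_atLeast:
  fixes f F :: "real \<Rightarrow> real"
  assumes f: "integrable lborel f" and f0: "\<And>t. t < 0 \<Longrightarrow> f t = 0"
    and F: "\<And>t. 0 \<le> t \<Longrightarrow> (F has_real_derivative f t) (at t within {0..})"
    and cont: "continuous_on {0..} f" and L: "(F \<longlongrightarrow> L) at_top"
  shows "(LINT t|lborel. f t) = L - F 0"
proof -
  have "((\<lambda>y. LINT t|lborel. indicator {..y} t *\<^sub>R f t) \<longlongrightarrow> (LINT t|lborel. f t)) at_top"
    by (rule tendsto_integral_at_top) (use f in auto)
  moreover have "\<forall>\<^sub>F y in at_top. (LINT t|lborel. indicator {..y} t *\<^sub>R f t) = F y - F 0"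
    using eventually_ge_at_top[of 0]
  proof eventually_elim
    case (elim y)
    have "(LINT t|lborel. indicator {..y} t *\<^sub>R f t) = (LINT t|lborel. indicator {0..y} t *\<^sub>R f t)"
      by (intro Bochner_Integration.integral_cong) (auto simp: indicator_def f0)
    also have "\<dots> = F y - F 0"
    proof (rule integral_FTC_Icc[OF elim])
      fix x :: real assume "0 \<le> x"
      then show "(F has_vector_derivative f x) (at x within {0..y})"
        using F[of x] by (auto simp: has_real_derivative_iff_has_vector_derivative intro: has_vector_derivative_within_subset)
    qed (use cont in \<open>auto intro: continuous_on_subset\<close>)
    finally show ?case .
  qed
  ultimately have "((\<lambda>y. F y - F 0) \<longlongrightarrow> (LINT t|lborel. f t)) at_top"
    by (rule Lim_transform_eventually)
  moreover have "((\<lambda>y. F y - F 0) \<longlongrightarrow> L - F 0) at_top" by (intro tendsto_intros L)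
  ultimately show ?thesis by (intro tendsto_unique[OF _ _ _]) auto
qed

definition causal_cos :: "real \<Rightarrow> real \<Rightarrow> real" where
  "causal_cos \<omega> t = (if t < 0 then 0 else cos (\<omega> * t))"

lemma causal_cos_bound: "\<bar>causal_cos \<omega> t\<bar> \<le> 1"
  by (simp add: causal_cos_def)

lemma causal_cos_measurable [measurable]:
  "(\<lambda>z. causal_cos (u z) (v z)) \<in> borel_measurable M" if [measurable]: "u \<in> borel_measurable M" "v \<in> borel_measurable M"
  unfolding causal_cos_def by measurable

lemma exp_integrable: 
  assumes "0 < s"
  shows "integrable lborel (\<lambda>t. indicator {0..} t * exp (- s * t :: real))"
proof -
  have "(\<integral>\<^sup>+t. ennreal (exp (- s * t)) * indicator {0..} t \<partial>lborel) = ennreal (0 - - exp (- s * 0) / s)"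
  proof (rule nn_integral_FTC_atLeast)
    show "DERIV (\<lambda>t. - exp (- s * t) / s) t :> exp (- s * t)" for t
      using assms by (auto intro!: derivative_eq_intros)
    show "((\<lambda>t. - exp (- s * t) / s) \<longlongrightarrow> 0) at_top"
      using assms by real_asymp
  qed auto
  then show ?thesis
    by (intro integrableI_nonneg) (auto simp: ennreal_mult' ennreal_indicator mult.commute)
qed

lemma exp_integrable_bounded:
  assumes s: "0 < s" and [measurable]: "f \<in> borel_measurable borel"
    and f0: "\<And>t. t < 0 \<Longrightarrow> f t = 0" and K: "\<And>t. \<bar>f t\<bar> \<le> K"
  shows "integrable lborel (\<lambda>t. exp (- s * t) * f t :: real)"
proof (rule Bochner_Integration.integrable_bound[OF integrable_mult_right[OF exp_integrable[OF s], of K]])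
  show "AE t in lborel. norm (exp (- s * t) * f t) \<le> norm (K * (indicator {0..} t * exp (- s * t)))"
  proof (rule AE_I2)
    fix t show "norm (exp (- s * t) * f t) \<le> norm (K * (indicator {0..} t * exp (- s * t)))"
      using f0[of t] order_trans[OF K[of t] abs_ge_self] by (cases "t < 0") (auto simp: abs_mult indicator_def)
  qed
qed measurable

lemma lap_causal_cos:
  assumes s: "0 < s"
  shows "lap (causal_cos \<omega>) s = s / (s\<^sup>2 + \<omega>\<^sup>2)"
proof -
  have pos: "s\<^sup>2 + \<omega>\<^sup>2 > 0" using s by (simp add: add_pos_nonneg)
  \<comment> \<open>Antiderivative of \<open>exp (- s * t) * cos (\<omega> * t)\<close> that
    vanishes at infinity; minus its value at 0 is the claimed transform.\<close>
  define F where "F t = exp (- s * t) * (\<omega> * sin (\<omega> * t) - s * cos (\<omega> * t)) / (s\<^sup>2 + \<omega>\<^sup>2)" for t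
  have "lap (causal_cos \<omega>) s = 0 - F 0"
    unfolding lap_def
  proof (rule integral_FTC_atLeast)
    show "integrable lborel (\<lambda>t. exp (- s * t) * causal_cos \<omega> t)"
      by (rule exp_integrable_bounded[OF s _ _ causal_cos_bound]) (auto simp: causal_cos_def)
    have d: "(F has_real_derivative exp (- s * t) * cos (\<omega> * t)) (at t within {0..})" for t
    proof -
      have "(F has_real_derivative ((exp (- s * t) * (- s)) * (\<omega> * sin (\<omega> * t) - s * cos (\<omega> * t))
          + exp (- s * t) * (\<omega> * (cos (\<omega> * t) * \<omega>) - s * (- sin (\<omega> * t) * \<omega>))) / (s\<^sup>2 + \<omega>\<^sup>2)) (at t within {0..})"
        unfolding F_def by (rule derivative_eq_intros refl | use pos in force)+
      also have "((exp (- s * t) * (- s)) * (\<omega> * sin (\<omega> * t) - s * cos (\<omega> * t))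
          + exp (- s * t) * (\<omega> * (cos (\<omega> * t) * \<omega>) - s * (- sin (\<omega> * t) * \<omega>))) = exp (- s * t) * cos (\<omega> * t) * (s\<^sup>2 + \<omega>\<^sup>2)"
        by (simp add: power2_eq_square algebra_simps)
      finally show ?thesis using pos s by simp
    qed
    then show "(F has_real_derivative exp (- s * t) * causal_cos \<omega> t) (at t within {0..})" if "0 \<le> t" for t
      using that by (simp add: causal_cos_def)
    have "continuous_on {0..} (\<lambda>t. exp (- s * t) * cos (\<omega> * t))" by (intro continuous_intros)
    then show "continuous_on {0..} (\<lambda>t. exp (- s * t) * causal_cos \<omega> t)"
      by (rule continuous_on_eq) (simp add: causal_cos_def)
    have "((\<lambda>t. exp (- s * t)) \<longlongrightarrow> 0) at_top"
      using s by real_asymp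
    then have lim: "((\<lambda>t. exp (- s * t) * ((\<bar>\<omega>\<bar> + s) / (s\<^sup>2 + \<omega>\<^sup>2))) \<longlongrightarrow> 0) at_top"
      by (rule tendsto_mult_left_zero)
    have le: "norm (F t) \<le> exp (- s * t) * ((\<bar>\<omega>\<bar> + s) / (s\<^sup>2 + \<omega>\<^sup>2))" for t
    proof -
      have "\<bar>\<omega> * sin (\<omega> * t) - s * cos (\<omega> * t)\<bar> \<le> \<bar>\<omega>\<bar> * \<bar>sin (\<omega> * t)\<bar> + s * \<bar>cos (\<omega> * t)\<bar>"
        using s by (intro order_trans[OF abs_triangle_ineq4]) (simp add: abs_mult)
      also have "\<dots> \<le> \<bar>\<omega>\<bar> * 1 + s * 1" using s by (intro add_mono mult_left_mono) auto
      finally show ?thesis using pos by (simp add: F_def abs_mult divide_right_mono mult_left_mono)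
    qed
    show "(F \<longlongrightarrow> 0) at_top"
      by (rule Lim_null_comparison[OF always_eventually lim]) (use le in blast)
  qed (simp add: causal_cos_def)
  then show ?thesis by (simp add: F_def)
qed

lemma AE_fst_neq_snd: "AE p in lborel2. fst p \<noteq> (snd p :: real)"
proof (rule lborel_pair.AE_pair_measure)
  show "AE x in lborel. AE y in lborel. fst (x, y) \<noteq> (snd (x, y) :: real)"
    using AE_lborel_singleton by (auto simp: eq_commute)
qed measurable

text \<open>Averaging over the exchange of the two times replaces the causal kernel by half of
  \<open>cos (\<omega> * (t - r))\<close>, and the addition theorem splits the resulting form into
  two squares.\<close>

lemma causal_cos_positive:
  fixes \<phi> :: "real \<Rightarrow> real"
  assumes \<phi>: "integrable lborel \<phi>"
  shows "0 \<le> (LINT t|lborel. conv (causal_cos \<omega>) \<phi> t * \<phi> t)"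
proof -
  have [measurable]: "\<phi> \<in> borel_measurable borel" using \<phi> by auto
  have I0: "integrable lborel2 (\<lambda>p. \<phi> (fst p) * \<phi> (snd p))"
    using lborel_pair.Fubini_integrable[of "\<lambda>p. \<phi> (fst p) * \<phi> (snd p)"] \<phi> by (auto simp: abs_mult)
  have I: "integrable lborel2 (\<lambda>p. k p * (\<phi> (fst p) * \<phi> (snd p)))"
    if [measurable]: "k \<in> borel_measurable lborel2" and "\<And>p. \<bar>k p\<bar> \<le> 1" for k :: "real \<times> real \<Rightarrow> real"
    by (rule Bochner_Integration.integrable_bound[OF I0]) (use that(2) in \<open>auto simp: abs_mult intro!: AE_I2 mult_left_le_one_le\<close>)
  define Q where "Q = (\<lambda>p. causal_cos \<omega> (fst p - snd p) * (\<phi> (fst p) * \<phi> (snd p)))"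
  have Qi: "integrable lborel2 Q" unfolding Q_def by (rule I[OF _ causal_cos_bound]) measurable
  have [measurable]: "Q \<in> borel_measurable lborel2" using Qi by auto
  have Qs: "integrable lborel2 (\<lambda>p. Q (snd p, fst p))"
    using lborel_pair.integrable_product_swap[OF Qi] by (simp add: split_beta')
  have "(LINT t|lborel. conv (causal_cos \<omega>) \<phi> t * \<phi> t) = (LINT p|lborel2. Q p)"
  proof -
    have "conv (causal_cos \<omega>) \<phi> t * \<phi> t = (LINT r|lborel. Q (t, r))" for t
      unfolding conv_def Q_def integral_mult_left_zero[symmetric] by (simp add: ac_simps)
    then show ?thesis using lborel_pair.integral_fst'[OF Qi] by simp
  qed
  moreover have "2 * (LINT p|lborel2. Q p) = (LINT p|lborel2. Q p + Q (snd p, fst p))"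
    using Bochner_Integration.integral_add[OF Qi Qs] integral_pair_swap[of Q] by simp
  moreover have "(LINT p|lborel2. Q p + Q (snd p, fst p))
      = (LINT p|lborel2. (cos (\<omega> * fst p) * \<phi> (fst p)) * (cos (\<omega> * snd p) * \<phi> (snd p)) +
          (sin (\<omega> * fst p) * \<phi> (fst p)) * (sin (\<omega> * snd p) * \<phi> (snd p)))"
  proof (rule integral_cong_AE)
    show "AE p in lborel2. Q p + Q (snd p, fst p) = (cos (\<omega> * fst p) * \<phi> (fst p)) * (cos (\<omega> * snd p) * \<phi> (snd p)) +
          (sin (\<omega> * fst p) * \<phi> (fst p)) * (sin (\<omega> * snd p) * \<phi> (snd p))"
      \<comment> \<open>On the diagonal the two causal cosines would add up to 2 instead of 1; the
        diagonal is a null set.\<close>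
      using AE_fst_neq_snd
    proof eventually_elim
      case (elim p)
      have "causal_cos \<omega> (fst p - snd p) + causal_cos \<omega> (snd p - fst p) = cos (\<omega> * fst p - \<omega> * snd p)"
        using elim cos_minus[of "\<omega> * fst p - \<omega> * snd p"] by (auto simp: causal_cos_def algebra_simps)
      then have "Q p + Q (snd p, fst p) = cos (\<omega> * fst p - \<omega> * snd p) * (\<phi> (fst p) * \<phi> (snd p))"
        by (simp add: Q_def mult.commute[of "\<phi> (snd p)"] distrib_right[symmetric])
      then show ?case by (simp add: cos_diff algebra_simps)
    qed
  qed measurable
  moreover have "\<dots> = (LINT t|lborel. cos (\<omega> * t) * \<phi> t)\<^sup>2 + (LINT t|lborel. sin (\<omega> * t) * \<phi> t)\<^sup>2"
  proof -
    have p: "integrable lborel (\<lambda>t. k t * \<phi> t) \<Longrightarrow> integrable lborel2 (\<lambda>p. (k (fst p) * \<phi> (fst p)) * (k (snd p) * \<phi> (snd p))) \<and>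
      (LINT p|lborel2. (k (fst p) * \<phi> (fst p)) * (k (snd p) * \<phi> (snd p))) = (LINT t|lborel. k t * \<phi> t)\<^sup>2" for k :: "real \<Rightarrow> real"
    proof -
      assume k: "integrable lborel (\<lambda>t. k t * \<phi> t)"
      then have [measurable]: "(\<lambda>t. k t * \<phi> t) \<in> borel_measurable borel" by auto
      have i: "integrable lborel2 (\<lambda>p. (k (fst p) * \<phi> (fst p)) * (k (snd p) * \<phi> (snd p)))"
      proof (rule lborel_pair.Fubini_integrable)
        show "(\<lambda>p. (k (fst p) * \<phi> (fst p)) * (k (snd p) * \<phi> (snd p))) \<in> borel_measurable lborel2"
          using measurable_compose[OF measurable_fst \<open>(\<lambda>t. k t * \<phi> t) \<in> borel_measurable borel\<close>]
            measurable_compose[OF measurable_snd \<open>(\<lambda>t. k t * \<phi> t) \<in> borel_measurable borel\<close>] by (auto intro!: borel_measurable_times)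
      qed (use k in \<open>auto simp: abs_mult[of "k _ * _"]\<close>)
      then show ?thesis by (subst lborel_pair.integral_fst'[OF i, symmetric]) (simp add: power2_eq_square)
    qed
    have "integrable lborel (\<lambda>t. cos (\<omega> * t) * \<phi> t)" "integrable lborel (\<lambda>t. sin (\<omega> * t) * \<phi> t)"
      by (rule Bochner_Integration.integrable_bound[OF \<phi>]; auto simp: abs_mult intro!: AE_I2 mult_left_le_one_le)+
    then show ?thesis using p[of "\<lambda>t. cos (\<omega> * t)"] p[of "\<lambda>t. sin (\<omega> * t)"] by simp
  qed
  ultimately have "2 * (LINT t|lborel. conv (causal_cos \<omega>) \<phi> t * \<phi> t) = (LINT t|lborel. cos (\<omega> * t) * \<phi> t)\<^sup>2 + (LINT t|lborel. sin (\<omega> * t) * \<phi> t)\<^sup>2"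
    by simp
  moreover have "0 \<le> (LINT t|lborel. cos (\<omega> * t) * \<phi> t)\<^sup>2 + (LINT t|lborel. sin (\<omega> * t) * \<phi> t)\<^sup>2" by simp
  ultimately show ?thesis by linarith
qed

section \<open>Causal convolutions: growth and associativity\<close>

lemma conv_measurable [measurable]:
  assumes [measurable]: "k \<in> borel_measurable borel" "f \<in> borel_measurable borel"
  shows "conv k f \<in> borel_measurable borel"
  unfolding conv_def[abs_def] by measurable

lemma conv_causal:
  assumes "\<And>t. t < 0 \<Longrightarrow> k t = 0" "\<And>t. t < 0 \<Longrightarrow> f t = 0" "t < 0"
  shows "conv k f t = 0"
proof -
  have "k (t - \<tau>) * f \<tau> = 0" for \<tau>
    using assms(1)[of "t - \<tau>"] assms(2)[of \<tau>] assms(3) by (cases "\<tau> < 0") auto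
  then show ?thesis unfolding conv_def by (simp only: Bochner_Integration.integral_zero)
qed

text \<open>Only \<open>\<tau> \<le> t\<close> contributes, and there the growth
  \<open>exp (\<sigma> * (t - \<tau>))\<close> of the kernel splits into a factor in
  \<open>t\<close> and the weight that makes \<open>f\<close> integrable.\<close>

lemma conv_exp_bound:
  assumes f: "integrable lborel (\<lambda>t. exp (- \<sigma> * t) * f t)"
    and k0: "\<And>t. t < 0 \<Longrightarrow> k t = 0" and k: "\<And>t. 0 \<le> t \<Longrightarrow> \<bar>k t\<bar> \<le> A * exp (\<sigma> * t)"
  shows "\<bar>conv k f t\<bar> \<le> A * exp (\<sigma> * t) * (LINT \<tau>|lborel. \<bar>exp (- \<sigma> * \<tau>) * f \<tau>\<bar>)"
proof -
  have A: "0 \<le> A" using k[of 0] by simp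
  have bd: "\<bar>k (t - \<tau>) * f \<tau>\<bar> \<le> A * exp (\<sigma> * t) * \<bar>exp (- \<sigma> * \<tau>) * f \<tau>\<bar>" for \<tau>
  proof (cases "\<tau> \<le> t")
    case True
    have "\<bar>k (t - \<tau>) * f \<tau>\<bar> \<le> (A * exp (\<sigma> * (t - \<tau>))) * \<bar>f \<tau>\<bar>"
      unfolding abs_mult using True by (intro mult_right_mono k) auto
    also have "\<dots> = A * exp (\<sigma> * t) * \<bar>exp (- \<sigma> * \<tau>) * f \<tau>\<bar>"
      by (simp add: abs_mult right_diff_distrib exp_diff exp_minus divide_inverse)
    finally show ?thesis .
  next
    case False then show ?thesis using k0[of "t - \<tau>"] A by simp
  qed
  have "\<bar>conv k f t\<bar> \<le> (LINT \<tau>|lborel. A * exp (\<sigma> * t) * \<bar>exp (- \<sigma> * \<tau>) * f \<tau>\<bar>)"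
  proof (cases "integrable lborel (\<lambda>\<tau>. k (t - \<tau>) * f \<tau>)")
    case True
    then show ?thesis unfolding conv_def using f bd
      by (intro order_trans[OF integral_abs_bound] integral_mono) auto
  next
    case False
    \<comment> \<open>A convolution integral that does not converge has the default value 0, for
      which the bound is trivial.\<close>
    then have "conv k f t = 0" by (simp add: conv_def not_integrable_integral_eq)
    then show ?thesis using A by (auto intro!: Bochner_Integration.integral_nonneg)
  qed
  then show ?thesis by simp
qed

text \<open>Causality confines the double integral to \<open>0 \<le> r \<le> \<tau> \<le> t\<close>,
  so bounded kernels and integrability of \<open>f\<close> on [0,t] are enough for Fubini, without
  any decay at infinity.\<close>

lemma conv_assoc_causal:
  assumes [measurable]: "k \<in> borel_measurable borel" "\<rho> \<in> borel_measurable borel"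
    and k: "\<And>t. t < 0 \<Longrightarrow> k t = 0" "\<And>t. \<bar>k t\<bar> \<le> L"
    and \<rho>: "\<And>t. t < 0 \<Longrightarrow> \<rho> t = 0" "\<And>t. \<bar>\<rho> t\<bar> \<le> K"
    and f: "integrable lborel (\<lambda>r. indicator {0..t} r * f r)" "\<And>t. t < 0 \<Longrightarrow> f t = 0"
    and [measurable]: "f \<in> borel_measurable borel"
  shows "conv k (conv \<rho> f) t = conv (conv k \<rho>) f t"
proof -
  define G where "G = (\<lambda>\<tau> r. k (t - \<tau>) * (\<rho> (\<tau> - r) * f r))"
  have K: "0 \<le> K" "0 \<le> L" using \<rho>(2)[of 0] k(2)[of 0] by linarith+
  have dom: "integrable lborel2 (\<lambda>p. (indicator {0..t} (fst p) * (L * K)) * \<bar>indicator {0..t} (snd p) * f (snd p)\<bar>)"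
  proof (rule lborel_pair.Fubini_integrable)
    have "integrable lborel (\<lambda>x. indicator {0..t} x * (L * K * (LINT r|lborel. \<bar>indicator {0..t} r * f r\<bar>)))"
      by (intro integrable_mult_left integrable_real_indicator) (auto simp: emeasure_lborel_Icc_eq)
    then show "integrable lborel (\<lambda>x. LINT y|lborel. norm (indicator {0..t} (fst (x, y)) * (L * K) * \<bar>indicator {0..t} (snd (x, y)) * f (snd (x, y))\<bar>))"
      using K by (simp add: abs_mult mult.assoc)
    show "AE x in lborel. integrable lborel (\<lambda>y. indicator {0..t} (fst (x, y)) * (L * K) * \<bar>indicator {0..t} (snd (x, y)) * f (snd (x, y))\<bar>)"
      using f(1) by auto
  qed measurable
  have G: "integrable lborel2 (case_prod G)"
  proof (rule Bochner_Integration.integrable_bound[OF dom])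
    show "case_prod G \<in> borel_measurable lborel2"
      unfolding G_def by measurable
    have "\<bar>G \<tau> r\<bar> \<le> (indicator {0..t} \<tau> * (L * K)) * \<bar>indicator {0..t} r * f r\<bar>" for \<tau> r
    proof (cases "0 \<le> r \<and> r \<le> \<tau> \<and> \<tau> \<le> t")
      case True
      then have "\<bar>k (t - \<tau>)\<bar> * (\<bar>\<rho> (\<tau> - r)\<bar> * \<bar>f r\<bar>) \<le> L * (K * \<bar>f r\<bar>)"
        by (intro mult_mono k \<rho>) (auto intro!: mult_nonneg_nonneg K)
      with True show ?thesis by (simp add: G_def abs_mult)
    next
      case False
      then have "G \<tau> r = 0" using k(1)[of "t - \<tau>"] \<rho>(1)[of "\<tau> - r"] f(2)[of r] by (auto simp: G_def)
      then show ?thesis using K by simp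
    qed
    from order_trans[OF this abs_ge_self]
    show "AE p in lborel2. norm (case_prod G p) \<le> norm ((indicator {0..t} (fst p) * (L * K)) * \<bar>indicator {0..t} (snd p) * f (snd p)\<bar>)"
      by (intro AE_I2) (auto simp only: split_beta' real_norm_def)
  qed
  have 1: "(LINT r|lborel. G \<tau> r) = k (t - \<tau>) * conv \<rho> f \<tau>" for \<tau>
    by (simp add: G_def conv_def)
  have 2: "(LINT \<tau>|lborel. G \<tau> r) = conv k \<rho> (t - r) * f r" for r
  proof -
    have "(LINT \<tau>|lborel. k (t - \<tau>) * \<rho> (\<tau> - r)) = (LINT u|lborel. k (t - r - u) * \<rho> u)"
      using lborel_integral_real_affine[of 1 "\<lambda>\<tau>. k (t - \<tau>) * \<rho> (\<tau> - r)" r] by (simp add: algebra_simps)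
    then show ?thesis unfolding G_def conv_def mult.assoc[symmetric] by simp
  qed
  show ?thesis
    using lborel_pair.integral_fst[OF G] lborel_pair.integral_snd[OF G] unfolding 1 2
    by (simp add: conv_def[of k "conv \<rho> f"] conv_def[of "conv k \<rho>" f])
qed

subsection \<open>Positivity of the symbols\<close>

text \<open>The bound on the second derivative makes oscillatory integrals of \<open>\<rho>\<close>
  decay quadratically in the frequency, and the vanishing of \<open>\<rho>\<close> and
  \<open>\<rho>'\<close> at 0 removes the boundary terms. \<open>K\<close> may be large: it serves
  for finiteness and domination and does not enter the energy estimate.\<close>

locale time_mollifier =
  fixes \<rho> \<rho>' \<rho>'' R :: "real \<Rightarrow> real" and K :: real
  assumes deriv: "\<And>t. (\<rho> has_real_derivative \<rho>' t) (at t)" "\<And>t. (\<rho>' has_real_derivative \<rho>'' t) (at t)"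
      "\<And>t. (R has_real_derivative \<rho> t) (at t)"
    and cont: "continuous_on UNIV \<rho>''"
    and zero: "\<And>t. t \<le> 0 \<Longrightarrow> \<rho> t = 0" "\<And>t. t \<le> 0 \<Longrightarrow> \<rho>' t = 0" "\<And>t. t \<le> 0 \<Longrightarrow> R t = 0"
    and bound: "\<And>t. \<bar>\<rho> t\<bar> \<le> K" "\<And>t. \<bar>\<rho>' t\<bar> \<le> K" "\<And>t. \<bar>\<rho>'' t\<bar> \<le> K"
    and nonneg: "\<And>t. 0 \<le> \<rho> t" "\<And>t. 0 \<le> R t" "\<And>t. R t \<le> 1"
begin

lemma K_nonneg: "0 \<le> K" using bound(1)[of 0] by linarith

lemma cont': "continuous_on A \<rho>" "continuous_on A \<rho>'" "continuous_on A R" "continuous_on A \<rho>''"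
  using DERIV_isCont[OF deriv(1)] DERIV_isCont[OF deriv(2)] DERIV_isCont[OF deriv(3)] continuous_on_subset[OF cont]
  by (auto intro!: continuous_at_imp_continuous_on)

lemma measurable' [measurable]: "\<rho> \<in> borel_measurable borel" "\<rho>' \<in> borel_measurable borel" "R \<in> borel_measurable borel"
  by (intro borel_measurable_continuous_onI cont')+

lemma conv_causal_cos_set:
  assumes "0 \<le> t"
  shows "conv (causal_cos \<omega>) \<rho> t = (LINT \<tau>|lborel. indicator {0..t} \<tau> *\<^sub>R (cos (\<omega> * (t - \<tau>)) * \<rho> \<tau>))"
  unfolding conv_def by (intro Bochner_Integration.integral_cong) (auto simp: causal_cos_def indicator_def zero)

text \<open>\<open>causal_cos 0\<close> is the Heaviside function, so convolution with it is
  integration from 0; in the Laplace variable this becomes the factor \<open>1 / s\<close>.\<close>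

lemma R_eq_conv: "R t = conv (causal_cos 0) \<rho> t"
proof (cases "0 \<le> t")
  case True
  have "(LINT \<tau>|lborel. indicator {0..t} \<tau> *\<^sub>R \<rho> \<tau>) = R t - R 0"
    by (rule integral_FTC_Icc[OF True])
      (auto simp: has_real_derivative_iff_has_vector_derivative[symmetric] cont' intro: has_field_derivative_at_within deriv)
  then show ?thesis using conv_causal_cos_set[OF True, of 0] by (simp add: zero)
next
  case False
  then show ?thesis using zero(3)[of t] conv_causal[of "causal_cos 0" \<rho> t] by (auto simp: causal_cos_def zero)
qed

text \<open>Two integrations by parts against the cosine bound \<open>\<omega>\<^sup>2\<close> times
  the convolution; the trivial bound \<open>K * t\<close> covers small frequencies, and adding both
  produces the factor \<open>1 + \<omega>\<^sup>2\<close>.\<close>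

lemma conv_causal_cos_bound:
  assumes t: "0 \<le> t"
  shows "\<bar>conv (causal_cos \<omega>) \<rho> t\<bar> \<le> 2 * K * exp t / (1 + \<omega>\<^sup>2)"
proof -
  define c where "c = conv (causal_cos \<omega>) \<rho> t"
  have int: "\<bar>LINT \<tau>|lborel. indicator {0..t} \<tau> *\<^sub>R (cos (\<omega> * (t - \<tau>)) * f \<tau>)\<bar> \<le> K * t"
    if f: "continuous_on UNIV f" "\<And>\<tau>. \<bar>f \<tau>\<bar> \<le> K" for f :: "real \<Rightarrow> real"
  proof -
    have bd: "\<bar>cos a * f b\<bar> \<le> K" for a b
      using mult_mono[OF abs_cos_le_one[of a] f(2)[of b]] by (simp add: abs_mult)
    have "\<bar>LINT \<tau>|lborel. indicator {0..t} \<tau> *\<^sub>R (cos (\<omega> * (t - \<tau>)) * f \<tau>)\<bar>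
        \<le> (LINT \<tau>|lborel. \<bar>indicator {0..t} \<tau> *\<^sub>R (cos (\<omega> * (t - \<tau>)) * f \<tau>)\<bar>)" by (rule integral_abs_bound)
    also have "\<dots> \<le> (LINT \<tau>|lborel. indicator {0..t} \<tau> * K)"
    proof (rule integral_mono)
      have "set_integrable lborel {0..t} (\<lambda>\<tau>. cos (\<omega> * (t - \<tau>)) * f \<tau>)"
        by (intro borel_integrable_atLeastAtMost' continuous_intros continuous_on_subset[OF f(1)]) auto
      then show "integrable lborel (\<lambda>\<tau>. \<bar>indicator {0..t} \<tau> *\<^sub>R (cos (\<omega> * (t - \<tau>)) * f \<tau>)\<bar>)"
        unfolding set_integrable_def by (rule integrable_abs)
      show "integrable lborel (\<lambda>\<tau>. indicator {0..t} \<tau> * K)"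
        by (intro integrable_mult_left integrable_real_indicator) (auto simp: emeasure_lborel_Icc_eq)
    qed (use bd in \<open>auto simp: indicator_def\<close>)
    also have "\<dots> = K * t" using t by simp
    finally show ?thesis .
  qed
  have 1: "\<bar>c\<bar> \<le> K * t"
    unfolding c_def conv_causal_cos_set[OF t] by (rule int) (auto simp: cont' bound)
  \<comment> \<open>Collects the boundary terms of both integrations by parts:
    \<open>A 0 = 0\<close> because \<open>\<rho>\<close> and \<open>\<rho>'\<close> vanish at 0, and
    \<open>A t = \<rho>' t\<close>.\<close>
  define A where "A \<tau> = cos (\<omega> * (t - \<tau>)) * \<rho>' \<tau> - \<omega> * sin (\<omega> * (t - \<tau>)) * \<rho> \<tau>" for \<tau>
  have si: "set_integrable lborel {0..t} (\<lambda>\<tau>. cos (\<omega> * (t - \<tau>)) * f \<tau>)" if "continuous_on {0..t} f" for f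
    by (intro borel_integrable_atLeastAtMost' continuous_intros that)
  have "(LINT \<tau>|lborel. indicator {0..t} \<tau> *\<^sub>R (cos (\<omega> * (t - \<tau>)) * \<rho>'' \<tau> + \<omega>\<^sup>2 * (cos (\<omega> * (t - \<tau>)) * \<rho> \<tau>))) = A t - A 0"
  proof (rule integral_FTC_Icc[OF t])
    fix \<tau> :: real
    have "(A has_real_derivative cos (\<omega> * (t - \<tau>)) * \<rho>'' \<tau> + \<omega>\<^sup>2 * (cos (\<omega> * (t - \<tau>)) * \<rho> \<tau>)) (at \<tau>)"
      unfolding A_def
      by (rule derivative_eq_intros deriv refl)+ (simp add: power2_eq_square algebra_simps)
    then show "(A has_vector_derivative cos (\<omega> * (t - \<tau>)) * \<rho>'' \<tau> + \<omega>\<^sup>2 * (cos (\<omega> * (t - \<tau>)) * \<rho> \<tau>)) (at \<tau> within {0..t})"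
      by (auto simp: has_real_derivative_iff_has_vector_derivative[symmetric] intro: has_field_derivative_at_within)
  qed (intro continuous_intros cont')
  also have "(LINT \<tau>|lborel. indicator {0..t} \<tau> *\<^sub>R (cos (\<omega> * (t - \<tau>)) * \<rho>'' \<tau> + \<omega>\<^sup>2 * (cos (\<omega> * (t - \<tau>)) * \<rho> \<tau>)))
     = (LINT \<tau>|lborel. indicator {0..t} \<tau> *\<^sub>R (cos (\<omega> * (t - \<tau>)) * \<rho>'' \<tau>)) + \<omega>\<^sup>2 * c"
    using si[OF cont'(4)] si[OF cont'(1)] unfolding set_integrable_def c_def conv_causal_cos_set[OF t]
    by (simp add: distrib_left mult.left_commute[of _ "\<omega>\<^sup>2"])
  also have "A t - A 0 = \<rho>' t" by (simp add: A_def zero)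
  finally have "\<omega>\<^sup>2 * c = \<rho>' t - (LINT \<tau>|lborel. indicator {0..t} \<tau> *\<^sub>R (cos (\<omega> * (t - \<tau>)) * \<rho>'' \<tau>))" by linarith
  then have "\<bar>\<omega>\<^sup>2 * c\<bar> \<le> K + K * t"
    using int[OF cont bound(3)] bound(2)[of t] by linarith
  then have "\<bar>c\<bar> * (1 + \<omega>\<^sup>2) \<le> K * (1 + 2 * t)"
    using 1 by (simp add: abs_mult algebra_simps)
  also have "\<dots> \<le> K * (2 * exp t)"
    using exp_ge_add_one_self[of t] t by (intro mult_left_mono K_nonneg) linarith
  finally have "\<bar>c\<bar> * (1 + \<omega>\<^sup>2) \<le> 2 * K * exp t" by simp
  moreover have "1 + \<omega>\<^sup>2 > 0" by (simp add: add_pos_nonneg)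
  ultimately show ?thesis unfolding c_def[symmetric] by (simp add: pos_le_divide_eq)
qed

end

lemma integrable_inverse_1_plus_square_UNIV: "integrable lborel (\<lambda>z::real. inverse (1 + z\<^sup>2))"
proof -
  have "einterval (-\<infinity>) \<infinity> = UNIV" by (auto simp: einterval_def)
  then show ?thesis using integrable_inverse_1_plus_square by (simp add: set_integrable_def)
qed

lemma exp_integrable_mono:
  assumes f: "integrable lborel (\<lambda>t. exp (- \<sigma> * t) * f t)" and f0: "\<And>t. t < 0 \<Longrightarrow> f t = 0"
    and s: "\<sigma> \<le> s" and [measurable]: "f \<in> borel_measurable borel"
  shows "integrable lborel (\<lambda>t. exp (- s * t) * f t :: real)"
proof (rule Bochner_Integration.integrable_bound[OF f])
  show "AE t in lborel. norm (exp (- s * t) * f t) \<le> norm (exp (- \<sigma> * t) * f t)"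
  proof (rule AE_I2)
    fix t show "norm (exp (- s * t) * f t) \<le> norm (exp (- \<sigma> * t) * f t)"
      using f0[of t] s by (cases "t < 0") (auto simp: abs_mult intro!: mult_right_mono)
  qed
qed measurable

context time_mollifier begin

text \<open>The factor \<open>1 / s\<close> contributed by \<open>R\<close> turns the symbol into
  \<open>c0 / s\<close> plus a superposition of \<open>s / (s\<^sup>2 + \<omega>\<^sup>2)\<close>,
  all transforms of \<open>causal_cos\<close>. By uniqueness \<open>conv R g\<close> is almost
  everywhere the same superposition of cosine convolutions of \<open>conv \<rho> f\<close>, and each
  of them is positive. The constant \<open>c0\<close> is an atom at frequency 0.\<close>

lemma positive_symbol:
  fixes f g w :: "real \<Rightarrow> real" and \<sigma> \<kappa> c0 c1 T :: real
  assumes \<sigma>: "1 \<le> \<sigma>"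
    and f: "integrable lborel (\<lambda>t. exp (- \<sigma> * t) * f t)" "\<And>t. t < 0 \<Longrightarrow> f t = 0" "f \<in> borel_measurable borel"
    and g: "integrable lborel (\<lambda>t. exp (- \<sigma> * t) * g t)" "\<And>t. t < 0 \<Longrightarrow> g t = 0" "g \<in> borel_measurable borel"
    and w: "w \<in> borel_measurable borel" "\<And>z. 0 \<le> w z" "\<And>z. w z \<le> 1" and c: "0 \<le> c0" "0 \<le> c1"
    and symb: "\<And>n::nat. \<sigma> < real n \<Longrightarrow> lap g (real n) =
        (c0 + c1 * real n * (LINT z|lborel. indicator {0<..} z * (w z * (real n / ((real n)\<^sup>2 + (\<kappa>\<^sup>2 + z\<^sup>2)))))) * lap f (real n)"
  shows "0 \<le> (LINT t:{0..T}|lborel. conv R g t * conv \<rho> f t)"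
proof -
  note [measurable] = f(3) g(3) w(1)
  define om where "om z = sqrt (\<kappa>\<^sup>2 + z\<^sup>2)" for z
  have om2: "(om z)\<^sup>2 = \<kappa>\<^sup>2 + z\<^sup>2" for z by (simp add: om_def)
  have [measurable]: "om \<in> borel_measurable borel" unfolding om_def[abs_def] by measurable
  define F where "F = (LINT t|lborel. \<bar>exp (- \<sigma> * t) * f t\<bar>)"
  have F: "0 \<le> F" by (simp add: F_def)
  define \<phi> where "\<phi> = conv \<rho> f"
  define \<psi> where "\<psi> = conv R g"
  define P where "P z = conv (causal_cos (om z)) \<phi>" for z
  define P0 where "P0 = conv (causal_cos 0) \<phi>"
  have cc0: "causal_cos a t = 0" if "t < 0" for a t using that by (simp add: causal_cos_def)
  have \<rho>0: "\<rho> t = 0" and R0: "R t = 0" if "t < 0" for t using that zero by auto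
  have f_loc: "integrable lborel (\<lambda>r. indicator {0..t} r * f r)" for t
  proof (rule Bochner_Integration.integrable_bound[OF integrable_mult_right[OF f(1), of "exp (\<sigma> * t)"]])
    have "\<bar>indicator {0..t} r * f r\<bar> \<le> exp (\<sigma> * t) * (exp (- \<sigma> * r) * \<bar>f r\<bar>)" for r
    proof (cases "r \<in> {0..t}")
      case True
      then have "1 \<le> exp (\<sigma> * t) * exp (- \<sigma> * r)" using \<sigma> by (simp add: exp_add[symmetric] mult_left_mono)
      then have "1 * \<bar>f r\<bar> \<le> (exp (\<sigma> * t) * exp (- \<sigma> * r)) * \<bar>f r\<bar>" by (intro mult_right_mono) auto
      with True show ?thesis by (simp add: mult.assoc)
    qed simp
    then show "AE r in lborel. norm (indicator {0..t} r * f r) \<le> norm (exp (\<sigma> * t) * (exp (- \<sigma> * r) * f r))"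
      by (intro AE_I2) (simp add: abs_mult)
  qed measurable
  have [measurable]: "\<phi> \<in> borel_measurable borel" "\<psi> \<in> borel_measurable borel" "P0 \<in> borel_measurable borel"
    unfolding \<phi>_def \<psi>_def P0_def by measurable
  have Pm [measurable]: "(\<lambda>x. P (u x) (v x)) \<in> borel_measurable M"
    if [measurable]: "u \<in> borel_measurable M" "v \<in> borel_measurable M" for u v and M :: "'z measure"
    unfolding P_def conv_def by measurable
  have \<phi>0: "\<phi> t = 0" and \<psi>0: "\<psi> t = 0" if "t < 0" for t
    using that by (auto simp: \<phi>_def \<psi>_def intro!: conv_causal \<rho>0 R0 f(2) g(2))
  have P_0: "P z t = 0" and P0_0: "P0 t = 0" if "t < 0" for t z
    using that by (auto simp: P_def P0_def intro!: conv_causal cc0 \<phi>0)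
  \<comment> \<open>The cosine is moved from \<open>\<phi>\<close> onto the smooth kernel
    \<open>\<rho>\<close>, where oscillation produces decay in the frequency; \<open>f\<close>
    itself is merely integrable.\<close>
  have P_assoc: "conv (causal_cos a) \<phi> t = conv (conv (causal_cos a) \<rho>) f t" for a t
    unfolding \<phi>_def by (rule conv_assoc_causal) (auto simp: cc0 \<rho>0 f f_loc intro: causal_cos_bound bound)
  have P_bd': "\<bar>conv (causal_cos a) \<phi> t\<bar> \<le> 2 * K / (1 + a\<^sup>2) * exp (\<sigma> * t) * F" for a t
    unfolding P_assoc F_def
  proof (rule conv_exp_bound[OF f(1)])
    show "conv (causal_cos a) \<rho> t = 0" if "t < 0" for t
      using that by (intro conv_causal cc0 \<rho>0)
    show "\<bar>conv (causal_cos a) \<rho> t\<bar> \<le> 2 * K / (1 + a\<^sup>2) * exp (\<sigma> * t)" if "0 \<le> t" for t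
    proof -
      have "2 * K * exp t / (1 + a\<^sup>2) \<le> 2 * K * exp (\<sigma> * t) / (1 + a\<^sup>2)"
        using that \<sigma> K_nonneg mult_right_mono[of 1 \<sigma> t] by (intro divide_right_mono mult_left_mono) auto
      with conv_causal_cos_bound[OF that, of a] show ?thesis by simp
    qed
  qed
  \<comment> \<open>An integrable majorant in \<open>z\<close>, valid because
    \<open>(om z)\<^sup>2\<close> is at least \<open>z\<^sup>2\<close>.\<close>
  define D where "D z = inverse (1 + z\<^sup>2) * (2 * K * F)" for z :: real
  have D: "integrable lborel D" "\<And>z. 0 \<le> D z"
    unfolding D_def[abs_def] using integrable_inverse_1_plus_square_UNIV K_nonneg F by (auto intro!: mult_nonneg_nonneg)
  have P_bd: "\<bar>P z t\<bar> \<le> D z * exp (\<sigma> * t)" for z t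
  proof -
    have "2 * K / (1 + (om z)\<^sup>2) * exp (\<sigma> * t) * F \<le> 2 * K / (1 + z\<^sup>2) * exp (\<sigma> * t) * F"
      using K_nonneg F by (intro mult_right_mono divide_left_mono) (auto simp: om2 add_pos_nonneg)
    with P_bd'[of "om z" t] show ?thesis by (simp add: P_def D_def divide_inverse mult_ac)
  qed
  have \<phi>_bd: "\<bar>\<phi> t\<bar> \<le> K * exp (\<sigma> * t) * F" for t
    unfolding \<phi>_def F_def
  proof (rule conv_exp_bound[OF f(1) \<rho>0])
    show "\<bar>\<rho> t\<bar> \<le> K * exp (\<sigma> * t)" if "0 \<le> t" for t
      using bound(1)[of t] that \<sigma> K_nonneg order_trans[OF _ mult_left_mono[of 1 "exp (\<sigma> * t)" K]] by auto
  qed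
  have wi: "0 \<le> indicator {0<..} z * w z" "indicator {0<..} z * w z \<le> 1" for z
    using w by (auto simp: indicator_def)
  \<comment> \<open>Applied twice: with an exponential as \<open>q\<close> for the Laplace
    transform, and with the truncated \<open>\<phi>\<close> as \<open>q\<close> for the
    energy.\<close>
  have W: "integrable lborel2 (\<lambda>(z, t). indicator {0<..} z * w z * (q t * P z t))"
    if q: "integrable lborel (\<lambda>t. q t * exp (\<sigma> * t) * indicator {0..} t)" and [measurable]: "q \<in> borel_measurable borel" for q
  proof -
    have "integrable lborel2 (\<lambda>p. D (fst p) * (q (snd p) * exp (\<sigma> * snd p) * indicator {0..} (snd p)))"
      using lborel_pair.Fubini_integrable[of "\<lambda>p. D (fst p) * (q (snd p) * exp (\<sigma> * snd p) * indicator {0..} (snd p))"] D(1) q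
      by (auto simp: abs_mult D_def integrable_inverse_1_plus_square_UNIV)
    then show ?thesis
    proof (rule Bochner_Integration.integrable_bound)
      show "(\<lambda>(z, t). indicator {0<..} z * w z * (q t * P z t)) \<in> borel_measurable lborel2"
        by measurable
      have "\<bar>(indicator {0<..} z * w z) * (q t * P z t)\<bar> \<le> \<bar>D z * (q t * exp (\<sigma> * t) * indicator {0..} t)\<bar>" for z t
      proof (cases "t < 0")
        case False
        have "\<bar>indicator {0<..} z * w z\<bar> * (\<bar>q t\<bar> * \<bar>P z t\<bar>) \<le> 1 * (\<bar>q t\<bar> * (D z * exp (\<sigma> * t)))"
          using wi[of z] by (intro mult_mono mult_left_mono P_bd) auto
        then show ?thesis using False D(2)[of z] by (simp add: abs_mult mult_ac)
      qed (simp add: P_0)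
      then show "AE p in lborel2. norm (case p of (z, t) \<Rightarrow> indicator {0<..} z * w z * (q t * P z t))
          \<le> norm (D (fst p) * (q (snd p) * exp (\<sigma> * snd p) * indicator {0..} (snd p)))"
        by (intro AE_I2) (auto simp only: split_beta' real_norm_def)
    qed
  qed
  \<comment> \<open>The continuous part of the superposition that the symbol prescribes for
    \<open>conv R g\<close>; the atom is added in \<open>\<Psi>\<close>.\<close>
  define \<Psi>1 where "\<Psi>1 t = (LINT z|lborel. indicator {0<..} z * w z * P z t)" for t
  define \<Psi> where "\<Psi> t = c0 * P0 t + c1 * \<Psi>1 t" for t
  have [measurable]: "\<Psi>1 \<in> borel_measurable borel" "\<Psi> \<in> borel_measurable borel"
    unfolding \<Psi>1_def[abs_def] \<Psi>_def[abs_def] by measurable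
  have avg: "(LINT z|lborel. indicator {0<..} z * w z * (q * P z t)) = q * \<Psi>1 t" for q t
    unfolding \<Psi>1_def integral_mult_right_zero[symmetric] by (simp add: mult_ac)
  have \<Psi>_0: "\<Psi> t = 0" if "t < 0" for t using that by (simp add: \<Psi>_def P0_0 \<Psi>1_def P_0)
  have lap_int: "integrable lborel (\<lambda>t. exp (- s * t) * \<phi> t)" "integrable lborel (\<lambda>t. exp (- s * t) * \<psi> t)"
      "integrable lborel (\<lambda>t. exp (- s * t) * P0 t)" "integrable lborel (\<lambda>t. exp (- s * t) * \<Psi>1 t)"
    and lap_eq: "lap \<phi> s = lap \<rho> s * lap f s" "lap \<psi> s = lap R s * lap g s" "lap P0 s = lap \<phi> s / s"
      "lap \<Psi>1 s = (LINT z|lborel. indicator {0<..} z * (w z * (s / (s\<^sup>2 + (\<kappa>\<^sup>2 + z\<^sup>2))))) * lap \<phi> s"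
      "lap R s = lap \<rho> s / s"
    if s: "\<sigma> < s" for s
  proof -
    have s0: "0 < s" using s \<sigma> by simp
    have R: "\<bar>R t\<bar> \<le> 1" for t using nonneg(2,3)[of t] by simp
    have fi: "integrable lborel (\<lambda>t. exp (- s * t) * f t)"
      by (rule exp_integrable_mono[OF f(1,2) less_imp_le[OF s] f(3)])
    have gi: "integrable lborel (\<lambda>t. exp (- s * t) * g t)"
      by (rule exp_integrable_mono[OF g(1,2) less_imp_le[OF s] g(3)])
    have \<rho>i: "integrable lborel (\<lambda>t. exp (- s * t) * \<rho> t)"
      by (rule exp_integrable_bounded[OF s0 _ \<rho>0 bound(1)]) measurable
    have Ri: "integrable lborel (\<lambda>t. exp (- s * t) * R t)"
      by (rule exp_integrable_bounded[OF s0 _ R0 R]) measurable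
    have Ci: "integrable lborel (\<lambda>t. exp (- s * t) * causal_cos a t)" for a
      by (rule exp_integrable_bounded[OF s0 _ cc0 causal_cos_bound]) measurable
    show \<phi>i: "integrable lborel (\<lambda>t. exp (- s * t) * \<phi> t)" unfolding \<phi>_def by (rule integrable_exp_conv[OF \<rho>i fi])
    show "integrable lborel (\<lambda>t. exp (- s * t) * \<psi> t)" unfolding \<psi>_def by (rule integrable_exp_conv[OF Ri gi])
    show "integrable lborel (\<lambda>t. exp (- s * t) * P0 t)" unfolding P0_def by (rule integrable_exp_conv[OF Ci \<phi>i])
    show "lap \<phi> s = lap \<rho> s * lap f s" unfolding \<phi>_def by (rule lap_conv[OF \<rho>i fi])
    show "lap \<psi> s = lap R s * lap g s" unfolding \<psi>_def by (rule lap_conv[OF Ri gi])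
    show "lap P0 s = lap \<phi> s / s" unfolding P0_def lap_conv[OF Ci \<phi>i] lap_causal_cos[OF s0]
      using s0 by (simp add: power2_eq_square)
    have "lap R s = lap (causal_cos 0) s * lap \<rho> s" 
      unfolding lap_conv[OF Ci \<rho>i, symmetric] using R_eq_conv by (metis ext)
    then show "lap R s = lap \<rho> s / s" using s0 by (simp add: lap_causal_cos[OF s0] power2_eq_square)
    have "integrable lborel (\<lambda>t. exp (- s * t) * exp (\<sigma> * t) * indicator {0..} t)"
      using exp_integrable[of "s - \<sigma>"] s by (simp add: exp_add[symmetric] algebra_simps)
    from W[OF this] have WI: "integrable lborel2 (\<lambda>(z, t). indicator {0<..} z * w z * (exp (- s * t) * P z t))"
      by simp
    show "integrable lborel (\<lambda>t. exp (- s * t) * \<Psi>1 t)"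
      using lborel_pair.integrable_snd[OF WI] unfolding avg .
    have "lap \<Psi>1 s = (LINT z|lborel. LINT t|lborel. indicator {0<..} z * w z * (exp (- s * t) * P z t))"
      using lborel_pair.integral_fst[OF WI] lborel_pair.integral_snd[OF WI] unfolding avg lap_def by simp
    also have "\<dots> = (LINT z|lborel. indicator {0<..} z * (w z * (s / (s\<^sup>2 + (\<kappa>\<^sup>2 + z\<^sup>2)))) * lap \<phi> s)"
      using lap_conv[OF Ci \<phi>i] unfolding lap_causal_cos[OF s0] P_def
      by (intro Bochner_Integration.integral_cong refl) (simp add: om2 lap_def[of "conv _ _"])
    finally show "lap \<Psi>1 s = (LINT z|lborel. indicator {0<..} z * (w z * (s / (s\<^sup>2 + (\<kappa>\<^sup>2 + z\<^sup>2))))) * lap \<phi> s"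
      unfolding integral_mult_left_zero .
  qed
  \<comment> \<open>The extra 1 makes the next inequality strict, as the assumption on the symbol
    requires.\<close>
  define N where "N = nat \<lceil>\<sigma>\<rceil> + 1"
  have N: "\<sigma> < real N" unfolding N_def by linarith
  have "AE t in lborel. \<psi> t - \<Psi> t = 0"
  proof (rule lap_unique)
    have int: "integrable lborel (\<lambda>t. exp (- s * t) * (\<psi> t - \<Psi> t))"
      and lap: "lap (\<lambda>t. \<psi> t - \<Psi> t) s = lap \<psi> s - (c0 * lap P0 s + c1 * lap \<Psi>1 s)" if "\<sigma> < s" for s
    proof -
      have e: "exp (- s * t) * (\<psi> t - \<Psi> t) = exp (- s * t) * \<psi> t - (c0 * (exp (- s * t) * P0 t) + c1 * (exp (- s * t) * \<Psi>1 t))" for t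
        by (simp add: \<Psi>_def algebra_simps)
      show "integrable lborel (\<lambda>t. exp (- s * t) * (\<psi> t - \<Psi> t))" unfolding e
        by (intro Bochner_Integration.integrable_diff Bochner_Integration.integrable_add integrable_mult_right lap_int that)
      show "lap (\<lambda>t. \<psi> t - \<Psi> t) s = lap \<psi> s - (c0 * lap P0 s + c1 * lap \<Psi>1 s)"
        unfolding lap_def e using lap_int[OF that] by simp
    qed
    show "integrable lborel (\<lambda>t. exp (- real N * t) * (\<psi> t - \<Psi> t))" by (rule int[OF N])
    show "\<psi> t - \<Psi> t = 0" if "t < 0" for t using that by (simp add: \<psi>0 \<Psi>_0)
    fix n assume "N \<le> n"
    then have n: "\<sigma> < real n" using N by linarith
    then have n0: "real n > 0" using \<sigma> by linarith
    show "lap (\<lambda>t. \<psi> t - \<Psi> t) (real n) = 0"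
      unfolding lap[OF n] lap_eq(2-5)[OF n] lap_eq(1)[OF n] symb[OF n] using n0 by (simp add: field_simps)
  qed
  then have ae: "AE t in lborel. \<psi> t = \<Psi> t" by simp
  have cos_pos: "0 \<le> (LINT t:{0..T}|lborel. conv (causal_cos a) \<phi> t * \<phi> t)" for a
  proof -
    \<comment> \<open>Truncation makes \<open>\<phi>\<close> integrable on the whole line, and by
      causality it leaves the convolution unchanged at times up to \<open>T\<close>.\<close>
    define \<phi>T where "\<phi>T t = indicator {0..T} t * \<phi> t" for t
    have "integrable lborel \<phi>T"
    proof (rule Bochner_Integration.integrable_bound[where f = "\<lambda>t. indicator {0..T} t * (K * exp (\<sigma> * T) * F)"])
      show "integrable lborel (\<lambda>t. indicator {0..T} t * (K * exp (\<sigma> * T) * F))"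
        by (intro integrable_mult_left integrable_real_indicator) (auto simp: emeasure_lborel_Icc_eq)
      show "\<phi>T \<in> borel_measurable lborel" unfolding \<phi>T_def[abs_def] by measurable
      have "\<bar>\<phi>T t\<bar> \<le> indicator {0..T} t * (K * exp (\<sigma> * T) * F)" for t
      proof (cases "t \<in> {0..T}")
        case True
        have "K * exp (\<sigma> * t) * F \<le> K * exp (\<sigma> * T) * F"
          using True \<sigma> F K_nonneg by (intro mult_right_mono mult_left_mono) auto
        with True \<phi>_bd[of t] show ?thesis by (simp add: \<phi>T_def)
      qed (simp add: \<phi>T_def)
      then show "AE t in lborel. norm (\<phi>T t) \<le> norm (indicator {0..T} t * (K * exp (\<sigma> * T) * F))"
        by (intro AE_I2) (auto intro: order_trans[OF _ abs_ge_self])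
    qed
    from causal_cos_positive[OF this, of a]
    have "0 \<le> (LINT t|lborel. conv (causal_cos a) \<phi>T t * \<phi>T t)" .
    moreover have "conv (causal_cos a) \<phi>T t * \<phi>T t = indicator {0..T} t *\<^sub>R (conv (causal_cos a) \<phi> t * \<phi> t)" for t
    proof (cases "t \<in> {0..T}")
      case True
      have "causal_cos a (t - \<tau>) * \<phi>T \<tau> = causal_cos a (t - \<tau>) * \<phi> \<tau>" for \<tau>
        using True \<phi>0[of \<tau>] by (cases "\<tau> < 0") (auto simp: \<phi>T_def causal_cos_def indicator_def)
      then have "conv (causal_cos a) \<phi>T t = conv (causal_cos a) \<phi> t" unfolding conv_def by presburger
      with True show ?thesis by (simp add: \<phi>T_def)
    qed (simp add: \<phi>T_def)
    ultimately show ?thesis by (simp add: set_lebesgue_integral_def)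
  qed
  have bdT: "\<bar>indicator {0..T} t * \<phi> t\<bar> \<le> indicator {0..T} t * (K * exp (\<sigma> * T) * F)" for t
  proof (cases "t \<in> {0..T}")
    case True
    have "K * exp (\<sigma> * t) * F \<le> K * exp (\<sigma> * T) * F"
      using True \<sigma> F K_nonneg by (intro mult_right_mono mult_left_mono) auto
    with True \<phi>_bd[of t] show ?thesis by simp
  qed simp
  have q: "integrable lborel (\<lambda>t. indicator {0..T} t * \<phi> t * exp (\<sigma> * t) * indicator {0..} t)"
  proof (rule Bochner_Integration.integrable_bound[where f = "\<lambda>t. indicator {0..T} t * (K * exp (\<sigma> * T) * F * exp (\<sigma> * T))"])
    show "integrable lborel (\<lambda>t. indicator {0..T} t * (K * exp (\<sigma> * T) * F * exp (\<sigma> * T)))"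
      by (intro integrable_mult_left integrable_real_indicator) (auto simp: emeasure_lborel_Icc_eq)
    have "\<bar>indicator {0..T} t * \<phi> t * exp (\<sigma> * t) * indicator {0..} t\<bar> \<le> indicator {0..T} t * (K * exp (\<sigma> * T) * F * exp (\<sigma> * T))" for t
    proof (cases "t \<in> {0..T}")
      case True
      then have "\<bar>\<phi> t\<bar> * exp (\<sigma> * t) \<le> K * exp (\<sigma> * T) * F * exp (\<sigma> * T)"
        using bdT[of t] \<sigma> K_nonneg F by (intro mult_mono) (auto intro!: mult_nonneg_nonneg)
      with True show ?thesis by (simp add: abs_mult)
    qed simp
    then show "AE t in lborel. norm (indicator {0..T} t * \<phi> t * exp (\<sigma> * t) * indicator {0..} t) \<le> norm (indicator {0..T} t * (K * exp (\<sigma> * T) * F * exp (\<sigma> * T)))"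
      by (intro AE_I2) (auto intro: order_trans[OF _ abs_ge_self])
  qed measurable
  have WI: "integrable lborel2 (\<lambda>(z, t). indicator {0<..} z * w z * (indicator {0..T} t * \<phi> t * P z t))"
    by (rule W[OF q]) measurable
  have I1: "integrable lborel (\<lambda>t. indicator {0..T} t * \<phi> t * \<Psi>1 t)"
    using lborel_pair.integrable_snd[OF WI] unfolding avg .
  have "(LINT t|lborel. indicator {0..T} t * \<phi> t * \<Psi>1 t)
      = (LINT z|lborel. LINT t|lborel. indicator {0<..} z * w z * (indicator {0..T} t * \<phi> t * P z t))"
    using lborel_pair.integral_fst[OF WI] lborel_pair.integral_snd[OF WI] unfolding avg by simp
  also have "\<dots> = (LINT z|lborel. indicator {0<..} z * w z * (LINT t:{0..T}|lborel. P z t * \<phi> t))"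
    unfolding set_lebesgue_integral_def integral_mult_right_zero
    by (intro Bochner_Integration.integral_cong refl) (simp add: mult_ac)
  also have "\<dots> \<ge> 0"
    unfolding P_def by (intro Bochner_Integration.integral_nonneg mult_nonneg_nonneg wi(1) cos_pos)
  finally have p1: "0 \<le> (LINT t|lborel. indicator {0..T} t * \<phi> t * \<Psi>1 t)" .
  have I0: "integrable lborel (\<lambda>t. indicator {0..T} t * \<phi> t * P0 t)"
  proof (rule Bochner_Integration.integrable_bound[OF integrable_mult_right[OF q, of "2 * K * F"]])
    show "AE t in lborel. norm (indicator {0..T} t * \<phi> t * P0 t) \<le> norm (2 * K * F * (indicator {0..T} t * \<phi> t * exp (\<sigma> * t) * indicator {0..} t))"
    proof (rule AE_I2)
      fix t
      have "\<bar>P0 t\<bar> \<le> 2 * K * F * exp (\<sigma> * t)" using P_bd'[of 0 t] by (simp add: P0_def mult_ac)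
      then have "\<bar>indicator {0..T} t * \<phi> t\<bar> * \<bar>P0 t\<bar> \<le> \<bar>indicator {0..T} t * \<phi> t\<bar> * (2 * K * F * exp (\<sigma> * t))"
        by (intro mult_left_mono) auto
      then show "norm (indicator {0..T} t * \<phi> t * P0 t) \<le> norm (2 * K * F * (indicator {0..T} t * \<phi> t * exp (\<sigma> * t) * indicator {0..} t))"
        using K_nonneg F by (cases "t \<in> {0..T}") (auto simp: abs_mult mult_ac)
    qed
  qed measurable
  have p0: "0 \<le> (LINT t|lborel. indicator {0..T} t * \<phi> t * P0 t)"
    using cos_pos[of 0] by (simp add: set_lebesgue_integral_def P0_def mult_ac)
  have "(LINT t:{0..T}|lborel. \<psi> t * \<phi> t) = (LINT t|lborel. c0 * (indicator {0..T} t * \<phi> t * P0 t) + c1 * (indicator {0..T} t * \<phi> t * \<Psi>1 t))"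
    unfolding set_lebesgue_integral_def
  proof (rule integral_cong_AE)
    show "AE t in lborel. indicator {0..T} t *\<^sub>R (\<psi> t * \<phi> t) = c0 * (indicator {0..T} t * \<phi> t * P0 t) + c1 * (indicator {0..T} t * \<phi> t * \<Psi>1 t)"
      using ae by eventually_elim (simp add: \<Psi>_def algebra_simps)
  qed measurable
  also have "\<dots> = c0 * (LINT t|lborel. indicator {0..T} t * \<phi> t * P0 t) + c1 * (LINT t|lborel. indicator {0..T} t * \<phi> t * \<Psi>1 t)"
    using I0 I1 by simp
  also have "\<dots> \<ge> 0" using c p0 p1 by simp
  finally show ?thesis by (simp add: \<psi>_def \<phi>_def)
qed

end

section \<open>Integral representations of the two symbols\<close>

lemma
  assumes a: "0 < (a::real)"
  shows integrable_inverse_sum_squares: "integrable lborel (\<lambda>z. indicator {0<..} z * (1 / (a\<^sup>2 + z\<^sup>2)))"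
    and integral_inverse_sum_squares: "(LINT z|lborel. indicator {0<..} z * (1 / (a\<^sup>2 + z\<^sup>2))) = pi / (2 * a)"
proof -
  have pos: "a\<^sup>2 + z\<^sup>2 > 0" for z using a by (simp add: add_pos_nonneg)
  have "(\<integral>\<^sup>+z. ennreal (1 / (a\<^sup>2 + z\<^sup>2)) * indicator {0..} z \<partial>lborel) = ennreal (pi / (2 * a) - arctan (0 / a) / a)"
  proof (rule nn_integral_FTC_atLeast)
    show "DERIV (\<lambda>z. arctan (z / a) / a) z :> 1 / (a\<^sup>2 + z\<^sup>2)" for z
    proof -
      have "DERIV (\<lambda>z. arctan (z / a) / a) z :> ((1 / a) / (1 + (z / a)\<^sup>2)) / a"
        using a by (auto intro!: derivative_eq_intros simp: divide_inverse mult_ac)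
      also have "((1 / a) / (1 + (z / a)\<^sup>2)) / a = 1 / (a\<^sup>2 + z\<^sup>2)"
      proof -
        have "a * (a * (1 + (z / a)\<^sup>2)) = a\<^sup>2 + z\<^sup>2" using a by (simp add: field_simps power2_eq_square)
        moreover have "(1 / a) / (1 + (z / a)\<^sup>2) / a = 1 / (a * (a * (1 + (z / a)\<^sup>2)))" by simp
        ultimately show ?thesis by metis
      qed
      finally show ?thesis .
    qed
    have "filterlim (\<lambda>z. z / a) at_top at_top" using a by real_asymp
    then have "((\<lambda>z. arctan (z / a)) \<longlongrightarrow> pi / 2) at_top"
      by (rule filterlim_compose[OF tendsto_arctan_at_top])
    then have "((\<lambda>z. arctan (z / a) / a) \<longlongrightarrow> pi / 2 / a) at_top"
      using a by (intro tendsto_divide tendsto_const) auto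
    then show "((\<lambda>z. arctan (z / a) / a) \<longlongrightarrow> pi / (2 * a)) at_top" by simp
    show "0 \<le> 1 / (a\<^sup>2 + z\<^sup>2)" for z using pos[of z] by simp
  qed measurable
  moreover have "(\<integral>\<^sup>+z. ennreal (indicator {0<..} z * (1 / (a\<^sup>2 + z\<^sup>2))) \<partial>lborel) = (\<integral>\<^sup>+z. ennreal (1 / (a\<^sup>2 + z\<^sup>2)) * indicator {0..} z \<partial>lborel)"
    using AE_lborel_singleton[of 0] by (intro nn_integral_cong_AE) (auto elim!: eventually_mono simp: indicator_def)
  ultimately have nn: "(\<integral>\<^sup>+z. ennreal (indicator {0<..} z * (1 / (a\<^sup>2 + z\<^sup>2))) \<partial>lborel) = ennreal (pi / (2 * a))"
    by simp
  have nonneg: "0 \<le> indicator {0<..} z * (1 / (a\<^sup>2 + z\<^sup>2))" for z using pos[of z] by simp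
  show I: "integrable lborel (\<lambda>z. indicator {0<..} z * (1 / (a\<^sup>2 + z\<^sup>2)))"
    by (rule integrableI_nonneg) (use nn nonneg in \<open>auto intro: always_eventually\<close>)
  have "ennreal (LINT z|lborel. indicator {0<..} z * (1 / (a\<^sup>2 + z\<^sup>2))) = ennreal (pi / (2 * a))"
    unfolding nn[symmetric] by (rule nn_integral_eq_integral[OF I, symmetric]) (use nonneg in auto)
  then show "(LINT z|lborel. indicator {0<..} z * (1 / (a\<^sup>2 + z\<^sup>2))) = pi / (2 * a)"
    using a by (subst (asm) ennreal_inj) (auto intro!: Bochner_Integration.integral_nonneg nonneg)
qed

text \<open>With weight 1 the integrand is a multiple of a Cauchy density of width
  \<open>sqrt (s\<^sup>2 + \<kappa>\<^sup>2)\<close>.\<close>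

lemma symbol_integral_parallel:
  assumes s: "0 < (s::real)"
  shows "(LINT z|lborel. indicator {0<..} z * (1 * (s / (s\<^sup>2 + (\<kappa>\<^sup>2 + z\<^sup>2))))) = pi / 2 * (s / sqrt (s\<^sup>2 + \<kappa>\<^sup>2))"
proof -
  have pos: "0 < s\<^sup>2 + \<kappa>\<^sup>2" using s by (simp add: add_pos_nonneg)
  have "indicator {0<..} z * (1 * (s / (s\<^sup>2 + (\<kappa>\<^sup>2 + z\<^sup>2)))) = s * (indicator {0<..} z * (1 / ((sqrt (s\<^sup>2 + \<kappa>\<^sup>2))\<^sup>2 + z\<^sup>2)))" for z
    using pos by (simp add: add.assoc)
  then show ?thesis
    unfolding integral_mult_right_zero using integral_inverse_sum_squares[of "sqrt (s\<^sup>2 + \<kappa>\<^sup>2)"] pos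
    by (simp only: integral_mult_right_zero) simp
qed

text \<open>Partial fractions in \<open>z\<^sup>2\<close> give a difference of two Cauchy integrals.
  Subtracting \<open>\<kappa>\<close> has a reason: for positive \<open>\<kappa>\<close> the
  quotient \<open>sqrt (s\<^sup>2 + \<kappa>\<^sup>2) / s\<close> has a pole at 0 like
  \<open>\<kappa> / s\<close>, the transform of a constant, which cosines of frequency above
  \<open>\<kappa>\<close> cannot produce.\<close>

lemma symbol_integral_perp:
  assumes s: "0 < (s::real)" and \<kappa>: "0 \<le> \<kappa>"
  shows "(LINT z|lborel. indicator {0<..} z * (z\<^sup>2 / (\<kappa>\<^sup>2 + z\<^sup>2) * (s / (s\<^sup>2 + (\<kappa>\<^sup>2 + z\<^sup>2))))) = pi / 2 * ((sqrt (s\<^sup>2 + \<kappa>\<^sup>2) - \<kappa>) / s)"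
proof -
  define A where "A = sqrt (s\<^sup>2 + \<kappa>\<^sup>2)"
  have pos: "0 < s\<^sup>2 + \<kappa>\<^sup>2" using s by (simp add: add_pos_nonneg)
  then have A: "0 < A" "A\<^sup>2 = s\<^sup>2 + \<kappa>\<^sup>2" by (simp_all add: A_def)
  \<comment> \<open>For \<open>\<kappa> = 0\<close> the second Cauchy integral diverges while its
    factor \<open>\<kappa>\<^sup>2\<close> removes it, hence the case distinction.\<close>
  have k: "integrable lborel (\<lambda>z. \<kappa>\<^sup>2 * (indicator {0<..} z * (1 / (\<kappa>\<^sup>2 + z\<^sup>2)))) \<and>
     (LINT z|lborel. \<kappa>\<^sup>2 * (indicator {0<..} z * (1 / (\<kappa>\<^sup>2 + z\<^sup>2)))) = pi * \<kappa> / 2"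
  proof (cases "\<kappa> = 0")
    case False
    then have "0 < \<kappa>" using \<kappa> by simp
    have "\<kappa>\<^sup>2 * (pi / (2 * \<kappa>)) = pi * \<kappa> / 2" using \<open>0 < \<kappa>\<close> by (simp add: power2_eq_square)
    then show ?thesis
      unfolding integral_mult_right_zero integral_inverse_sum_squares[OF \<open>0 < \<kappa>\<close>]
      by (intro conjI integrable_mult_right integrable_inverse_sum_squares[OF \<open>0 < \<kappa>\<close>])
  qed simp
  have "indicator {0<..} z * (z\<^sup>2 / (\<kappa>\<^sup>2 + z\<^sup>2) * (s / (s\<^sup>2 + (\<kappa>\<^sup>2 + z\<^sup>2))))
      = 1 / s * (A\<^sup>2 * (indicator {0<..} z * (1 / (A\<^sup>2 + z\<^sup>2))) - \<kappa>\<^sup>2 * (indicator {0<..} z * (1 / (\<kappa>\<^sup>2 + z\<^sup>2))))" for z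
  proof (cases "0 < z")
    case True
    have p: "0 < A\<^sup>2 + z\<^sup>2" "0 < \<kappa>\<^sup>2 + z\<^sup>2" using True A(1) by (simp_all add: add_nonneg_pos)
    have "A\<^sup>2 / (A\<^sup>2 + z\<^sup>2) - \<kappa>\<^sup>2 / (\<kappa>\<^sup>2 + z\<^sup>2) = (A\<^sup>2 * (\<kappa>\<^sup>2 + z\<^sup>2) - \<kappa>\<^sup>2 * (A\<^sup>2 + z\<^sup>2)) / ((A\<^sup>2 + z\<^sup>2) * (\<kappa>\<^sup>2 + z\<^sup>2))"
      using p by (subst diff_frac_eq) auto
    also have "A\<^sup>2 * (\<kappa>\<^sup>2 + z\<^sup>2) - \<kappa>\<^sup>2 * (A\<^sup>2 + z\<^sup>2) = s\<^sup>2 * z\<^sup>2" by (simp add: A algebra_simps)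
    finally show ?thesis using True s A(2) by (simp add: power2_eq_square[of s] add.assoc mult_ac)
  qed simp
  then have "(LINT z|lborel. indicator {0<..} z * (z\<^sup>2 / (\<kappa>\<^sup>2 + z\<^sup>2) * (s / (s\<^sup>2 + (\<kappa>\<^sup>2 + z\<^sup>2))))) = 1 / s * (A\<^sup>2 * (pi / (2 * A)) - pi * \<kappa> / 2)"
    using k integrable_mult_right[OF integrable_inverse_sum_squares[OF A(1)], of "A\<^sup>2"] integral_inverse_sum_squares[OF A(1)]
    by (simp only: integral_mult_right_zero Bochner_Integration.integral_diff)
  also have "A\<^sup>2 * (pi / (2 * A)) = pi / 2 * A" using A(1) by (simp add: power2_eq_square)
  finally show ?thesis unfolding A_def by (simp add: field_simps)
qed

subsection \<open>The boundary operators at a fixed frequency\<close>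

text \<open>Up to a factor \<open>\<i>\<close>, \<open>par\<close> and \<open>per\<close> are the
  Fourier symbols of the surface divergence and the surface curl. They are left unnormalised, in the
  form in which they occur in the trace densities.\<close>

definition par :: "real^2 \<Rightarrow> complex^2 \<Rightarrow> complex" where
  "par \<xi> g = \<xi> $ 1 * g $ 1 + \<xi> $ 2 * g $ 2"

definition per :: "real^2 \<Rightarrow> complex^2 \<Rightarrow> complex" where
  "per \<xi> g = \<xi> $ 1 * g $ 2 - \<xi> $ 2 * g $ 1"

lemma norm_power2_real2: "(norm (\<xi>::real^2))\<^sup>2 = (\<xi> $ 1)\<^sup>2 + (\<xi> $ 2)\<^sup>2"
  unfolding power2_norm_eq_inner inner_vec_def sum_2 by (simp add: power2_eq_square)

lemma cdot_par_per: "complex_of_real ((norm \<xi>)\<^sup>2) * cdot x y = par \<xi> x * cnj (par \<xi> y) + per \<xi> x * cnj (per \<xi> y)"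
  unfolding norm_power2_real2 cdot_def sum_2 par_def per_def by (simp add: algebra_simps power2_eq_square)

lemma Re_cdot: "Re (cdot a b) = a \<bullet> b"
  by (simp add: cdot_def inner_vec_def inner_complex_def)

lemma inner_par_per: "(norm \<xi>)\<^sup>2 * (x \<bullet> y) = par \<xi> x \<bullet> par \<xi> y + per \<xi> x \<bullet> per \<xi> y"
  using arg_cong[OF cdot_par_per[of \<xi> x y], of Re] unfolding Re_complex_of_real
  by (simp add: Re_cdot[symmetric] inner_complex_def)

lemma par_bounded_linear: "bounded_linear (par \<xi>)"
proof -
  have "bounded_linear (\<lambda>g::complex^2. complex_of_real (\<xi> $ 1) * g $ 1 + complex_of_real (\<xi> $ 2) * g $ 2)"
    by (intro bounded_linear_add bounded_linear_const_mult bounded_linear_vec_nth)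
  then show ?thesis unfolding par_def[abs_def] .
qed

lemma per_bounded_linear: "bounded_linear (per \<xi>)"
proof -
  have "bounded_linear (\<lambda>g::complex^2. complex_of_real (\<xi> $ 1) * g $ 2 - complex_of_real (\<xi> $ 2) * g $ 1)"
    by (intro bounded_linear_sub bounded_linear_const_mult bounded_linear_vec_nth)
  then show ?thesis unfolding per_def[abs_def] .
qed

text \<open>At positive real \<open>s\<close> the radicand is a positive number, so the complex root
  is the ordinary one and both multipliers are real.\<close>

lemma beta_real:
  assumes "0 < e * m" "0 < s"
  shows "beta e m (complex_of_real s) \<xi> = complex_of_real (sqrt (e * m * s\<^sup>2 + (norm \<xi>)\<^sup>2))"
proof -
  have "complex_of_real (e * m) * (complex_of_real s)\<^sup>2 + complex_of_real ((norm \<xi>)\<^sup>2) = complex_of_real (e * m * s\<^sup>2 + (norm \<xi>)\<^sup>2)"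
    by simp
  then show ?thesis unfolding beta_def using assms by (simp only: csqrt_of_real) (simp add: csqrt_of_real)
qed

text \<open>The second summands of \<open>B_op\<close> form a vector orthogonal to
  \<open>\<xi>\<close>: they cancel in \<open>par\<close>, and in \<open>per\<close> they add
  \<open>(norm \<xi>)\<^sup>2\<close> and complete the radicand \<open>b\<^sup>2\<close>.\<close>

lemma
  fixes e m s :: real and \<xi> :: "real^2"
  assumes e: "0 < e" and m: "0 < m" and s: "0 < s"
  defines "b \<equiv> sqrt (e * m * s\<^sup>2 + (norm \<xi>)\<^sup>2)"
  shows par_B_op: "par \<xi> (complex_of_real s *s B_op e m (complex_of_real s) g \<xi>) = complex_of_real (e * s\<^sup>2 / b) * par \<xi> (g \<xi>)"
    and per_B_op: "per \<xi> (complex_of_real s *s B_op e m (complex_of_real s) g \<xi>) = complex_of_real (b / m) * per \<xi> (g \<xi>)"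
proof -
  have em: "0 < e * m" using e m by simp
  have pos: "0 < e * m * s\<^sup>2 + (norm \<xi>)\<^sup>2" using e m s by (simp add: add_pos_nonneg)
  then have b: "0 < b" "b\<^sup>2 = e * m * s\<^sup>2 + ((\<xi> $ 1)\<^sup>2 + (\<xi> $ 2)\<^sup>2)" by (simp_all add: b_def norm_power2_real2)
  have B: "beta e m (complex_of_real s) \<xi> = complex_of_real b" using beta_real[OF em s] by (simp add: b_def)
  have b2: "complex_of_real b * complex_of_real b = complex_of_real e * complex_of_real m * (complex_of_real s)\<^sup>2 + ((complex_of_real (\<xi> $ 1))\<^sup>2 + (complex_of_real (\<xi> $ 2))\<^sup>2)"
    using arg_cong[OF b(2), of complex_of_real] by (simp add: power2_eq_square)
  have nz: "complex_of_real b \<noteq> 0" "complex_of_real m \<noteq> 0" "complex_of_real s \<noteq> 0" using b m s by auto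
  have "par \<xi> (complex_of_real s *s B_op e m (complex_of_real s) g \<xi>)
      = (1 / (complex_of_real m * complex_of_real b)) * (complex_of_real (e * m) * (complex_of_real s)\<^sup>2 * par \<xi> (g \<xi>))"
    unfolding B_op_def B par_def using nz by (simp add: field_simps)
  also have "\<dots> = complex_of_real (e * s\<^sup>2 / b) * par \<xi> (g \<xi>)" using nz by (simp add: field_simps)
  finally show "par \<xi> (complex_of_real s *s B_op e m (complex_of_real s) g \<xi>) = complex_of_real (e * s\<^sup>2 / b) * par \<xi> (g \<xi>)" .
  have "per \<xi> (complex_of_real s *s B_op e m (complex_of_real s) g \<xi>)
      = (1 / (complex_of_real m * complex_of_real b)) * ((complex_of_real b * complex_of_real b) * per \<xi> (g \<xi>))"
    unfolding B_op_def B per_def b2 using nz by (simp add: field_simps power2_eq_square)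
  also have "\<dots> = complex_of_real (b / m) * per \<xi> (g \<xi>)" using nz by (simp add: field_simps)
  finally show "per \<xi> (complex_of_real s *s B_op e m (complex_of_real s) g \<xi>) = complex_of_real (b / m) * per \<xi> (g \<xi>)" .
qed

section \<open>Positivity of the boundary form at one frequency\<close>

context time_mollifier begin

text \<open>The kernel vanishes beyond \<open>t\<close>, and for \<open>\<tau> \<le> t\<close> the
  weight \<open>exp (\<sigma> * (t - \<tau>))\<close> is at least 1 and may be inserted.\<close>

lemma integrable_causal_kernel:
  fixes v :: "real \<Rightarrow> 'b::euclidean_space"
  assumes v: "integrable lborel (\<lambda>t. exp (- \<sigma> * t) *\<^sub>R v t)" "v \<in> borel_measurable borel" and \<sigma>: "0 \<le> \<sigma>"
    and k [measurable]: "k \<in> borel_measurable borel" and k0: "\<And>t. t < 0 \<Longrightarrow> k t = 0" and kK: "\<And>t. \<bar>k t\<bar> \<le> L"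
  shows "integrable lborel (\<lambda>\<tau>. k (t - \<tau>) *\<^sub>R v \<tau>)"
proof (rule Bochner_Integration.integrable_bound[OF integrable_scaleR_right[OF v(1), of "L * exp (\<sigma> * t)"]])
  have L: "0 \<le> L" using kK[of 0] by linarith
  note [measurable] = v(2)
  show "(\<lambda>\<tau>. k (t - \<tau>) *\<^sub>R v \<tau>) \<in> borel_measurable lborel" by measurable
  show "AE \<tau> in lborel. norm (k (t - \<tau>) *\<^sub>R v \<tau>) \<le> norm ((L * exp (\<sigma> * t)) *\<^sub>R exp (- \<sigma> * \<tau>) *\<^sub>R v \<tau>)"
  proof (rule AE_I2)
    fix \<tau> :: real
    show "norm (k (t - \<tau>) *\<^sub>R v \<tau>) \<le> norm ((L * exp (\<sigma> * t)) *\<^sub>R exp (- \<sigma> * \<tau>) *\<^sub>R v \<tau>)"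
    proof (cases "\<tau> \<le> t")
      case True
      have "1 \<le> exp (\<sigma> * t) * exp (- \<sigma> * \<tau>)" using True \<sigma> by (simp add: exp_add[symmetric] mult_left_mono)
      then have "L * 1 \<le> L * (exp (\<sigma> * t) * exp (- \<sigma> * \<tau>))" by (intro mult_left_mono L)
      then have "\<bar>k (t - \<tau>)\<bar> * norm (v \<tau>) \<le> L * (exp (\<sigma> * t) * exp (- \<sigma> * \<tau>)) * norm (v \<tau>)"
        using kK[of "t - \<tau>"] by (intro mult_right_mono) auto
      then show ?thesis using L by (simp add: mult.assoc abs_mult)
    qed (use k0[of "t - \<tau>"] in simp)
  qed
qed

lemma conv_product_set_integrable:
  assumes f: "integrable lborel (\<lambda>t. exp (- \<sigma> * t) * f t)" "f \<in> borel_measurable borel"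
    and g: "integrable lborel (\<lambda>t. exp (- \<sigma> * t) * g t)" "g \<in> borel_measurable borel" and \<sigma>: "0 \<le> \<sigma>"
  shows "set_integrable lborel {0..T} (\<lambda>t. conv R g t * conv \<rho> f t)"
proof -
  note [measurable] = f(2) g(2)
  define F where "F = (LINT t|lborel. \<bar>exp (- \<sigma> * t) * f t\<bar>)"
  define G where "G = (LINT t|lborel. \<bar>exp (- \<sigma> * t) * g t\<bar>)"
  have FG: "0 \<le> F" "0 \<le> G" by (simp_all add: F_def G_def)
  have e1: "1 \<le> exp (\<sigma> * t)" if "0 \<le> t" for t using that \<sigma> by simp
  have 1: "\<bar>conv \<rho> f t\<bar> \<le> K * exp (\<sigma> * t) * F" for t unfolding F_def
  proof (rule conv_exp_bound[OF f(1)])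
    show "\<bar>\<rho> t\<bar> \<le> K * exp (\<sigma> * t)" if "0 \<le> t" for t
      using bound(1)[of t] mult_left_mono[OF e1[OF that] K_nonneg] by linarith
  qed (simp add: zero)
  have 2: "\<bar>conv R g t\<bar> \<le> 1 * exp (\<sigma> * t) * G" for t unfolding G_def
  proof (rule conv_exp_bound[OF g(1)])
    show "\<bar>R t\<bar> \<le> 1 * exp (\<sigma> * t)" if "0 \<le> t" for t
      using nonneg(2,3)[of t] e1[OF that] by linarith
  qed (simp add: zero)
  show ?thesis unfolding set_integrable_def
  proof (rule Bochner_Integration.integrable_bound[where f = "\<lambda>t. indicator {0..T} t * ((1 * exp (\<sigma> * T) * G) * (K * exp (\<sigma> * T) * F))"])
    show "integrable lborel (\<lambda>t. indicator {0..T} t * ((1 * exp (\<sigma> * T) * G) * (K * exp (\<sigma> * T) * F)))"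
      by (intro integrable_mult_left integrable_real_indicator) (auto simp: emeasure_lborel_Icc_eq)
    show "AE t in lborel. norm (indicator {0..T} t *\<^sub>R (conv R g t * conv \<rho> f t)) \<le> norm (indicator {0..T} t * ((1 * exp (\<sigma> * T) * G) * (K * exp (\<sigma> * T) * F)))"
    proof (rule AE_I2)
      fix t
      show "norm (indicator {0..T} t *\<^sub>R (conv R g t * conv \<rho> f t)) \<le> norm (indicator {0..T} t * ((1 * exp (\<sigma> * T) * G) * (K * exp (\<sigma> * T) * F)))"
      proof (cases "t \<in> {0..T}")
        case True
        then have ee: "exp (\<sigma> * t) \<le> exp (\<sigma> * T)" using \<sigma> by (simp add: mult_left_mono)
        have "\<bar>conv R g t\<bar> \<le> 1 * exp (\<sigma> * T) * G"
          by (rule order_trans[OF 2]) (intro mult_right_mono mult_left_mono ee FG, simp)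
        moreover have "\<bar>conv \<rho> f t\<bar> \<le> K * exp (\<sigma> * T) * F"
          by (rule order_trans[OF 1]) (intro mult_right_mono mult_left_mono ee FG K_nonneg)
        ultimately have "\<bar>conv R g t\<bar> * \<bar>conv \<rho> f t\<bar> \<le> (1 * exp (\<sigma> * T) * G) * (K * exp (\<sigma> * T) * F)"
          using FG by (intro mult_mono) auto
        with True FG K_nonneg show ?thesis by (simp add: abs_mult)
      qed simp
    qed
  qed measurable
qed

text \<open>Real and imaginary parts of \<open>par\<close> and \<open>per\<close> are four real
  signals. At real \<open>s\<close> the multipliers are real, so the four do not mix, and each is
  covered by \<open>positive_symbol\<close>.\<close>

lemma boundary_pointwise_nonneg:
  fixes u v :: "real \<Rightarrow> complex^2" and e m \<sigma> :: real
  assumes e: "0 < e" and m: "0 < m" and \<xi>: "\<xi> \<noteq> 0" and \<sigma>: "1 \<le> \<sigma>"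
    and u: "integrable lborel (\<lambda>t. exp (- \<sigma> * t) *\<^sub>R u t)" "u \<in> borel_measurable borel" "\<And>t. t < 0 \<Longrightarrow> u t = 0"
    and v: "integrable lborel (\<lambda>t. exp (- \<sigma> * t) *\<^sub>R v t)" "v \<in> borel_measurable borel" "\<And>t. t < 0 \<Longrightarrow> v t = 0"
    and lap: "\<And>n::nat. \<sigma> < real n \<Longrightarrow> (LINT t|lborel. exp (- real n * t) *\<^sub>R v t)
        = complex_of_real (real n) *s B_op e m (complex_of_real (real n)) (\<lambda>\<xi>. LINT t|lborel. exp (- real n * t) *\<^sub>R u t) \<xi>"
  shows "0 \<le> (LINT t:{0..T}|lborel. (LINT \<tau>|lborel. R (t - \<tau>) *\<^sub>R v \<tau>) \<bullet> (LINT \<tau>|lborel. \<rho> (t - \<tau>) *\<^sub>R u \<tau>))"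
proof -
  note [measurable] = u(2) v(2)
  define k where "k = norm \<xi>"
  have k: "0 < k" using \<xi> by (simp add: k_def)
  have \<sigma>0: "0 \<le> \<sigma>" using \<sigma> by simp
  have R1: "\<bar>R t\<bar> \<le> 1" for t using nonneg(2,3)[of t] by simp
  have intR: "integrable lborel (\<lambda>\<tau>. R (t - \<tau>) *\<^sub>R v \<tau>)" for t
    by (rule integrable_causal_kernel[OF v(1,2) \<sigma>0 _ _ R1]) (auto simp: zero)
  have int\<rho>: "integrable lborel (\<lambda>\<tau>. \<rho> (t - \<tau>) *\<^sub>R u \<tau>)" for t
    by (rule integrable_causal_kernel[OF u(1,2) \<sigma>0 _ _ bound(1)]) (auto simp: zero)
  have expi: "integrable lborel (\<lambda>t. exp (- s * t) *\<^sub>R w t)"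
    if w: "integrable lborel (\<lambda>t. exp (- \<sigma> * t) *\<^sub>R w t)" "\<And>t. t < 0 \<Longrightarrow> w t = 0" and s: "\<sigma> < s"
      and [measurable]: "w \<in> borel_measurable borel" for w :: "real \<Rightarrow> complex^2" and s
  proof (rule Bochner_Integration.integrable_bound[OF w(1)])
    show "AE t in lborel. norm (exp (- s * t) *\<^sub>R w t) \<le> norm (exp (- \<sigma> * t) *\<^sub>R w t)"
    proof (rule AE_I2)
      fix t show "norm (exp (- s * t) *\<^sub>R w t) \<le> norm (exp (- \<sigma> * t) *\<^sub>R w t)"
        using w(2)[of t] s by (cases "t < 0") (auto intro!: mult_right_mono)
    qed
  qed measurable
  have lf: "lap (\<lambda>t. l (w t)) s = l (LINT t|lborel. exp (- s * t) *\<^sub>R w t)"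
    if l: "bounded_linear l" and w: "integrable lborel (\<lambda>t. exp (- s * t) *\<^sub>R w t)" for l :: "complex^2 \<Rightarrow> real" and w s
    using integral_bounded_linear[OF l w] linear_scale[OF bounded_linear.linear[OF l]] by (simp add: lap_def)
  have conv_l: "conv R (\<lambda>t. l (v t)) t = l (LINT \<tau>|lborel. R (t - \<tau>) *\<^sub>R v \<tau>)"
      "conv \<rho> (\<lambda>t. l (u t)) t = l (LINT \<tau>|lborel. \<rho> (t - \<tau>) *\<^sub>R u \<tau>)" if l: "bounded_linear l" for l :: "complex^2 \<Rightarrow> real" and t
    using integral_bounded_linear[OF l intR] integral_bounded_linear[OF l int\<rho>] linear_scale[OF bounded_linear.linear[OF l]]
    by (simp_all add: conv_def)
  have main: "0 \<le> (LINT t:{0..T}|lborel. l (LINT \<tau>|lborel. R (t - \<tau>) *\<^sub>R v \<tau>) * l (LINT \<tau>|lborel. \<rho> (t - \<tau>) *\<^sub>R u \<tau>))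
     \<and> set_integrable lborel {0..T} (\<lambda>t. l (LINT \<tau>|lborel. R (t - \<tau>) *\<^sub>R v \<tau>) * l (LINT \<tau>|lborel. \<rho> (t - \<tau>) *\<^sub>R u \<tau>))"
    if l: "bounded_linear l" and c: "0 \<le> c0" "0 \<le> c1" and w: "w \<in> borel_measurable borel" "\<And>z. 0 \<le> w z" "\<And>z. w z \<le> 1"
      and sym: "\<And>n::nat. \<sigma> < real n \<Longrightarrow> l (LINT t|lborel. exp (- real n * t) *\<^sub>R v t) =
        (c0 + c1 * real n * (LINT z|lborel. indicator {0<..} z * (w z * (real n / ((real n)\<^sup>2 + (\<kappa>\<^sup>2 + z\<^sup>2)))))) * l (LINT t|lborel. exp (- real n * t) *\<^sub>R u t)"
    for l :: "complex^2 \<Rightarrow> real" and c0 c1 w \<kappa>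
  proof -
    have lm [measurable]: "l \<in> borel_measurable borel" using l by (intro borel_measurable_continuous_onI linear_continuous_on)
    have l0: "l 0 = 0" using linear_0[OF bounded_linear.linear[OF l]] .
    have li: "integrable lborel (\<lambda>t. exp (- \<sigma> * t) * l (w t))" if "integrable lborel (\<lambda>t. exp (- \<sigma> * t) *\<^sub>R w t)" for w
      using integrable_bounded_linear[OF l that] linear_scale[OF bounded_linear.linear[OF l]] by simp
    have lmeas: "(\<lambda>t. l (u t)) \<in> borel_measurable borel" "(\<lambda>t. l (v t)) \<in> borel_measurable borel" by measurable
    have "0 \<le> (LINT t:{0..T}|lborel. conv R (\<lambda>t. l (v t)) t * conv \<rho> (\<lambda>t. l (u t)) t)"
    proof (rule positive_symbol[OF \<sigma> li[OF u(1)] _ lmeas(1) li[OF v(1)] _ lmeas(2) w c])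
      fix n :: nat assume n: "\<sigma> < real n"
      show "lap (\<lambda>t. l (v t)) (real n) = (c0 + c1 * real n * (LINT z|lborel. indicator {0<..} z * (w z * (real n / ((real n)\<^sup>2 + (\<kappa>\<^sup>2 + z\<^sup>2)))))) * lap (\<lambda>t. l (u t)) (real n)"
      proof -
        have "lap (\<lambda>t. l (v t)) (real n) = l (LINT t|lborel. exp (- real n * t) *\<^sub>R v t)"
          by (rule lf[OF l]) (rule expi[OF v(1,3) n v(2)])
        moreover have "lap (\<lambda>t. l (u t)) (real n) = l (LINT t|lborel. exp (- real n * t) *\<^sub>R u t)"
          by (rule lf[OF l]) (rule expi[OF u(1,3) n u(2)])
        ultimately show ?thesis using sym[OF n] by presburger
      qed
    qed (use l0 u(3) v(3) in auto)
    then show ?thesis using conv_product_set_integrable[OF li[OF u(1)] lmeas(1) li[OF v(1)] lmeas(2) \<sigma>0, of T]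
      unfolding conv_l[OF l] by blast
  qed
  \<comment> \<open>Factoring \<open>e * m\<close> out of the root brings both multipliers to the
    normalised form of the symbol integrals.\<close>
  define \<kappa> where "\<kappa> = k / sqrt (e * m)"
  have em: "0 < e * m" using e m by simp
  have sq: "sqrt (e * m * s\<^sup>2 + k\<^sup>2) = sqrt (e * m) * sqrt (s\<^sup>2 + \<kappa>\<^sup>2)" for s
  proof -
    have "e * m * s\<^sup>2 + k\<^sup>2 = (e * m) * (s\<^sup>2 + \<kappa>\<^sup>2)" using em e m by (simp add: \<kappa>_def power_divide distrib_left less_imp_le)
    then show ?thesis by (simp add: real_sqrt_mult)
  qed
  \<comment> \<open>The factors \<open>2 / pi\<close> here and in \<open>per_sym\<close> undo the
    \<open>pi / 2\<close> of the Cauchy integral. \<open>par\<close> has no atom at frequency 0;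
    that of \<open>per\<close> is proportional to \<open>\<kappa>\<close>.\<close>
  have par_sym: "e * s\<^sup>2 / sqrt (e * m * s\<^sup>2 + k\<^sup>2) = 0 + 2 / pi * (e / sqrt (e * m)) * s * (LINT z|lborel. indicator {0<..} z * (1 * (s / (s\<^sup>2 + (\<kappa>\<^sup>2 + z\<^sup>2)))))"
    if "0 < s" for s
    unfolding symbol_integral_parallel[OF that] sq by (simp add: power2_eq_square)
  have kap: "0 \<le> \<kappa>" using k em by (simp add: \<kappa>_def)
  have per_sym: "sqrt (e * m * s\<^sup>2 + k\<^sup>2) / m = \<kappa> * sqrt (e * m) / m + 2 / pi * (sqrt (e * m) / m) * s * (LINT z|lborel. indicator {0<..} z * (z\<^sup>2 / (\<kappa>\<^sup>2 + z\<^sup>2) * (s / (s\<^sup>2 + (\<kappa>\<^sup>2 + z\<^sup>2)))))"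
    if "0 < s" for s
    unfolding symbol_integral_perp[OF that kap] sq using that m by (simp add: field_simps)
  have w2: "(\<lambda>z. z\<^sup>2 / (\<kappa>\<^sup>2 + z\<^sup>2)) \<in> borel_measurable borel" "0 \<le> z\<^sup>2 / (\<kappa>\<^sup>2 + z\<^sup>2)" "z\<^sup>2 / (\<kappa>\<^sup>2 + z\<^sup>2) \<le> 1" for z :: real
  proof -
    show "(\<lambda>z. z\<^sup>2 / (\<kappa>\<^sup>2 + z\<^sup>2)) \<in> borel_measurable borel" by measurable
    show "0 \<le> z\<^sup>2 / (\<kappa>\<^sup>2 + z\<^sup>2)" by simp
    have a: "z\<^sup>2 \<le> \<kappa>\<^sup>2 + z\<^sup>2" "0 \<le> \<kappa>\<^sup>2 + z\<^sup>2" by simp_all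
    show "z\<^sup>2 / (\<kappa>\<^sup>2 + z\<^sup>2) \<le> 1"
      using divide_right_mono[OF a] by (cases "\<kappa>\<^sup>2 + z\<^sup>2 = 0") auto
  qed
  have npos: "0 < real n" if "\<sigma> < real n" for n :: nat using that \<sigma> by linarith
  note P = par_B_op[OF e m npos, folded k_def] per_B_op[OF e m npos, folded k_def]
  have Pre: "Re (complex_of_real r * z) = r * Re z" "Im (complex_of_real r * z) = r * Im z" for r z by simp_all
  have par: "bounded_linear (\<lambda>x. Re (par \<xi> x))" "bounded_linear (\<lambda>x. Im (par \<xi> x))"
    and per: "bounded_linear (\<lambda>x. Re (per \<xi> x))" "bounded_linear (\<lambda>x. Im (per \<xi> x))"
    by (auto intro: bounded_linear_compose[OF bounded_linear_Re par_bounded_linear] bounded_linear_compose[OF bounded_linear_Im par_bounded_linear]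
        bounded_linear_compose[OF bounded_linear_Re per_bounded_linear] bounded_linear_compose[OF bounded_linear_Im per_bounded_linear])
  have c1: "0 \<le> 2 / pi * (e / sqrt (e * m))" "0 \<le> \<kappa> * sqrt (e * m) / m" "0 \<le> 2 / pi * (sqrt (e * m) / m)"
    using e m kap by auto
  have w1: "(\<lambda>z::real. 1::real) \<in> borel_measurable borel" "\<And>z::real. 0 \<le> (1::real)" "\<And>z::real. (1::real) \<le> 1" by auto
  have m1: "0 \<le> (LINT t:{0..T}|lborel. l (LINT \<tau>|lborel. R (t - \<tau>) *\<^sub>R v \<tau>) * l (LINT \<tau>|lborel. \<rho> (t - \<tau>) *\<^sub>R u \<tau>))
     \<and> set_integrable lborel {0..T} (\<lambda>t. l (LINT \<tau>|lborel. R (t - \<tau>) *\<^sub>R v \<tau>) * l (LINT \<tau>|lborel. \<rho> (t - \<tau>) *\<^sub>R u \<tau>))"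
    if "l = (\<lambda>x. Re (par \<xi> x)) \<or> l = (\<lambda>x. Im (par \<xi> x))" for l
    using that
    by (elim disjE; hypsubst; intro main[OF _ order_refl c1(1) w1, where \<kappa> = \<kappa>] par; subst lap; simp only: P k_def[symmetric] Pre par_sym[OF npos, symmetric])
  have m2: "0 \<le> (LINT t:{0..T}|lborel. l (LINT \<tau>|lborel. R (t - \<tau>) *\<^sub>R v \<tau>) * l (LINT \<tau>|lborel. \<rho> (t - \<tau>) *\<^sub>R u \<tau>))
     \<and> set_integrable lborel {0..T} (\<lambda>t. l (LINT \<tau>|lborel. R (t - \<tau>) *\<^sub>R v \<tau>) * l (LINT \<tau>|lborel. \<rho> (t - \<tau>) *\<^sub>R u \<tau>))"
    if "l = (\<lambda>x. Re (per \<xi> x)) \<or> l = (\<lambda>x. Im (per \<xi> x))" for l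
    using that
    by (elim disjE; hypsubst; intro main[OF _ c1(2,3) w2, where \<kappa> = \<kappa>] per; subst lap; simp only: P k_def[symmetric] Pre per_sym[OF npos, symmetric])
  define S where "S l t = l (LINT \<tau>|lborel. R (t - \<tau>) *\<^sub>R v \<tau>) * l (LINT \<tau>|lborel. \<rho> (t - \<tau>) *\<^sub>R u \<tau>)" for l :: "complex^2 \<Rightarrow> real" and t
  note m1 = m1[folded S_def] and m2 = m2[folded S_def]
  have "(LINT \<tau>|lborel. R (t - \<tau>) *\<^sub>R v \<tau>) \<bullet> (LINT \<tau>|lborel. \<rho> (t - \<tau>) *\<^sub>R u \<tau>)
      = inverse (k\<^sup>2) * ((S (\<lambda>x. Re (par \<xi> x)) t + S (\<lambda>x. Im (par \<xi> x)) t) + (S (\<lambda>x. Re (per \<xi> x)) t + S (\<lambda>x. Im (per \<xi> x)) t))" for t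
    using inner_par_per[of \<xi> "LINT \<tau>|lborel. R (t - \<tau>) *\<^sub>R v \<tau>" "LINT \<tau>|lborel. \<rho> (t - \<tau>) *\<^sub>R u \<tau>"] k
    unfolding k_def[symmetric] S_def by (simp add: inner_complex_def field_simps)
  then show ?thesis
    using m1[of "\<lambda>x. Re (par \<xi> x)"] m1[of "\<lambda>x. Im (par \<xi> x)"] m2[of "\<lambda>x. Re (per \<xi> x)"] m2[of "\<lambda>x. Im (per \<xi> x)"]
    by (simp add: set_integral_add)
qed

end

subsection \<open>Positivity of the boundary terms\<close>

text \<open>
  These weights turn the $H^{-1/2}(\mathrm{curl})$ and $H^{-1/2}(\mathrm{div})$ norms into $L^2$ norms and their
  duality into the $L^2$ inner product.  At \<open>\<xi> = 0\<close> they degenerate (division by zero).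
\<close>
definition curl_weight :: "real^2 \<Rightarrow> complex^2 \<Rightarrow> complex \<times> complex" where
  "curl_weight \<xi> g = (par \<xi> g /\<^sub>R (sqrt (sqrt (1 + (norm \<xi>)\<^sup>2)) * norm \<xi>), (sqrt (sqrt (1 + (norm \<xi>)\<^sup>2)) / norm \<xi>) *\<^sub>R per \<xi> g)"

definition div_weight :: "real^2 \<Rightarrow> complex^2 \<Rightarrow> complex \<times> complex" where
  "div_weight \<xi> g = ((sqrt (sqrt (1 + (norm \<xi>)\<^sup>2)) / norm \<xi>) *\<^sub>R par \<xi> g, per \<xi> g /\<^sub>R (sqrt (sqrt (1 + (norm \<xi>)\<^sup>2)) * norm \<xi>))"

lemma weight_bounded_linear: "bounded_linear (curl_weight \<xi>)" "bounded_linear (div_weight \<xi>)"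
  unfolding curl_weight_def[abs_def] div_weight_def[abs_def]
  by (intro bounded_linear_Pair bounded_linear_const_scaleR par_bounded_linear per_bounded_linear)+

lemma one_plus_norm_powr: "(1 + (norm \<xi>)\<^sup>2) powr (- 1 / 2) = 1 / sqrt (1 + (norm (\<xi>::real^2))\<^sup>2)"
  by (simp add: powr_minus_divide powr_half_sqrt)

text \<open>Expressing \<open>norm (g \<xi>)\<close> through \<open>par\<close> and
  \<open>per\<close> turns the density into a weighted sum of their squares: \<open>par\<close> gets
  the factor \<open>1 / c\<close> and \<open>per\<close> the factor
  \<open>(1 + (norm \<xi>)\<^sup>2) / c = c\<close>, both over
  \<open>(norm \<xi>)\<^sup>2\<close>.\<close>

lemma norm_curl_weight:
  assumes "\<xi> \<noteq> 0"
  shows "(norm (curl_weight \<xi> (g \<xi>)))\<^sup>2 = Hcurl_trace_density g \<xi>"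
proof -
  define c where "c = sqrt (1 + (norm \<xi>)\<^sup>2)"
  have c: "0 < c" "c\<^sup>2 = 1 + (norm \<xi>)\<^sup>2" by (simp_all add: c_def add_pos_nonneg)
  have k: "0 < norm \<xi>" using assms by simp
  have p: "(norm \<xi>)\<^sup>2 * (norm (g \<xi>))\<^sup>2 = (cmod (par \<xi> (g \<xi>)))\<^sup>2 + (cmod (per \<xi> (g \<xi>)))\<^sup>2"
    using inner_par_per[of \<xi> "g \<xi>" "g \<xi>"] by (simp add: power2_norm_eq_inner)
  have "(norm (curl_weight \<xi> (g \<xi>)))\<^sup>2 = (cmod (par \<xi> (g \<xi>)))\<^sup>2 / (c * (norm \<xi>)\<^sup>2) + c / (norm \<xi>)\<^sup>2 * (cmod (per \<xi> (g \<xi>)))\<^sup>2"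
    unfolding curl_weight_def c_def[symmetric] norm_Pair using c(1)
    by (simp add: power_mult_distrib power_divide power_inverse divide_inverse mult_ac)
  also have "\<dots> = 1 / c * (((cmod (par \<xi> (g \<xi>)))\<^sup>2 + (c\<^sup>2 * (cmod (per \<xi> (g \<xi>)))\<^sup>2)) / (norm \<xi>)\<^sup>2)"
    using c(1) k by (simp add: field_simps power2_eq_square)
  also have "(cmod (par \<xi> (g \<xi>)))\<^sup>2 + (c\<^sup>2 * (cmod (per \<xi> (g \<xi>)))\<^sup>2) = (norm \<xi>)\<^sup>2 * ((norm (g \<xi>))\<^sup>2 + (cmod (per \<xi> (g \<xi>)))\<^sup>2)"
    unfolding c(2) distrib_left p by (simp add: algebra_simps)
  also have "1 / c * ((norm \<xi>)\<^sup>2 * ((norm (g \<xi>))\<^sup>2 + (cmod (per \<xi> (g \<xi>)))\<^sup>2) / (norm \<xi>)\<^sup>2) = Hcurl_trace_density g \<xi>"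
    using k unfolding Hcurl_trace_density_def one_plus_norm_powr c_def[symmetric] per_def by simp
  finally show ?thesis .
qed

lemma norm_div_weight:
  assumes "\<xi> \<noteq> 0"
  shows "(norm (div_weight \<xi> (g \<xi>)))\<^sup>2 = Hdiv_trace_density g \<xi>"
proof -
  define c where "c = sqrt (1 + (norm \<xi>)\<^sup>2)"
  have c: "0 < c" "c\<^sup>2 = 1 + (norm \<xi>)\<^sup>2" by (simp_all add: c_def add_pos_nonneg)
  have k: "0 < norm \<xi>" using assms by simp
  have p: "(norm \<xi>)\<^sup>2 * (norm (g \<xi>))\<^sup>2 = (cmod (par \<xi> (g \<xi>)))\<^sup>2 + (cmod (per \<xi> (g \<xi>)))\<^sup>2"
    using inner_par_per[of \<xi> "g \<xi>" "g \<xi>"] by (simp add: power2_norm_eq_inner)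
  have "(norm (div_weight \<xi> (g \<xi>)))\<^sup>2 = c / (norm \<xi>)\<^sup>2 * (cmod (par \<xi> (g \<xi>)))\<^sup>2 + (cmod (per \<xi> (g \<xi>)))\<^sup>2 / (c * (norm \<xi>)\<^sup>2)"
    unfolding div_weight_def c_def[symmetric] norm_Pair using c(1)
    by (simp add: power_mult_distrib power_divide power_inverse divide_inverse mult_ac)
  also have "\<dots> = 1 / c * ((c\<^sup>2 * (cmod (par \<xi> (g \<xi>)))\<^sup>2 + (cmod (per \<xi> (g \<xi>)))\<^sup>2) / (norm \<xi>)\<^sup>2)"
    using c(1) k by (simp add: field_simps power2_eq_square)
  also have "c\<^sup>2 * (cmod (par \<xi> (g \<xi>)))\<^sup>2 + (cmod (per \<xi> (g \<xi>)))\<^sup>2 = (norm \<xi>)\<^sup>2 * ((norm (g \<xi>))\<^sup>2 + (cmod (par \<xi> (g \<xi>)))\<^sup>2)"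
    unfolding c(2) distrib_left p by (simp add: algebra_simps)
  also have "1 / c * ((norm \<xi>)\<^sup>2 * ((norm (g \<xi>))\<^sup>2 + (cmod (par \<xi> (g \<xi>)))\<^sup>2) / (norm \<xi>)\<^sup>2) = Hdiv_trace_density g \<xi>"
    using k unfolding Hdiv_trace_density_def one_plus_norm_powr c_def[symmetric] par_def by simp
  finally show ?thesis .
qed

text \<open>Both densities contain the square of \<open>norm g\<close> itself. The constant depends
  on \<open>\<xi>\<close>, which is enough to return from weighted to raw traces at a fixed
  frequency.\<close>

lemma norm_le_weight:
  assumes "\<xi> \<noteq> 0"
  shows "norm g \<le> sqrt (sqrt (1 + (norm \<xi>)\<^sup>2)) * norm (curl_weight \<xi> g)"
    and "norm g \<le> sqrt (sqrt (1 + (norm \<xi>)\<^sup>2)) * norm (div_weight \<xi> g)"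
proof -
  define c where "c = sqrt (1 + (norm \<xi>)\<^sup>2)"
  have c: "0 < c" by (simp add: c_def add_pos_nonneg)
  have "(norm g)\<^sup>2 \<le> c * (norm (curl_weight \<xi> g))\<^sup>2" "(norm g)\<^sup>2 \<le> c * (norm (div_weight \<xi> g))\<^sup>2"
    using norm_curl_weight[OF assms, of "\<lambda>_. g"] norm_div_weight[OF assms, of "\<lambda>_. g"] c
    unfolding Hcurl_trace_density_def Hdiv_trace_density_def one_plus_norm_powr c_def[symmetric] by simp_all
  then have "(norm g)\<^sup>2 \<le> (sqrt c * norm (curl_weight \<xi> g))\<^sup>2" "(norm g)\<^sup>2 \<le> (sqrt c * norm (div_weight \<xi> g))\<^sup>2"
    using c by (simp_all add: power_mult_distrib)
  then show "norm g \<le> sqrt (sqrt (1 + (norm \<xi>)\<^sup>2)) * norm (curl_weight \<xi> g)"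
    "norm g \<le> sqrt (sqrt (1 + (norm \<xi>)\<^sup>2)) * norm (div_weight \<xi> g)"
    unfolding c_def[symmetric] using c by (auto intro: power2_le_imp_le)
qed

text \<open>The two weights are reciprocal in each component, apart from the normalisation
  \<open>1 / (norm \<xi>)\<^sup>2\<close> that \<open>par\<close> and \<open>per\<close>
  lack.\<close>

lemma inner_weights:
  assumes "\<xi> \<noteq> 0"
  shows "div_weight \<xi> x \<bullet> curl_weight \<xi> y = x \<bullet> y"
proof -
  have k: "norm \<xi> \<noteq> 0" using assms by simp
  have c: "sqrt (sqrt (1 + (norm \<xi>)\<^sup>2)) \<noteq> 0" by (simp add: add_nonneg_eq_0_iff)
  have "div_weight \<xi> x \<bullet> curl_weight \<xi> y = (par \<xi> x \<bullet> par \<xi> y + per \<xi> x \<bullet> per \<xi> y) / (norm \<xi>)\<^sup>2"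
    unfolding div_weight_def curl_weight_def inner_Pair inner_scaleR_left inner_scaleR_right
    using k c by (simp add: field_simps power2_eq_square)
  then show ?thesis unfolding inner_par_per[symmetric] using k by simp
qed

lemma measurable_nth: "f \<in> borel_measurable M \<Longrightarrow> (\<lambda>x. (f x :: 'a::euclidean_space^'n::finite) $ i) \<in> borel_measurable M"
  by (rule measurable_compose[OF _ borel_measurable_continuous_onI]) (auto intro: continuous_intros)

lemma measurable_weights [measurable]:
  assumes [measurable]: "f \<in> borel_measurable M" "g \<in> borel_measurable M"
  shows "(\<lambda>x. curl_weight (f x) (g x)) \<in> borel_measurable M" "(\<lambda>x. div_weight (f x) (g x)) \<in> borel_measurable M"
proof -
  have [measurable]: "(\<lambda>x. f x $ i) \<in> borel_measurable M" "(\<lambda>x. g x $ i) \<in> borel_measurable M" for i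
    using assms by (auto intro: measurable_nth)
  show "(\<lambda>x. curl_weight (f x) (g x)) \<in> borel_measurable M" "(\<lambda>x. div_weight (f x) (g x)) \<in> borel_measurable M"
    unfolding curl_weight_def div_weight_def par_def per_def borel_prod[symmetric] by measurable
qed

lemma AE_nonzero: "AE \<xi> in lborel. (\<xi>::real^2) \<noteq> 0"
  by (rule AE_lborel_singleton)

section \<open>Traces as weighted square integrable fields depending on time\<close>

lemma time_L2_scale:
  fixes a :: "real \<Rightarrow> 'x \<Rightarrow> 'b::euclidean_space"
  assumes a: "time_L2 M a" and [measurable]: "k \<in> borel_measurable borel" and K: "\<And>t. \<bar>k t\<bar> \<le> K"
  shows "time_L2 M (\<lambda>t x. k t *\<^sub>R a t x)"
  unfolding time_L2_def
proof (intro conjI)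
  note [measurable] = time_L2_measurable[OF a]
  show "(\<lambda>p. k (fst p) *\<^sub>R a (fst p) (snd p)) \<in> borel_measurable (lborel \<Otimes>\<^sub>M M)" by measurable
  have l: "l2n M (\<lambda>x. k t *\<^sub>R a t x) = \<bar>k t\<bar> * l2n M (a t)" for t
    by (simp add: l2n_def power_mult_distrib real_sqrt_mult)
  have ae: "AE t in lborel. sq_integrable M (a t)" and i: "integrable lborel (\<lambda>t. l2n M (a t))"
    using a by (auto simp: time_L2_def)
  show "AE t in lborel. sq_integrable M (\<lambda>x. k t *\<^sub>R a t x)"
    using ae by eventually_elim (auto simp: sq_integrable_def power_mult_distrib)
  show "integrable lborel (\<lambda>t. l2n M (\<lambda>x. k t *\<^sub>R a t x))"
    unfolding l using integrable_bounded_scale[OF i, of "\<lambda>t. \<bar>k t\<bar>" K] K by simp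
qed

text \<open>Common to both trace spaces: off the null set \<open>\<xi> = 0\<close> the weight
  \<open>w\<close> turns the density \<open>d\<close> into a squared norm, so the trace norm
  \<open>N\<close> becomes \<open>l2n\<close>.\<close>

lemma time_L2_weighted:
  fixes W :: "real \<Rightarrow> real^2 \<Rightarrow> complex^2" and w :: "real^2 \<Rightarrow> complex^2 \<Rightarrow> complex \<times> complex"
  assumes W: "W \<in> bochner_L1 {0<..} UNIV X N"
    and X: "\<And>g. g \<in> X \<Longrightarrow> g \<in> borel_measurable lborel \<and> integrable lborel (d g)"
    and N: "\<And>g. N g = sqrt (LINT \<xi>|lborel. d g \<xi>)"
    and w: "\<And>\<xi> g. \<xi> \<noteq> 0 \<Longrightarrow> (norm (w \<xi> (g \<xi>)))\<^sup>2 = d g \<xi>" "\<And>\<xi>. bounded_linear (w \<xi>)"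
    and wm: "\<And>f g (M :: (real \<times> (real^2)) measure). f \<in> borel_measurable M \<Longrightarrow> g \<in> borel_measurable M \<Longrightarrow> (\<lambda>x. w (f x) (g x)) \<in> borel_measurable M"
      "\<And>f g (M :: (real^2) measure). f \<in> borel_measurable M \<Longrightarrow> g \<in> borel_measurable M \<Longrightarrow> (\<lambda>x. w (f x) (g x)) \<in> borel_measurable M"
  shows "time_L2 lborel (\<lambda>t \<xi>. w \<xi> (indicator {0<..} t *\<^sub>R W t \<xi>))"
  unfolding time_L2_def
proof (intro conjI)
  have meas: "(\<lambda>p. indicator ({0<..} \<times> UNIV) p *\<^sub>R W (fst p) (snd p)) \<in> borel_measurable lborel"
    and ae: "AE t\<in>{0<..} in lborel. W t \<in> X" and int: "set_integrable lborel {0<..} (\<lambda>t. N (W t))"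
    using W unfolding bochner_L1_def bochner_measurable_def set_borel_measurable_def by auto
  have ind: "indicator ({0<..} \<times> UNIV) p = (indicator {0<..} (fst p) :: real)" for p :: "real \<times> (real^2)"
    by (auto simp: indicator_def mem_Times_iff)
  have meas': "(\<lambda>p. indicator {0<..} (fst p) *\<^sub>R W (fst p) (snd p)) \<in> borel_measurable lborel2"
    using meas unfolding ind lborel_prod .
  show "(\<lambda>p. w (snd p) (indicator {0<..} (fst p) *\<^sub>R W (fst p) (snd p))) \<in> borel_measurable lborel2"
    by (rule wm(1)[OF _ meas']) measurable
  have sc: "w \<xi> (c *\<^sub>R x) = c *\<^sub>R w \<xi> x" for \<xi> c x
    by (rule linear_scale[OF bounded_linear.linear[OF w(2)]])
  have wX: "sq_integrable lborel (\<lambda>\<xi>. w \<xi> (g \<xi>))" and wN: "l2n lborel (\<lambda>\<xi>. w \<xi> (g \<xi>)) = N g" if g: "g \<in> X" for g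
  proof -
    have gm: "g \<in> borel_measurable lborel" and gi: "integrable lborel (d g)" using X[OF g] by auto
    have m: "(\<lambda>\<xi>. w \<xi> (g \<xi>)) \<in> borel_measurable lborel" by (rule wm(2)[OF _ gm]) measurable
    have eq: "AE \<xi> in lborel. d g \<xi> = (norm (w \<xi> (g \<xi>)))\<^sup>2"
      using AE_nonzero by eventually_elim (simp add: w(1))
    show "sq_integrable lborel (\<lambda>\<xi>. w \<xi> (g \<xi>))" unfolding sq_integrable_def
      using m integrable_cong_AE_imp[OF gi _ eq] by auto
    show "l2n lborel (\<lambda>\<xi>. w \<xi> (g \<xi>)) = N g" unfolding l2n_def N
      using integral_cong_AE[OF borel_measurable_integrable[OF gi] _ eq] m by auto
  qed
  show "AE t in lborel. sq_integrable lborel (\<lambda>\<xi>. w \<xi> (indicator {0<..} t *\<^sub>R W t \<xi>))"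
    using ae
  proof eventually_elim
    case (elim t)
    show ?case
    proof (cases "0 < t")
      case True then show ?thesis using wX elim by simp
    next
      case False then show ?thesis unfolding sc by (simp add: sq_integrable_def)
    qed
  qed
  have l: "l2n lborel (\<lambda>\<xi>. w \<xi> (indicator {0<..} t *\<^sub>R W t \<xi>)) = indicator {0<..} t * l2n lborel (\<lambda>\<xi>. w \<xi> (W t \<xi>))" for t
    unfolding sc by (cases "0 < t") (auto simp: l2n_def)
  have "AE t in lborel. indicator {0<..} t *\<^sub>R N (W t) = l2n lborel (\<lambda>\<xi>. w \<xi> (indicator {0<..} t *\<^sub>R W t \<xi>))"
    using ae unfolding l by eventually_elim (auto simp: wN indicator_def)
  moreover have "(\<lambda>t. l2n lborel (\<lambda>\<xi>. w \<xi> (indicator {0<..} t *\<^sub>R W t \<xi>))) \<in> borel_measurable lborel"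
  proof -
    have "(\<lambda>p. w (snd p) (indicator {0<..} (fst p) *\<^sub>R W (fst p) (snd p))) \<in> borel_measurable lborel2"
      by (rule wm(1)[OF _ meas']) measurable
    then have "(\<lambda>(t, \<xi>). (norm (w \<xi> (indicator {0<..} t *\<^sub>R W t \<xi>)))\<^sup>2) \<in> borel_measurable lborel2"
      by (simp add: split_beta')
    from lborel.borel_measurable_lebesgue_integral[OF this] show ?thesis unfolding l2n_def by measurable
  qed
  ultimately show "integrable lborel (\<lambda>t. l2n lborel (\<lambda>\<xi>. w \<xi> (indicator {0<..} t *\<^sub>R W t \<xi>)))"
    using int integrable_cong_AE_imp unfolding set_integrable_def by blast
qed

lemma time_L2_curl_weight:
  assumes "W \<in> bochner_L1 {0<..} UNIV Hcurl_trace Hcurl_trace_norm"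
  shows "time_L2 lborel (\<lambda>t \<xi>. curl_weight \<xi> (indicator {0<..} t *\<^sub>R W t \<xi>))"
  by (rule time_L2_weighted[OF assms, where d = Hcurl_trace_density])
    (auto simp: Hcurl_trace_def Hcurl_trace_norm_def norm_curl_weight weight_bounded_linear intro: measurable_weights)

lemma time_L2_div_weight:
  assumes "W \<in> bochner_L1 {0<..} UNIV Hdiv_trace Hdiv_trace_norm"
  shows "time_L2 lborel (\<lambda>t \<xi>. div_weight \<xi> (indicator {0<..} t *\<^sub>R W t \<xi>))"
  by (rule time_L2_weighted[OF assms, where d = Hdiv_trace_density])
    (auto simp: Hdiv_trace_def Hdiv_trace_norm_def norm_div_weight weight_bounded_linear intro: measurable_weights)

lemma AE_integrable_of_weight:
  fixes W :: "real \<Rightarrow> real^2 \<Rightarrow> complex^2" and w :: "real^2 \<Rightarrow> complex^2 \<Rightarrow> complex \<times> complex"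
  assumes W: "W \<in> bochner_L1 {0<..} UNIV X N"
    and L: "time_L2 lborel (\<lambda>t \<xi>. w \<xi> (indicator {0<..} t *\<^sub>R W t \<xi>))"
    and w: "\<And>\<xi> g. \<xi> \<noteq> 0 \<Longrightarrow> norm g \<le> C \<xi> * norm (w \<xi> g)"
  shows "AE \<xi> in lborel. integrable lborel (\<lambda>t. indicator {0<..} t *\<^sub>R W t \<xi>)"
  using AE_integrable_time[OF lborel.sigma_finite_measure_axioms L] AE_nonzero
proof eventually_elim
  case (elim \<xi>)
  have meas: "(\<lambda>p. indicator ({0<..} \<times> UNIV) p *\<^sub>R W (fst p) (snd p)) \<in> borel_measurable lborel2"
    using W unfolding bochner_L1_def bochner_measurable_def set_borel_measurable_def lborel_prod by auto
  have "(\<lambda>t. indicator ({0<..} \<times> UNIV) (t, \<xi>) *\<^sub>R W (fst (t, \<xi>)) (snd (t, \<xi>))) \<in> borel_measurable lborel"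
    by (rule measurable_compose[OF _ meas]) measurable
  then have m: "(\<lambda>t. indicator {0<..} t *\<^sub>R W t \<xi>) \<in> borel_measurable lborel"
    by (simp add: indicator_times)
  show ?case
  proof (rule Bochner_Integration.integrable_bound[OF integrable_scaleR_right[OF elim(1), of "C \<xi>"] m])
    show "AE t in lborel. norm (indicator {0<..} t *\<^sub>R W t \<xi>) \<le> norm (C \<xi> *\<^sub>R w \<xi> (indicator {0<..} t *\<^sub>R W t \<xi>))"
    proof (rule AE_I2)
      fix t
      define g where "g = indicator {0<..} t *\<^sub>R W t \<xi>"
      have "C \<xi> * norm (w \<xi> g) \<le> \<bar>C \<xi>\<bar> * norm (w \<xi> g)" by (intro mult_right_mono) auto
      with w[OF elim(2), of g] have "norm g \<le> norm (C \<xi> *\<^sub>R w \<xi> g)" by simp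
      then show "norm (indicator {0<..} t *\<^sub>R W t \<xi>) \<le> norm (C \<xi> *\<^sub>R w \<xi> (indicator {0<..} t *\<^sub>R W t \<xi>))"
        by (simp only: g_def)
    qed
  qed
qed

lemma laplace_of_real:
  "laplace u (complex_of_real s) \<xi> = (LINT t|lborel. exp (- s * t) *\<^sub>R (indicator {0<..} t *\<^sub>R u t \<xi>))"
proof -
  have "exp (- complex_of_real s * complex_of_real t) = complex_of_real (exp (- s * t))" for t
    by (simp add: exp_of_real[symmetric])
  then have "exp (- complex_of_real s * complex_of_real t) *s x = exp (- s * t) *\<^sub>R x" for t and x :: "complex^2"
    by (simp add: vec_eq_iff) (simp add: scaleR_conv_of_real)
  then show ?thesis unfolding laplace_def set_lebesgue_integral_def
    by (intro Bochner_Integration.integral_cong refl) (simp add: mult.commute)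
qed

definition time_restrict :: "real \<Rightarrow> (real \<Rightarrow> 'x \<Rightarrow> 'b::real_vector) \<Rightarrow> real \<Rightarrow> 'x \<Rightarrow> 'b" where
  "time_restrict T u t x = indicator {0<..<T} t *\<^sub>R u t x"

text \<open>On a bounded time interval the exponential that makes the trace Laplace transformable is
  bounded from below, so it can be undone.\<close>

lemma time_L2_time_restrict:
  fixes w :: "real^2 \<Rightarrow> complex^2 \<Rightarrow> complex \<times> complex"
  assumes L: "time_L2 lborel (\<lambda>t \<xi>. w \<xi> (indicator {0<..} t *\<^sub>R (exp (- \<sigma> * t) *\<^sub>R u t \<xi>)))"
    and w: "\<And>\<xi>. bounded_linear (w \<xi>)" and \<sigma>: "0 \<le> \<sigma>"
  shows "time_L2 lborel (\<lambda>t \<xi>. w \<xi> (time_restrict T u t \<xi>))"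
proof -
  have sc: "w \<xi> (c *\<^sub>R x) = c *\<^sub>R w \<xi> x" for \<xi> c x
    by (rule linear_scale[OF bounded_linear.linear[OF w]])
  define k where "k t = indicator {0<..<T} t * exp (\<sigma> * t)" for t
  have e: "w \<xi> (time_restrict T u t \<xi>) = k t *\<^sub>R w \<xi> (indicator {0<..} t *\<^sub>R (exp (- \<sigma> * t) *\<^sub>R u t \<xi>))" for t \<xi>
    unfolding time_restrict_def sc by (auto simp: k_def indicator_def exp_minus)
  have "\<bar>k t\<bar> \<le> exp (\<sigma> * \<bar>T\<bar>)" for t
    using \<sigma> by (auto simp: k_def indicator_def intro!: mult_left_mono)
  then show ?thesis unfolding e by (intro time_L2_scale[OF L]) (auto simp: k_def[abs_def])
qed

lemma is_C_op_time_L2: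
  assumes "is_C_op e m u v"
  shows "time_L2 lborel (\<lambda>t \<xi>. curl_weight \<xi> (time_restrict T u t \<xi>))"
    and "time_L2 lborel (\<lambda>t \<xi>. div_weight \<xi> (time_restrict T v t \<xi>))"
proof -
  obtain \<sigma>0 where \<sigma>0: "0 \<le> \<sigma>0" "laplace_transformable \<sigma>0 Hcurl_trace Hcurl_trace_norm u"
      "laplace_transformable \<sigma>0 Hdiv_trace Hdiv_trace_norm v"
    using assms unfolding is_C_op_def by blast
  have \<sigma>: "\<sigma>0 < \<sigma>0 + 1" "0 \<le> \<sigma>0 + 1" using \<sigma>0(1) by auto
  show "time_L2 lborel (\<lambda>t \<xi>. curl_weight \<xi> (time_restrict T u t \<xi>))"
    using \<sigma>0(2) \<sigma> unfolding laplace_transformable_def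
    by (intro time_L2_time_restrict[OF _ weight_bounded_linear(1) \<sigma>(2)] time_L2_curl_weight) blast
  show "time_L2 lborel (\<lambda>t \<xi>. div_weight \<xi> (time_restrict T v t \<xi>))"
    using \<sigma>0(3) \<sigma> unfolding laplace_transformable_def
    by (intro time_L2_time_restrict[OF _ weight_bounded_linear(2) \<sigma>(2)] time_L2_div_weight) blast
qed

section \<open>From fixed frequencies to the whole boundary term\<close>

context time_mollifier begin

text \<open>The quantifiers over \<open>T\<close> and \<open>t\<close> stand inside the
  almost-everywhere statement because the later Fubini argument fixes \<open>\<xi>\<close> and uses
  all times at once.\<close>

lemma boundary_AE_nonneg:
  assumes C: "is_C_op e m u v" and e: "0 < e" and m: "0 < m"
  shows "AE \<xi> in lborel. \<xi> \<noteq> 0 \<and>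
    (\<forall>T. 0 \<le> (LINT t:{0..T}|lborel. (LINT \<tau>|lborel. R (t - \<tau>) *\<^sub>R (indicator {0<..} \<tau> *\<^sub>R v \<tau> \<xi>)) \<bullet> (LINT \<tau>|lborel. \<rho> (t - \<tau>) *\<^sub>R (indicator {0<..} \<tau> *\<^sub>R u \<tau> \<xi>)))) \<and>
    (\<forall>t. integrable lborel (\<lambda>\<tau>. R (t - \<tau>) *\<^sub>R (indicator {0<..} \<tau> *\<^sub>R v \<tau> \<xi>))) \<and>
    (\<forall>t. integrable lborel (\<lambda>\<tau>. \<rho> (t - \<tau>) *\<^sub>R (indicator {0<..} \<tau> *\<^sub>R u \<tau> \<xi>)))"
proof -
  obtain \<sigma>0 where \<sigma>0: "0 \<le> \<sigma>0" "laplace_transformable \<sigma>0 Hcurl_trace Hcurl_trace_norm u"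
      "laplace_transformable \<sigma>0 Hdiv_trace Hdiv_trace_norm v"
    and lap: "\<And>s. Re s > \<sigma>0 \<Longrightarrow> (AE \<xi> in lborel. laplace v s \<xi> = s *s B_op e m s (laplace u s) \<xi>)"
    using C unfolding is_C_op_def by blast
  define \<sigma> where "\<sigma> = \<sigma>0 + 1"
  have \<sigma>: "\<sigma>0 < \<sigma>" "0 \<le> \<sigma>" "1 \<le> \<sigma>" using \<sigma>0(1) by (auto simp: \<sigma>_def)
  have Wu: "(\<lambda>t \<xi>. exp (- \<sigma> * t) *\<^sub>R u t \<xi>) \<in> bochner_L1 {0<..} UNIV Hcurl_trace Hcurl_trace_norm"
    and Wv: "(\<lambda>t \<xi>. exp (- \<sigma> * t) *\<^sub>R v t \<xi>) \<in> bochner_L1 {0<..} UNIV Hdiv_trace Hdiv_trace_norm"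
    using \<sigma>0(2,3) \<sigma>(1) unfolding laplace_transformable_def by blast+
  \<comment> \<open>Countably many integers share one exceptional null set of frequencies.\<close>
  have lapn: "AE \<xi> in lborel. \<forall>n::nat. \<sigma> < real n \<longrightarrow> laplace v (complex_of_real (real n)) \<xi>
      = complex_of_real (real n) *s B_op e m (complex_of_real (real n)) (laplace u (complex_of_real (real n))) \<xi>"
    unfolding AE_all_countable
  proof
    fix n :: nat
    show "AE \<xi> in lborel. \<sigma> < real n \<longrightarrow> laplace v (complex_of_real (real n)) \<xi>
      = complex_of_real (real n) *s B_op e m (complex_of_real (real n)) (laplace u (complex_of_real (real n))) \<xi>"
      using lap[of "complex_of_real (real n)"] \<sigma>(1) by (cases "\<sigma> < real n") auto
  qed
  have Iu: "AE \<xi> in lborel. integrable lborel (\<lambda>t. indicator {0<..} t *\<^sub>R exp (- \<sigma> * t) *\<^sub>R u t \<xi>)"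
    by (rule AE_integrable_of_weight[OF Wu time_L2_curl_weight[OF Wu]]) (rule norm_le_weight(1))
  have Iv: "AE \<xi> in lborel. integrable lborel (\<lambda>t. indicator {0<..} t *\<^sub>R exp (- \<sigma> * t) *\<^sub>R v t \<xi>)"
    by (rule AE_integrable_of_weight[OF Wv time_L2_div_weight[OF Wv]]) (rule norm_le_weight(2))
  show ?thesis
    using AE_nonzero lapn Iu Iv
  proof eventually_elim
    case (elim \<xi>)
    define u0 where "u0 t = indicator {0<..} t *\<^sub>R u t \<xi>" for t :: real
    define v0 where "v0 t = indicator {0<..} t *\<^sub>R v t \<xi>" for t :: real
    have ui: "integrable lborel (\<lambda>t. exp (- \<sigma> * t) *\<^sub>R u0 t)" and vi: "integrable lborel (\<lambda>t. exp (- \<sigma> * t) *\<^sub>R v0 t)"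
      using elim(3,4) unfolding u0_def v0_def by (simp_all only: scaleR_left_commute)
    \<comment> \<open>Measurability of \<open>u0\<close> and \<open>v0\<close> is inherited from
      their exponentially weighted versions by undoing the weight.\<close>
    have resc: "x = exp (\<sigma> * t) *\<^sub>R exp (- \<sigma> * t) *\<^sub>R x" for x :: "complex^2" and t
      by (simp add: exp_minus)
    have um: "u0 \<in> borel_measurable borel" and vm: "v0 \<in> borel_measurable borel"
      using borel_measurable_scaleR[OF _ borel_measurable_integrable[OF ui], of "\<lambda>t. exp (\<sigma> * t)"]
        borel_measurable_scaleR[OF _ borel_measurable_integrable[OF vi], of "\<lambda>t. exp (\<sigma> * t)"]
      unfolding resc[symmetric] by auto
    have u0: "u0 t = 0" and v0: "v0 t = 0" if "t < 0" for t using that by (auto simp: u0_def v0_def)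
    have R1: "\<bar>R t\<bar> \<le> 1" for t using nonneg(2,3)[of t] by simp
    have L: "(LINT t|lborel. exp (- real n * t) *\<^sub>R v0 t)
        = complex_of_real (real n) *s B_op e m (complex_of_real (real n)) (\<lambda>\<xi>. LINT t|lborel. exp (- real n * t) *\<^sub>R u0 t) \<xi>"
      if n: "\<sigma> < real n" for n
    proof -
      have "laplace v (complex_of_real (real n)) \<xi> = complex_of_real (real n) *s B_op e m (complex_of_real (real n)) (laplace u (complex_of_real (real n))) \<xi>"
        using elim(2) n by blast
      then show ?thesis unfolding laplace_of_real u0_def v0_def B_op_def .
    qed
    have "0 \<le> (LINT t:{0..T}|lborel. (LINT \<tau>|lborel. R (t - \<tau>) *\<^sub>R v0 \<tau>) \<bullet> (LINT \<tau>|lborel. \<rho> (t - \<tau>) *\<^sub>R u0 \<tau>))" for T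
      by (rule boundary_pointwise_nonneg[OF e m elim(1) \<sigma>(3) ui um u0 vi vm v0 L])
    moreover have "integrable lborel (\<lambda>\<tau>. R (t - \<tau>) *\<^sub>R v0 \<tau>)" for t
      by (rule integrable_causal_kernel[OF vi vm \<sigma>(2) _ _ R1]) (auto simp: zero)
    moreover have "integrable lborel (\<lambda>\<tau>. \<rho> (t - \<tau>) *\<^sub>R u0 \<tau>)" for t
      by (rule integrable_causal_kernel[OF ui um \<sigma>(2) _ _ bound(1)]) (auto simp: zero)
    ultimately show ?case using elim(1) unfolding u0_def v0_def by blast
  qed
qed

text \<open>The time average is put on the kernel, the frequency integral is taken outside, and at a
  fixed \<open>\<xi>\<close> the time average is restored so that the pointwise sign applies.
  Cutting the traces at \<open>T\<close> makes them \<open>time_L2\<close> and does not affect times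
  up to \<open>T'\<close>.\<close>

lemma boundary_nonneg:
  assumes C: "is_C_op e m u v" and e: "0 < e" and m: "0 < m" and T: "T' \<le> T"
  defines "a \<equiv> \<lambda>t \<xi>. div_weight \<xi> (time_restrict T v t \<xi>)" and "b \<equiv> \<lambda>t \<xi>. curl_weight \<xi> (time_restrict T u t \<xi>)"
  shows "0 \<le> (LINT t:{0..T'}|lborel. LINT p|lborel2. R (t - fst p) * \<rho> (t - snd p) * cross lborel a b p)"
proof -
  have a: "time_L2 lborel a" and b: "time_L2 lborel b"
    unfolding a_def b_def by (rule is_C_op_time_L2[OF C])+
  note sf = lborel.sigma_finite_measure_axioms
  have R1: "\<bar>R t\<bar> \<le> 1" for t using nonneg(2,3)[of t] by simp
  have Rm: "R \<in> borel_measurable borel" and \<rho>m: "\<rho> \<in> borel_measurable borel" by measurable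
  \<comment> \<open>Averaged over time first, the kernel is bounded on the plane of both times,
    which permits the exchange with the frequency integral.\<close>
  define k where "k p = (LINT t:{0..T'}|lborel. R (t - fst p) * \<rho> (t - snd p))" for p
  have km: "k \<in> borel_measurable lborel2"
    unfolding k_def[abs_def] set_lebesgue_integral_def by measurable
  have kb: "\<bar>k p\<bar> \<le> \<bar>T'\<bar> * K" for p
  proof -
    have Rr: "\<bar>R s * \<rho> r\<bar> \<le> K" for s r
      using mult_mono[OF R1[of s] bound(1)[of r]] by (simp add: abs_mult)
    have "\<bar>k p\<bar> \<le> (LINT t:{0..T'}|lborel. K)"
      unfolding k_def set_lebesgue_integral_def
    proof (rule order_trans[OF integral_abs_bound integral_mono])
      have "set_integrable lborel {0..T'} (\<lambda>t. R (t - fst p) * \<rho> (t - snd p))"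
        by (intro borel_integrable_atLeastAtMost' continuous_intros continuous_on_compose2[OF cont'(1)[of UNIV]] continuous_on_compose2[OF cont'(3)[of UNIV]]) auto
      then show "integrable lborel (\<lambda>t. \<bar>indicator {0..T'} t *\<^sub>R (R (t - fst p) * \<rho> (t - snd p))\<bar>)"
        unfolding set_integrable_def by (rule integrable_abs)
      show "integrable lborel (\<lambda>t. indicator {0..T'} t *\<^sub>R K)"
        by (intro integrable_scaleR_left integrable_real_indicator) (auto simp: emeasure_lborel_Icc_eq)
    qed (use Rr in \<open>auto simp: indicator_def\<close>)
    also have "\<dots> \<le> \<bar>T'\<bar> * K" using K_nonneg by (cases "0 \<le> T'") (auto simp: set_lebesgue_integral_def mult_nonpos_nonneg)
    finally show ?thesis .
  qed
  have "(LINT t:{0..T'}|lborel. LINT p|lborel2. R (t - fst p) * \<rho> (t - snd p) * cross lborel a b p)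
      = (LINT p|lborel2. k p * cross lborel a b p)"
    unfolding k_def by (rule integral_time_average[OF integrable_cross[OF sf a b] Rm \<rho>m R1 bound(1)])
  also have "\<dots> = (LINT \<xi>|lborel. LINT p|lborel2. k p * (a (fst p) \<xi> \<bullet> b (snd p) \<xi>))"
    by (rule integral_cross_kernel[OF sf a b km kb])
  also have "\<dots> \<ge> 0"
  proof (rule integral_nonneg_AE)
    show "AE \<xi> in lborel. 0 \<le> (LINT p|lborel2. k p * (a (fst p) \<xi> \<bullet> b (snd p) \<xi>))"
      using boundary_AE_nonneg[OF C e m] AE_integrable_time[OF sf a] AE_integrable_time[OF sf b]
    proof eventually_elim
      case (elim \<xi>)
      \<comment> \<open>For \<open>t \<le> T\<close> the causal kernel does not reach times from
        \<open>T\<close> on, so the cut traces may replace the full ones; the weight is linear and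
        passes through the integral.\<close>
      have wl: "w (LINT \<tau>|lborel. k (t - \<tau>) *\<^sub>R (indicator {0<..} \<tau> *\<^sub>R u \<tau> \<xi>)) = (LINT \<tau>|lborel. k (t - \<tau>) *\<^sub>R w (time_restrict T u \<tau> \<xi>))"
        if i: "integrable lborel (\<lambda>\<tau>. k (t - \<tau>) *\<^sub>R (indicator {0<..} \<tau> *\<^sub>R u \<tau> \<xi>))" and w: "bounded_linear w"
          and k: "\<And>t. t \<le> 0 \<Longrightarrow> k t = 0" and t: "t \<le> T"
        for k :: "real \<Rightarrow> real" and u :: "real \<Rightarrow> real^2 \<Rightarrow> complex^2" and w :: "complex^2 \<Rightarrow> complex \<times> complex" and t
      proof -
        have "k (t - \<tau>) *\<^sub>R w (time_restrict T u \<tau> \<xi>) = w (k (t - \<tau>) *\<^sub>R (indicator {0<..} \<tau> *\<^sub>R u \<tau> \<xi>))" for \<tau>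
          unfolding linear_scale[OF bounded_linear.linear[OF w]] time_restrict_def using k[of "t - \<tau>"] t
          by (cases "\<tau> < T") (auto simp: indicator_def)
        then show ?thesis using integral_bounded_linear[OF w i] by simp
      qed
      note I = integral_inner_product[OF elim(2,3)]
      have "(LINT p|lborel2. k p * (a (fst p) \<xi> \<bullet> b (snd p) \<xi>))
          = (LINT t:{0..T'}|lborel. LINT p|lborel2. R (t - fst p) * \<rho> (t - snd p) * (a (fst p) \<xi> \<bullet> b (snd p) \<xi>))"
        unfolding k_def by (rule integral_time_average[OF I(1) Rm \<rho>m R1 bound(1), symmetric])
      also have "\<dots> = (LINT t:{0..T'}|lborel. (LINT \<tau>|lborel. R (t - \<tau>) *\<^sub>R (indicator {0<..} \<tau> *\<^sub>R v \<tau> \<xi>)) \<bullet> (LINT \<tau>|lborel. \<rho> (t - \<tau>) *\<^sub>R (indicator {0<..} \<tau> *\<^sub>R u \<tau> \<xi>)))"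
      proof (rule set_lebesgue_integral_cong)
        show "\<forall>t. t \<in> {0..T'} \<longrightarrow> (LINT p|lborel2. R (t - fst p) * \<rho> (t - snd p) * (a (fst p) \<xi> \<bullet> b (snd p) \<xi>))
          = (LINT \<tau>|lborel. R (t - \<tau>) *\<^sub>R (indicator {0<..} \<tau> *\<^sub>R v \<tau> \<xi>)) \<bullet> (LINT \<tau>|lborel. \<rho> (t - \<tau>) *\<^sub>R (indicator {0<..} \<tau> *\<^sub>R u \<tau> \<xi>))"
        proof (intro allI impI)
          fix t assume "t \<in> {0..T'}"
          then have t: "t \<le> T" using T by simp
          have ia: "integrable lborel (\<lambda>s. R (t - s) *\<^sub>R a s \<xi>)" and ib: "integrable lborel (\<lambda>s. \<rho> (t - s) *\<^sub>R b s \<xi>)"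
            by (rule integrable_bounded_scale[OF elim(2) _ R1], measurable) (rule integrable_bounded_scale[OF elim(3) _ bound(1)], measurable)
          have "(LINT p|lborel2. R (t - fst p) * \<rho> (t - snd p) * (a (fst p) \<xi> \<bullet> b (snd p) \<xi>))
              = (LINT s|lborel. R (t - s) *\<^sub>R a s \<xi>) \<bullet> (LINT s|lborel. \<rho> (t - s) *\<^sub>R b s \<xi>)"
            using integral_inner_product(2)[OF ia ib] by (simp add: mult.assoc mult.left_commute)
          also have "\<dots> = (LINT \<tau>|lborel. R (t - \<tau>) *\<^sub>R (indicator {0<..} \<tau> *\<^sub>R v \<tau> \<xi>)) \<bullet> (LINT \<tau>|lborel. \<rho> (t - \<tau>) *\<^sub>R (indicator {0<..} \<tau> *\<^sub>R u \<tau> \<xi>))"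
            unfolding a_def b_def using elim(1)
            by (subst (1 2) wl[symmetric]) (auto simp: weight_bounded_linear zero t inner_weights)
          finally show "(LINT p|lborel2. R (t - fst p) * \<rho> (t - snd p) * (a (fst p) \<xi> \<bullet> b (snd p) \<xi>))
            = (LINT \<tau>|lborel. R (t - \<tau>) *\<^sub>R (indicator {0<..} \<tau> *\<^sub>R v \<tau> \<xi>)) \<bullet> (LINT \<tau>|lborel. \<rho> (t - \<tau>) *\<^sub>R (indicator {0<..} \<tau> *\<^sub>R u \<tau> \<xi>))" .
        qed
      qed simp
      finally show ?case using elim(1) by simp
    qed
  qed
  finally show ?thesis .
qed

end

text \<open>Taking the real part inside the pairing needs absolute convergence, which the weights
  supply through Cauchy-Schwarz.\<close>

lemma cross_trace_pairing:
  assumes g: "g \<in> Hdiv_trace" and k: "k \<in> Hcurl_trace"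
  shows "(LINT \<xi>|lborel. div_weight \<xi> (g \<xi>) \<bullet> curl_weight \<xi> (k \<xi>)) = Re (trace_pairing g k)"
proof -
  have gm [measurable]: "g \<in> borel_measurable borel" and km [measurable]: "k \<in> borel_measurable borel"
    using g k by (auto simp: Hdiv_trace_def Hcurl_trace_def)
  have m: "(\<lambda>\<xi>. cdot (g \<xi>) (k \<xi>)) \<in> borel_measurable lborel"
    unfolding cdot_def by (intro borel_measurable_sum borel_measurable_times measurable_compose[OF _ borel_measurable_continuous_onI[of cnj]] measurable_nth)
      (auto intro: continuous_intros gm km)
  have "AE \<xi> in lborel. Hdiv_trace_density g \<xi> = (norm (div_weight \<xi> (g \<xi>)))\<^sup>2"
    and "AE \<xi> in lborel. Hcurl_trace_density k \<xi> = (norm (curl_weight \<xi> (k \<xi>)))\<^sup>2"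
    using AE_nonzero by (eventually_elim, simp add: norm_div_weight norm_curl_weight)+
  moreover have mm: "(\<lambda>\<xi>. div_weight \<xi> (g \<xi>)) \<in> borel_measurable lborel" "(\<lambda>\<xi>. curl_weight \<xi> (k \<xi>)) \<in> borel_measurable lborel"
    by measurable
  ultimately have sq: "sq_integrable lborel (\<lambda>\<xi>. div_weight \<xi> (g \<xi>))" "sq_integrable lborel (\<lambda>\<xi>. curl_weight \<xi> (k \<xi>))"
    using g k unfolding sq_integrable_def Hdiv_trace_def Hcurl_trace_def
    by (auto intro: integrable_cong_AE_imp)
  have I: "integrable lborel (\<lambda>\<xi>. cdot (g \<xi>) (k \<xi>))"
  proof (rule Bochner_Integration.integrable_bound[OF integrable_mult_right[OF Cauchy_Schwarz_norm(1)[OF sq], of 2] m])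
    show "AE \<xi> in lborel. norm (cdot (g \<xi>) (k \<xi>)) \<le> norm (2 * (norm (div_weight \<xi> (g \<xi>)) * norm (curl_weight \<xi> (k \<xi>))))"
      using AE_nonzero
    proof eventually_elim
      case (elim \<xi>)
      \<comment> \<open>Reduces the imaginary part to a real inner product with a rotated field,
        whose weighted norm is unchanged; so it obeys the same bound as the real part.\<close>
      have Im: "Im (cdot x y) = (\<i> *s y) \<bullet> x" for x y :: "complex^2"
        by (simp add: cdot_def inner_vec_def inner_complex_def sum_2 algebra_simps)
      define w where "w = curl_weight \<xi> (k \<xi>)"
      have wi: "curl_weight \<xi> (\<i> *s k \<xi>) = (\<i> * fst w, \<i> * snd w)"
        by (simp add: w_def curl_weight_def par_def per_def algebra_simps)
      have n: "norm (\<i> * fst w, \<i> * snd w) = norm w"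
        unfolding norm_Pair norm_prod_def by (simp add: norm_mult)
      have "\<bar>Im (cdot (g \<xi>) (k \<xi>))\<bar> \<le> norm (div_weight \<xi> (g \<xi>)) * norm w"
        using Cauchy_Schwarz_ineq2[of "div_weight \<xi> (g \<xi>)" "curl_weight \<xi> (\<i> *s k \<xi>)"]
        unfolding Im inner_weights[OF elim] by (simp add: inner_commute wi n)
      moreover have "\<bar>Re (cdot (g \<xi>) (k \<xi>))\<bar> \<le> norm (div_weight \<xi> (g \<xi>)) * norm w"
        using Cauchy_Schwarz_ineq2[of "div_weight \<xi> (g \<xi>)" w] unfolding w_def Re_cdot inner_weights[OF elim] .
      ultimately show ?case using cmod_le[of "cdot (g \<xi>) (k \<xi>)"] unfolding w_def by simp
    qed
  qed
  have "(LINT \<xi>|lborel. div_weight \<xi> (g \<xi>) \<bullet> curl_weight \<xi> (k \<xi>)) = (LINT \<xi>|lborel. Re (cdot (g \<xi>) (k \<xi>)))"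
  proof (rule integral_cong_AE)
    show "AE \<xi> in lborel. div_weight \<xi> (g \<xi>) \<bullet> curl_weight \<xi> (k \<xi>) = Re (cdot (g \<xi>) (k \<xi>))"
      using AE_nonzero by eventually_elim (simp add: inner_weights Re_cdot)
  qed (use mm I in \<open>auto intro!: borel_measurable_inner\<close>)
  also have "\<dots> = Re (trace_pairing g k)" unfolding trace_pairing_def by (rule integral_Re[OF I])
  finally show ?thesis .
qed

section \<open>The energy identity and estimate for the mollified field\<close>

text \<open>Fubini in both orders: the equation is integrated over \<open>s\<close> first, while the
  source term is estimated by integrating over \<open>r\<close> first.\<close>

lemma
  fixes X :: "real \<times> real \<Rightarrow> real"
  assumes X: "integrable lborel2 X"
    and [measurable]: "k \<in> borel_measurable borel" "l \<in> borel_measurable borel"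
    and K: "\<And>t. \<bar>k t\<bar> \<le> K" "\<And>t. \<bar>l t\<bar> \<le> L"
  shows integrable_tensor_kernel: "integrable lborel2 (\<lambda>p. k (fst p) * l (snd p) * X p)"
    and integrable_iterated_kernel: "integrable lborel (\<lambda>r. l r * (LINT s|lborel. k s * X (s, r)))"
    and integral_iterated_kernel: "(LINT r|lborel. l r * (LINT s|lborel. k s * X (s, r))) = (LINT p|lborel2. k (fst p) * l (snd p) * X p)"
    and integral_iterated_kernel': "(LINT s|lborel. k s * (LINT r|lborel. l r * X (s, r))) = (LINT p|lborel2. k (fst p) * l (snd p) * X p)"
proof -
  have [measurable]: "X \<in> borel_measurable lborel2" using X by auto
  show I: "integrable lborel2 (\<lambda>p. k (fst p) * l (snd p) * X p)"
  proof (rule Bochner_Integration.integrable_bound[OF integrable_mult_right[OF X, of "K * L"]])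
    have "\<bar>k s * l r * x\<bar> \<le> \<bar>K * L * x\<bar>" for s r x
      unfolding abs_mult by (intro mult_mono order_trans[OF K(1) abs_ge_self] order_trans[OF K(2) abs_ge_self]) auto
    then show "AE p in lborel2. norm (k (fst p) * l (snd p) * X p) \<le> norm (K * L * X p)" by simp
  qed measurable
  then have J: "integrable lborel2 (\<lambda>(s, r). l r * (k s * X (s, r)))" by (simp add: split_beta' mult_ac)
  have J': "integrable lborel2 (\<lambda>(s, r). k s * (l r * X (s, r)))" using I by (simp add: split_beta' mult_ac)
  show "integrable lborel (\<lambda>r. l r * (LINT s|lborel. k s * X (s, r)))"
    using lborel_pair.integrable_snd[OF J] by (simp only: integral_mult_right_zero)
  show "(LINT r|lborel. l r * (LINT s|lborel. k s * X (s, r))) = (LINT p|lborel2. k (fst p) * l (snd p) * X p)"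
    using lborel_pair.integral_snd[OF J] by (simp only: integral_mult_right_zero) (simp add: split_beta' mult_ac)
  show "(LINT s|lborel. k s * (LINT r|lborel. l r * X (s, r))) = (LINT p|lborel2. k (fst p) * l (snd p) * X p)"
    using lborel_pair.integral_fst[OF J'] by (simp only: integral_mult_right_zero) (simp add: split_beta' mult_ac)
qed

context time_mollifier begin

definition mollify :: "(real \<Rightarrow> 'x \<Rightarrow> 'b::euclidean_space) \<Rightarrow> real \<Rightarrow> 'x \<Rightarrow> 'b" where
  "mollify a t x = (LINT s|lborel. \<rho> (t - s) *\<^sub>R a s x)"

text \<open>Integrated over [0,T'], the second derivative and the curl term become halves of squared
  norms, and the boundary terms are nonnegative. This leaves
  \<open>(n T')\<^sup>2 / 2 \<le> S * D\<close> with \<open>S\<close> the supremum of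
  \<open>n\<close>; hence \<open>S\<^sup>2 \<le> 2 * (S * D)\<close>, and the factor 2 in the
  conclusion.\<close>

lemma energy_estimate:
  fixes a c f :: "real \<Rightarrow> 'x \<Rightarrow> 'b::euclidean_space" and w0 w1 :: "'x \<Rightarrow> 'b"
    and va ub :: "nat \<Rightarrow> real \<Rightarrow> 'y \<Rightarrow> 'c::euclidean_space"
  assumes M: "sigma_finite_measure M" and N: "sigma_finite_measure N"
    and a: "time_L2 M a" and c: "time_L2 M c" and f: "time_L2 M f"
    and supp: "\<And>t x. t < 0 \<Longrightarrow> a t x = 0" "\<And>t x. t < 0 \<Longrightarrow> c t x = 0"
    and w0: "sq_integrable M w0" and w1: "sq_integrable M w1"
    and b: "\<And>j. j \<in> J \<Longrightarrow> time_L2 N (va j)" "\<And>j. j \<in> J \<Longrightarrow> time_L2 N (ub j)"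
    and b_pos: "\<And>j T'. j \<in> J \<Longrightarrow> T' \<le> T \<Longrightarrow>
      0 \<le> (LINT t:{0..T'}|lborel. LINT p|lborel2. R (t - fst p) * \<rho> (t - snd p) * cross N (va j) (ub j) p)"
    and eq: "\<And>t. t \<in> {0..T} \<Longrightarrow> AE r in lborel. (LINT s|lborel. \<rho>' (t - s) * cross M a a (s, r)) =
        \<rho> t * (LINT x|M. w0 x \<bullet> a r x) + R t * (LINT x|M. w1 x \<bullet> a r x)
        - (LINT s|lborel. R (t - s) * (cross M c c (s, r) + cross M f a (s, r) + (\<Sum>j\<in>J. cross N (va j) (ub j) (s, r))))"
    and t: "t \<in> {0..T}"
  shows "l2n M (mollify a t) \<le> 2 * (l2n M w0 + T * l2n M w1 + T * (LINT s|lborel. l2n M (f s)))"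
proof -
  have R1: "\<bar>R t\<bar> \<le> 1" for t using nonneg(2,3)[of t] by simp
  have sh [measurable]: "(\<lambda>s. \<rho> (t - s)) \<in> borel_measurable borel" "(\<lambda>s. \<rho>' (t - s)) \<in> borel_measurable borel" "(\<lambda>s. R (t - s)) \<in> borel_measurable borel" for t
    by measurable
  have \<rho>m: "\<rho> \<in> borel_measurable borel" "\<rho>' \<in> borel_measurable borel" "R \<in> borel_measurable borel" by measurable
  note X = integrable_cross[OF M a a] integrable_cross[OF M c c] integrable_cross[OF M f a]
  have XB: "integrable lborel2 (cross N (va j) (ub j))" if "j \<in> J" for j
    by (rule integrable_cross[OF N b(1)[OF that] b(2)[OF that]])
  define D where "D = l2n M w0 + T * l2n M w1 + T * (LINT s|lborel. l2n M (f s))"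
  have Nf: "0 \<le> (LINT s|lborel. l2n M (f s))" by simp
  define n where "n t = l2n M (mollify a t)" for t
  have E: "sq_integrable M (mollify a t)" for t
    unfolding mollify_def[abs_def] by (rule sq_integrable_time_integral[OF M a sh(1) bound(1)])
  have n2: "(n t)\<^sup>2 = (LINT p|lborel2. \<rho> (t - fst p) * \<rho> (t - snd p) * cross M a a p)" for t
    unfolding n_def l2n_power2 mollify_def
    by (rule integral_cross_tensor[OF M a a sh(1) sh(1) bound(1) bound(1), symmetric])
  have cpos: "0 \<le> (LINT p|lborel2. R (t - fst p) * R (t - snd p) * cross M c c p)" for t
    unfolding integral_cross_tensor[OF M c c sh(3) sh(3) R1 R1] by simp
  \<comment> \<open>A crude bound depending on \<open>K\<close>; its purpose is that the supremum
    \<open>S\<close> below is finite.\<close>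
  define B0 where "B0 = K * K * (LINT p|lborel2. \<bar>cross M a a p\<bar>)"
  have nB: "(n t)\<^sup>2 \<le> B0" for t
  proof -
    have "(n t)\<^sup>2 \<le> (LINT p|lborel2. \<bar>\<rho> (t - fst p) * \<rho> (t - snd p) * cross M a a p\<bar>)"
      unfolding n2 by (rule order_trans[OF abs_ge_self integral_abs_bound])
    also have "\<dots> \<le> (LINT p|lborel2. K * K * \<bar>cross M a a p\<bar>)"
    proof (rule integral_mono)
      show "integrable lborel2 (\<lambda>p. \<bar>\<rho> (t - fst p) * \<rho> (t - snd p) * cross M a a p\<bar>)"
        by (rule integrable_abs[OF integrable_tensor_kernel[OF X(1) sh(1) sh(1) bound(1) bound(1)]])
      show "integrable lborel2 (\<lambda>p. K * K * \<bar>cross M a a p\<bar>)" using X(1) by auto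
      show "\<bar>\<rho> (t - fst p) * \<rho> (t - snd p) * cross M a a p\<bar> \<le> K * K * \<bar>cross M a a p\<bar>" for p
        unfolding abs_mult by (intro mult_right_mono mult_mono bound K_nonneg) auto
    qed
    finally show ?thesis by (simp add: B0_def)
  qed
  have n0: "0 \<le> n t" for t by (simp add: n_def)
  have nle: "n t \<le> sqrt B0" for t using nB[of t] real_le_rsqrt by blast
  have symm: "cross M d d (s, r) = cross M d d (r, s)" for d :: "real \<Rightarrow> 'x \<Rightarrow> 'b" and s r
    by (simp add: cross_def inner_commute)
  have supp_a: "cross M a a (s, r) = 0" and supp_c: "cross M c c (s, r) = 0" if "s < 0 \<or> r < 0" for s r
    using that supp by (auto simp: cross_def)
  define A where "A t = (LINT p|lborel2. \<rho>' (t - fst p) * \<rho> (t - snd p) * cross M a a p)" for t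
  define Cc where "Cc t = (LINT p|lborel2. R (t - fst p) * \<rho> (t - snd p) * cross M c c p)" for t
  define Ff where "Ff t = (LINT p|lborel2. R (t - fst p) * \<rho> (t - snd p) * cross M f a p)" for t
  define Bb where "Bb j t = (LINT p|lborel2. R (t - fst p) * \<rho> (t - snd p) * cross N (va j) (ub j) p)" for j t
  \<comment> \<open>The assumed equation, multiplied by \<open>\<rho> (t - r)\<close> and integrated
    over \<open>r\<close>, so that the test field becomes the mollified field.\<close>
  have ident: "A t = \<rho> t * (LINT x|M. w0 x \<bullet> mollify a t x) + R t * (LINT x|M. w1 x \<bullet> mollify a t x) - (Cc t + Ff t + (\<Sum>j\<in>J. Bb j t))"
    if t: "t \<in> {0..T}" for t
  proof -
    define X where "X p = cross M c c p + cross M f a p + (\<Sum>j\<in>J. cross N (va j) (ub j) p)" for p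
    have XI: "integrable lborel2 X" unfolding X_def[abs_def]
      by (intro Bochner_Integration.integrable_add Bochner_Integration.integrable_sum integrable_cross[OF M c c] integrable_cross[OF M f a] XB)
    note Wm = integrable_inner_time[OF M w0 a sh(1) bound(1)] integrable_inner_time[OF M w1 a sh(1) bound(1)]
    note II = integrable_iterated_kernel[OF XI sh(3) sh(1) R1 bound(1)]
    note IA = integrable_iterated_kernel[OF integrable_cross[OF M a a] sh(2) sh(1) bound(2) bound(1)]
    have "A t = (LINT r|lborel. \<rho> (t - r) * (LINT s|lborel. \<rho>' (t - s) * cross M a a (s, r)))"
      unfolding A_def by (rule integral_iterated_kernel[OF integrable_cross[OF M a a] sh(2) sh(1) bound(2) bound(1), symmetric])
    also have "\<dots> = (LINT r|lborel. \<rho> t * (\<rho> (t - r) * (LINT x|M. w0 x \<bullet> a r x)) + R t * (\<rho> (t - r) * (LINT x|M. w1 x \<bullet> a r x))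
        - \<rho> (t - r) * (LINT s|lborel. R (t - s) * X (s, r)))"
    proof (rule integral_cong_AE)
      show "AE r in lborel. \<rho> (t - r) * (LINT s|lborel. \<rho>' (t - s) * cross M a a (s, r)) = \<rho> t * (\<rho> (t - r) * (LINT x|M. w0 x \<bullet> a r x)) + R t * (\<rho> (t - r) * (LINT x|M. w1 x \<bullet> a r x))
        - \<rho> (t - r) * (LINT s|lborel. R (t - s) * X (s, r))"
        using eq[OF t] unfolding X_def by eventually_elim (simp only: right_diff_distrib distrib_left mult.left_commute)
    next
      show "(\<lambda>r. \<rho> (t - r) * (LINT s|lborel. \<rho>' (t - s) * cross M a a (s, r))) \<in> borel_measurable lborel"
        by (rule borel_measurable_integrable[OF IA])
      show "(\<lambda>r. \<rho> t * (\<rho> (t - r) * (LINT x|M. w0 x \<bullet> a r x)) + R t * (\<rho> (t - r) * (LINT x|M. w1 x \<bullet> a r x))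
        - \<rho> (t - r) * (LINT s|lborel. R (t - s) * X (s, r))) \<in> borel_measurable lborel"
        by (intro borel_measurable_integrable Bochner_Integration.integrable_diff Bochner_Integration.integrable_add
            integrable_mult_right Wm II)
    qed
    also have "\<dots> = \<rho> t * (LINT x|M. w0 x \<bullet> mollify a t x) + R t * (LINT x|M. w1 x \<bullet> mollify a t x) - (LINT r|lborel. \<rho> (t - r) * (LINT s|lborel. R (t - s) * X (s, r)))"
      unfolding mollify_def integral_inner_time[OF M w0 a sh(1) bound(1), symmetric] integral_inner_time[OF M w1 a sh(1) bound(1), symmetric]
      using Wm II by (simp del: integral_mult_right_zero add: integral_mult_right)
    also have "(LINT r|lborel. \<rho> (t - r) * (LINT s|lborel. R (t - s) * X (s, r))) = (LINT p|lborel2. R (t - fst p) * \<rho> (t - snd p) * X p)"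
      by (rule integral_iterated_kernel[OF XI sh(3) sh(1) R1 bound(1)])
    also have "\<dots> = Cc t + Ff t + (\<Sum>j\<in>J. Bb j t)"
    proof -
      note tk = integrable_tensor_kernel[OF _ sh(3) sh(1) R1 bound(1)]
      have jj: "integrable lborel2 (\<lambda>p. \<Sum>j\<in>J. R (t - fst p) * \<rho> (t - snd p) * cross N (va j) (ub j) p)"
        by (intro Bochner_Integration.integrable_sum tk XB)
      have "(LINT p|lborel2. (\<Sum>j\<in>J. R (t - fst p) * \<rho> (t - snd p) * cross N (va j) (ub j) p)) = (\<Sum>j\<in>J. Bb j t)"
        unfolding Bb_def by (intro Bochner_Integration.integral_sum tk XB)
      then show ?thesis
        using tk[OF integrable_cross[OF M c c]] tk[OF integrable_cross[OF M f a]] jj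
        unfolding X_def Cc_def Ff_def distrib_left sum_distrib_left by simp
    qed
    finally show ?thesis .
  qed
  \<comment> \<open>For each \<open>s\<close> the source is paired with the mollified field at the
    single time \<open>t\<close>, so only the integral of its norm over time enters.\<close>
  have Ff_bd: "\<bar>Ff t\<bar> \<le> S * (LINT s|lborel. l2n M (f s))" if S: "n t \<le> S" for t S
  proof -
    have fae: "AE s in lborel. sq_integrable M (f s)" and fi: "integrable lborel (\<lambda>s. l2n M (f s))"
      using f by (auto simp: time_L2_def)
    have "Ff t = (LINT s|lborel. R (t - s) * (LINT r|lborel. \<rho> (t - r) * cross M f a (s, r)))"
      unfolding Ff_def by (rule integral_iterated_kernel'[OF X(3) sh(3) sh(1) R1 bound(1), symmetric])
    also have "\<bar>\<dots>\<bar> \<le> (LINT s|lborel. S * l2n M (f s))"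
    proof (cases "integrable lborel (\<lambda>s. R (t - s) * (LINT r|lborel. \<rho> (t - r) * cross M f a (s, r)))")
      case True
      show ?thesis
      proof (rule order_trans[OF integral_abs_bound integral_mono_AE])
        show "AE s in lborel. \<bar>R (t - s) * (LINT r|lborel. \<rho> (t - r) * cross M f a (s, r))\<bar> \<le> S * l2n M (f s)"
          using fae
        proof eventually_elim
          case (elim s)
          have "(LINT r|lborel. \<rho> (t - r) * cross M f a (s, r)) = (LINT x|M. f s x \<bullet> mollify a t x)"
            unfolding cross_def mollify_def fst_conv snd_conv by (rule integral_inner_time[OF M elim a sh(1) bound(1)])
          also have "\<bar>\<dots>\<bar> \<le> l2n M (f s) * n t" unfolding n_def by (rule Cauchy_Schwarz_inner(2)[OF elim E])
          also have "\<dots> \<le> l2n M (f s) * S" using S by (intro mult_left_mono) auto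
          finally have "\<bar>R (t - s)\<bar> * \<bar>LINT r|lborel. \<rho> (t - r) * cross M f a (s, r)\<bar> \<le> 1 * (l2n M (f s) * S)"
            by (intro mult_mono R1) auto
          then show ?case by (simp add: abs_mult mult.commute)
        qed
      qed (use True fi in auto)
    next
      case False
      then show ?thesis using order_trans[OF n0 S] by (simp add: not_integrable_integral_eq)
    qed
    finally show ?thesis by simp
  qed
  have step: "(n T')\<^sup>2 \<le> 2 * (S * D)" if T': "T' \<in> {0..T}" and S: "\<And>t. t \<in> {0..T} \<Longrightarrow> n t \<le> S" for T' S
  proof -
    have T0: "0 \<le> T'" "T' \<le> T" using T' by auto
    have S0: "0 \<le> S" using order_trans[OF n0 S[of T']] T' by simp
    have iA: "set_integrable lborel {0..T'} A" unfolding A_def[abs_def]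
      by (rule integrable_time_average[OF X(1) \<rho>m(2) \<rho>m(1) bound(2) bound(1)])
    have iC: "set_integrable lborel {0..T'} Cc" unfolding Cc_def[abs_def]
      by (rule integrable_time_average[OF X(2) \<rho>m(3) \<rho>m(1) R1 bound(1)])
    have iB: "set_integrable lborel {0..T'} (Bb j)" if "j \<in> J" for j unfolding Bb_def[abs_def]
      by (rule integrable_time_average[OF XB[OF that] \<rho>m(3) \<rho>m(1) R1 bound(1)])
    have iBs: "set_integrable lborel {0..T'} (\<lambda>t. \<Sum>j\<in>J. Bb j t)"
      using iB unfolding set_integrable_def scaleR_sum_right by (intro Bochner_Integration.integrable_sum)
    have vA: "(LINT t:{0..T'}|lborel. A t) = (n T')\<^sup>2 / 2" unfolding A_def n2
      by (rule integral_time_average_symmetric[OF X(1) symm supp_a deriv(1) cont'(2) zero(1) bound(1,2) T0(1)])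
    \<comment> \<open>Here the derivative \<open>\<rho>\<close> of \<open>R\<close> sits at the
      second time; the symmetry of \<open>cross M c c\<close> moves it to the first, as the
      averaging lemma expects.\<close>
    have vC: "(LINT t:{0..T'}|lborel. Cc t) = (LINT p|lborel2. R (T' - fst p) * R (T' - snd p) * cross M c c p) / 2"
    proof -
      have e: "R (t - fst p) * \<rho> (t - snd p) * cross M c c p = \<rho> (t - snd p) * R (t - fst p) * cross M c c (snd p, fst p)" for t p
        using symm[of c "fst p" "snd p"] by (simp add: mult.commute)
      have "Cc t = (LINT p|lborel2. \<rho> (t - fst p) * R (t - snd p) * cross M c c p)" for t
        unfolding Cc_def e using integral_pair_swap[of "\<lambda>p. \<rho> (t - fst p) * R (t - snd p) * cross M c c p"] X(2) by simp
      then show ?thesis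
        using integral_time_average_symmetric[OF X(2) symm supp_c deriv(3) cont'(1) zero(3) R1 bound(1) T0(1)] by presburger
    qed
    have vB: "0 \<le> (LINT t:{0..T'}|lborel. (\<Sum>j\<in>J. Bb j t))"
    proof -
      have "(LINT t:{0..T'}|lborel. (\<Sum>j\<in>J. Bb j t)) = (\<Sum>j\<in>J. LINT t:{0..T'}|lborel. Bb j t)"
        using iB unfolding set_integrable_def set_lebesgue_integral_def scaleR_sum_right by (rule Bochner_Integration.integral_sum)
      also have "\<dots> \<ge> 0" unfolding Bb_def by (intro sum_nonneg b_pos T0)
      finally show ?thesis .
    qed
    have i\<rho>: "set_integrable lborel {0..T'} \<rho>" by (intro borel_integrable_atLeastAtMost' cont')
    \<comment> \<open>The mass of \<open>\<rho>\<close> up to \<open>T'\<close> is at most 1, which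
      keeps a factor \<open>T\<close> away from the \<open>w0\<close> term.\<close>
    have v\<rho>: "(LINT t:{0..T'}|lborel. \<rho> t) = R T'"
      unfolding set_lebesgue_integral_def using integral_FTC_Icc[OF T0(1), of R \<rho>]
      by (auto simp: has_real_derivative_iff_has_vector_derivative[symmetric] cont' zero intro: has_field_derivative_at_within deriv)
    define n1 where "n1 = l2n M w1 + (LINT s|lborel. l2n M (f s))"
    have n1: "0 \<le> n1" by (simp add: n1_def)
    have "(n T')\<^sup>2 / 2 \<le> (LINT t:{0..T'}|lborel. A t + (Cc t + (\<Sum>j\<in>J. Bb j t)))"
      using vA vC vB cpos[of T'] iA iC iBs by (simp add: set_integral_add)
    also have "\<dots> \<le> (LINT t:{0..T'}|lborel. \<rho> t * (l2n M w0 * S) + n1 * S)"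
    proof (rule set_integral_mono)
      show "set_integrable lborel {0..T'} (\<lambda>t. A t + (Cc t + (\<Sum>j\<in>J. Bb j t)))" using iA iC iBs by (intro set_integral_add)
      show "set_integrable lborel {0..T'} (\<lambda>t. \<rho> t * (l2n M w0 * S) + n1 * S)"
        by (intro borel_integrable_atLeastAtMost' continuous_intros cont')
      fix t assume "t \<in> {0..T'}"
      then have t: "t \<in> {0..T}" using T0 by auto
      have ip: "\<bar>LINT x|M. w x \<bullet> mollify a t x\<bar> \<le> l2n M w * S" if "sq_integrable M w" for w
        using Cauchy_Schwarz_inner(2)[OF that E[of t]] mult_left_mono[OF S[OF t] l2n_nonneg[of M w]] unfolding n_def by linarith
      have "\<rho> t * (LINT x|M. w0 x \<bullet> mollify a t x) \<le> \<rho> t * (l2n M w0 * S)"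
        using ip[OF w0] by (intro mult_left_mono nonneg) linarith
      moreover have "R t * (LINT x|M. w1 x \<bullet> mollify a t x) \<le> 1 * (l2n M w1 * S)"
        using ip[OF w1] S0 by (intro order_trans[OF mult_left_mono[OF _ nonneg(2)] mult_right_mono[OF nonneg(3)]]) auto
      ultimately show "A t + (Cc t + (\<Sum>j\<in>J. Bb j t)) \<le> \<rho> t * (l2n M w0 * S) + n1 * S"
        using ident[OF t] Ff_bd[OF S[OF t]] by (simp add: n1_def algebra_simps)
    qed
    also have "\<dots> = R T' * (l2n M w0 * S) + T' * (n1 * S)"
    proof -
      have "(LINT t:{0..T'}|lborel. \<rho> t * (l2n M w0 * S) + n1 * S) = (LINT t:{0..T'}|lborel. \<rho> t * (l2n M w0 * S)) + (LINT t:{0..T'}|lborel. n1 * S)"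
        by (intro set_integral_add borel_integrable_atLeastAtMost' continuous_intros cont')
      also have "(LINT t:{0..T'}|lborel. \<rho> t * (l2n M w0 * S)) = R T' * (l2n M w0 * S)"
        unfolding v\<rho>[symmetric] by (rule set_integral_mult_left)
      also have "(LINT t:{0..T'}|lborel. n1 * S) = T' * (n1 * S)"
        using T0 by (simp add: set_lebesgue_integral_def)
      finally show ?thesis .
    qed
    also have "\<dots> \<le> 1 * (l2n M w0 * S) + T * (n1 * S)"
      using S0 n1 T0 nonneg(3) by (intro add_mono mult_right_mono) auto
    also have "\<dots> = S * D" by (simp add: D_def n1_def algebra_simps)
    finally show ?thesis by simp
  qed
  \<comment> \<open>The estimate at each \<open>T'\<close> involves the supremum over the whole
    interval, so it is closed by taking the supremum on the left as well.\<close>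
  define S where "S = (SUP t\<in>{0..T}. n t)"
  have bdd: "bdd_above (n ` {0..T})" using nle by (auto intro!: bdd_aboveI[where M = "sqrt B0"])
  have nS: "n t \<le> S" if "t \<in> {0..T}" for t unfolding S_def by (rule cSUP_upper[OF that bdd])
  have T0: "0 \<le> T" using t by simp
  have D0: "0 \<le> D" using T0 Nf by (simp add: D_def)
  have S0: "0 \<le> S" using order_trans[OF n0 nS[OF t]] .
  have "S \<le> sqrt (2 * (S * D))" unfolding S_def[of]
  proof (rule cSUP_least)
    show "{0..T} \<noteq> {}" using T0 by simp
    show "n t \<le> sqrt (2 * ((SUP t\<in>{0..T}. n t) * D))" if "t \<in> {0..T}" for t
      using step[OF that nS] real_le_rsqrt unfolding S_def by blast
  qed
  then have "S\<^sup>2 \<le> 2 * (S * D)" using S0 D0 real_sqrt_le_iff power_mono[of S "sqrt (2 * (S * D))" 2] by simp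
  then have "S * S \<le> S * (2 * D)" by (simp add: power2_eq_square mult.left_commute)
  then have "S \<le> 2 * D" using S0 D0 by (cases "S = 0") auto
  then show ?thesis using nS[OF t] unfolding n_def D_def by linarith
qed

end

subsection \<open>Gamma densities as mollifiers\<close>

lemma conv_commute: "conv k f t = conv f k t"
  unfolding conv_def using lborel_integral_real_affine[of "-1" "\<lambda>\<tau>. k (t - \<tau>) * f \<tau>" t] by (simp add: mult.commute)

context time_mollifier begin

text \<open>With convolutions on the half-line, \<open>\<rho>'\<close> against \<open>y\<close>
  equals \<open>\<rho>\<close> against \<open>y'\<close> plus the initial value; then
  \<open>\<rho>\<close> against \<open>y'\<close> equals \<open>R\<close> against \<open>r\<close>
  plus the initial derivative.\<close>

lemma mollified_second_derivative:
  fixes y y' r :: "real \<Rightarrow> real"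
  assumes dy: "\<And>t. 0 \<le> t \<Longrightarrow> (y has_real_derivative y' t) (at t within {0..})"
    and r: "\<And>t. 0 \<le> t \<Longrightarrow> set_integrable lborel {0..t} r"
    and y': "\<And>t. 0 \<le> t \<Longrightarrow> y' t = y1 + (LINT \<tau>:{0..t}|lborel. r \<tau>)"
    and t: "0 \<le> t"
  shows "(LINT s:{0..t}|lborel. \<rho>' (t - s) * y s) = \<rho> t * y 0 + R t * y1 + (LINT s:{0..t}|lborel. R (t - s) * r s)"
proof -
  define I where "I s = (LINT \<tau>:{0..s}|lborel. r \<tau>)" for s
  have Ic: "continuous_on {0..t} I"
  proof -
    have "continuous_on {0..t} (\<lambda>s. integral {0..s} r)"
      by (rule indefinite_integral_continuous_1) (rule set_borel_integral_eq_integral(1)[OF r[OF t]])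
    then show ?thesis
      by (rule continuous_on_eq) (use set_borel_integral_eq_integral(2)[OF r] in \<open>auto simp: I_def\<close>)
  qed
  have yc: "continuous_on {0..t} y"
    using dy by (intro DERIV_continuous_on[of _ _ y']) (auto intro!: DERIV_subset[OF dy])
  have y'c: "continuous_on {0..t} y'"
    by (rule continuous_on_eq[of _ "\<lambda>s. y1 + I s"]) (intro continuous_intros Ic, simp add: y' I_def)
  have sh: "continuous_on {0..t} (\<lambda>s. f (t - s))" if "continuous_on UNIV f" for f :: "real \<Rightarrow> real"
    by (rule continuous_on_compose2[OF that]) (auto intro!: continuous_intros)
  note c\<rho> = sh[OF cont'(1)] and c\<rho>' = sh[OF cont'(2)] and cR = sh[OF cont'(3)]
  have dsh: "((\<lambda>s. f (t - s)) has_real_derivative - f' (t - s)) (at s within A)"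
    if "\<And>x. (f has_real_derivative f' x) (at x)" for f f' :: "real \<Rightarrow> real" and s A
  proof -
    have "((\<lambda>s. t - s) has_real_derivative - 1) (at s within A)" by (auto intro!: derivative_eq_intros)
    from DERIV_chain'[OF this that] show ?thesis by simp
  qed
  have "(LINT s|lborel. indicator {0..t} s *\<^sub>R (- \<rho>' (t - s) * y s + \<rho> (t - s) * y' s)) = \<rho> (t - t) * y t - \<rho> (t - 0) * y 0"
  proof (rule integral_FTC_Icc[OF t])
    fix s :: real assume s: "0 \<le> s" "s \<le> t"
    have "((\<lambda>s. \<rho> (t - s) * y s) has_real_derivative - \<rho>' (t - s) * y s + y' s * \<rho> (t - s)) (at s within {0..t})"
      by (intro DERIV_mult dsh deriv DERIV_subset[OF dy]) (use s in auto)
    then show "((\<lambda>s. \<rho> (t - s) * y s) has_vector_derivative - \<rho>' (t - s) * y s + \<rho> (t - s) * y' s) (at s within {0..t})"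
      by (simp add: has_real_derivative_iff_has_vector_derivative mult.commute)
  qed (intro continuous_intros c\<rho> c\<rho>' yc y'c)
  then have 1: "(LINT s:{0..t}|lborel. - \<rho>' (t - s) * y s + \<rho> (t - s) * y' s) = - \<rho> t * y 0"
    by (simp add: set_lebesgue_integral_def zero)
  have i1: "set_integrable lborel {0..t} (\<lambda>s. \<rho>' (t - s) * y s)" "set_integrable lborel {0..t} (\<lambda>s. \<rho> (t - s) * y' s)"
    "set_integrable lborel {0..t} (\<lambda>s. \<rho> (t - s) * y1)" "set_integrable lborel {0..t} (\<lambda>s. \<rho> (t - s) * I s)"
    by (intro borel_integrable_atLeastAtMost' continuous_intros c\<rho> c\<rho>' yc y'c Ic)+
  have "(LINT s:{0..t}|lborel. - \<rho>' (t - s) * y s + \<rho> (t - s) * y' s)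
      = (LINT s:{0..t}|lborel. \<rho> (t - s) * y' s) - (LINT s:{0..t}|lborel. \<rho>' (t - s) * y s)"
    using set_integral_diff(2)[OF i1(2,1)] by (simp add: algebra_simps)
  with 1 have 2: "(LINT s:{0..t}|lborel. \<rho>' (t - s) * y s) = \<rho> t * y 0 + (LINT s:{0..t}|lborel. \<rho> (t - s) * y' s)"
    by linarith
  have "(LINT s:{0..t}|lborel. \<rho> (t - s) * y' s) = (LINT s:{0..t}|lborel. \<rho> (t - s) * y1 + \<rho> (t - s) * I s)"
    by (rule set_lebesgue_integral_cong) (auto simp: y' I_def distrib_left)
  also have "\<dots> = (LINT s:{0..t}|lborel. \<rho> (t - s) * y1) + (LINT s:{0..t}|lborel. \<rho> (t - s) * I s)"
    by (rule set_integral_add(2)[OF i1(3,4)])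
  also have "(LINT s:{0..t}|lborel. \<rho> (t - s) * y1) = R t * y1"
  proof -
    have "(LINT s|lborel. indicator {0..t} s *\<^sub>R \<rho> (t - s)) = - R (t - t) - - R (t - 0)"
    proof (rule integral_FTC_Icc[OF t])
      fix s :: real
      have "((\<lambda>s. - R (t - s)) has_real_derivative \<rho> (t - s)) (at s within {0..t})"
        using DERIV_minus[OF dsh[OF deriv(3)]] by simp
      then show "((\<lambda>s. - R (t - s)) has_vector_derivative \<rho> (t - s)) (at s within {0..t})"
        by (simp add: has_real_derivative_iff_has_vector_derivative)
    qed (rule c\<rho>)
    then have "(LINT s:{0..t}|lborel. \<rho> (t - s)) = R t" by (simp add: set_lebesgue_integral_def zero)
    then show ?thesis by simp
  qed
  \<comment> \<open>\<open>I\<close> is only absolutely continuous, so associativity takes the place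
    of a second integration by parts: \<open>I\<close> is \<open>r\<close> convolved with the
    Heaviside function, and that function convolved with \<open>\<rho>\<close> is
    \<open>R\<close>.\<close>
  also have "(LINT s:{0..t}|lborel. \<rho> (t - s) * I s) = (LINT s:{0..t}|lborel. R (t - s) * r s)"
  proof -
    define r0 where "r0 s = indicator {0..t} s * r s" for s
    have r0i: "integrable lborel r0" using r[OF t] by (simp add: set_integrable_def r0_def[abs_def])
    have r0m: "r0 \<in> borel_measurable borel" using r0i by auto
    have cI: "conv (causal_cos 0) r0 s = (if 0 \<le> s then I s else 0)" if "s \<le> t" for s
    proof -
      have "causal_cos 0 (s - \<tau>) * r0 \<tau> = indicator {0..s} \<tau> *\<^sub>R r \<tau>" for \<tau>
        using that by (auto simp: causal_cos_def r0_def indicator_def)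
      then show ?thesis unfolding conv_def I_def set_lebesgue_integral_def by auto
    qed
    have "(LINT s:{0..t}|lborel. \<rho> (t - s) * I s) = conv \<rho> (conv (causal_cos 0) r0) t"
      unfolding set_lebesgue_integral_def conv_def[of \<rho>]
    proof (intro Bochner_Integration.integral_cong refl)
      fix s show "indicator {0..t} s *\<^sub>R (\<rho> (t - s) * I s) = \<rho> (t - s) * conv (causal_cos 0) r0 s"
        using zero(1)[of "t - s"] cI[of s] by (cases "s \<le> t") (auto simp: indicator_def)
    qed
    also have "\<dots> = conv (conv \<rho> (causal_cos 0)) r0 t"
    proof (rule conv_assoc_causal[where L = K and K = 1])
      show "integrable lborel (\<lambda>s. indicator {0..t} s * r0 s)" using r0i by (simp add: r0_def[abs_def] mult.assoc[symmetric] indicator_inter_arith[symmetric])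
      show "causal_cos 0 t = 0" if "t < 0" for t using that by (simp add: causal_cos_def)
    qed (auto simp: zero bound causal_cos_bound r0_def r0m)
    also have "\<dots> = conv R r0 t" unfolding conv_commute[of \<rho>] R_eq_conv[abs_def, symmetric] by (simp add: conv_def conv_commute[of \<rho>] R_eq_conv)
    also have "\<dots> = (LINT s:{0..t}|lborel. R (t - s) * r s)"
      unfolding conv_def set_lebesgue_integral_def r0_def by (intro Bochner_Integration.integral_cong refl) simp
    finally show ?thesis .
  qed
  finally show ?thesis using 2 by simp
qed

end

section \<open>The Gamma kernel and its derivatives\<close>

text \<open>At 0 the glued function has difference quotients no larger in modulus than those of
  \<open>f\<close>, which tend to 0.\<close>

lemma DERIV_glue_zero:
  fixes f :: "real \<Rightarrow> real"
  assumes f: "\<And>t. (f has_real_derivative f' t) (at t)" and 0: "f 0 = 0" "f' 0 = 0"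
  shows "((\<lambda>t. if t \<le> 0 then 0 else f t) has_real_derivative (if t \<le> 0 then 0 else f' t)) (at t)"
proof (cases t "0::real" rule: linorder_cases)
  case less
  have "((\<lambda>t. if t \<le> 0 then 0 else f t) has_real_derivative 0) (at t)"
    by (rule has_field_derivative_transform_within_open[of "\<lambda>_. 0" _ _ "{..<0}"]) (use less in auto)
  with less show ?thesis by simp
next
  case greater
  have "((\<lambda>t. if t \<le> 0 then 0 else f t) has_real_derivative f' t) (at t)"
    by (rule has_field_derivative_transform_within_open[OF f, of "{0<..}"]) (use greater in auto)
  with greater show ?thesis by simp
next
  case equal
  have "((\<lambda>h. (f (0 + h) - f 0) / h) \<longlongrightarrow> 0) (at 0)" using f[of 0] 0 unfolding DERIV_def by simp
  then have lim: "((\<lambda>h. norm ((f (0 + h) - 0) / h)) \<longlongrightarrow> 0) (at 0)"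
    unfolding 0 by (rule tendsto_norm_zero)
  have "((\<lambda>h. (if h \<le> 0 then 0 else f h) / h) \<longlongrightarrow> 0) (at 0)"
  proof (rule Lim_null_comparison[OF always_eventually lim], intro allI)
    show "norm ((if h \<le> 0 then 0 else f h) / h) \<le> norm ((f (0 + h) - 0) / h)" for h
      by (cases "h \<le> 0") (simp_all only: if_True if_False add_0 diff_zero div_0 norm_zero norm_ge_zero order_refl)
  qed
  then show ?thesis unfolding equal DERIV_def by (simp cong: if_cong)
qed

text \<open>Raise \<open>x / k \<le> exp (x / k)\<close> to the power \<open>k\<close>; 27 is
  \<open>3 ^ 3\<close>, the largest \<open>k ^ k\<close> in the range.\<close>

lemma power_exp_minus_bound:
  assumes "0 \<le> (x::real)" and k: "k \<in> {1, 2, 3}"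
  shows "x ^ k * exp (- x) \<le> 27"
proof -
  have k0: "0 < real k" using k by auto
  have "x / k \<le> exp (x / k)" using exp_ge_add_one_self[of "x / k"] by linarith
  then have "(x / k) ^ k \<le> exp (x / k) ^ k" using assms by (intro power_mono) auto
  also have "\<dots> = exp x" using k0 by (simp add: exp_of_nat_mult[symmetric])
  finally have "x ^ k \<le> real k ^ k * exp x" using k0 by (simp add: power_divide divide_le_eq mult.commute)
  then have "x ^ k * exp (- x) \<le> real k ^ k" by (simp add: exp_minus field_simps)
  also have "\<dots> \<le> 27" using k by auto
  finally show ?thesis .
qed

text \<open>The density of the Gamma distribution of shape 4 and rate \<open>n\<close>; shape 4 makes it twice continuously differentiable at 0.\<close>
definition gamma_kernel :: "real \<Rightarrow> real \<Rightarrow> real" where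
  "gamma_kernel n t = (if t \<le> 0 then 0 else n * ((n * t) ^ 3 * exp (- (n * t))) / 6)"

definition gamma_kernel' :: "real \<Rightarrow> real \<Rightarrow> real" where
  "gamma_kernel' n t = (if t \<le> 0 then 0 else n ^ 2 * ((3 * (n * t) ^ 2 - (n * t) ^ 3) * exp (- (n * t))) / 6)"

definition gamma_kernel'' :: "real \<Rightarrow> real \<Rightarrow> real" where
  "gamma_kernel'' n t = (if t \<le> 0 then 0 else n ^ 3 * ((6 * (n * t) - 6 * (n * t) ^ 2 + (n * t) ^ 3) * exp (- (n * t))) / 6)"

text \<open>The Erlang distribution function: one minus the probability that a Poisson process of
  rate \<open>n\<close> has at most 3 events up to time \<open>t\<close>.\<close>

definition gamma_cdf :: "real \<Rightarrow> real \<Rightarrow> real" where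
  "gamma_cdf n t = (if t \<le> 0 then 0 else 1 - (1 + n * t + (n * t)\<^sup>2 / 2 + (n * t) ^ 3 / 6) * exp (- (n * t)))"

text \<open>Each term \<open>(n * t) ^ k * exp (- (n * t))\<close> is at most 27, and the largest
  sum of coefficients, \<open>(6 + 6 + 1) / 6\<close> in the second derivative, gives 58.5, rounded
  up to 60. Adding the three powers of \<open>n\<close> yields one bound for all three
  functions.\<close>

lemma time_mollifier_gamma:
  assumes n: "0 < n"
  shows "time_mollifier (gamma_kernel n) (gamma_kernel' n) (gamma_kernel'' n) (gamma_cdf n) (60 * (n + n ^ 2 + n ^ 3))"
proof
  show d1: "(gamma_kernel n has_real_derivative gamma_kernel' n t) (at t)" for t
    unfolding gamma_kernel_def[abs_def] gamma_kernel'_def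
    by (rule DERIV_glue_zero) (auto intro!: derivative_eq_intros simp: field_simps power2_eq_square power3_eq_cube)
  show d2: "(gamma_kernel' n has_real_derivative gamma_kernel'' n t) (at t)" for t
    unfolding gamma_kernel'_def[abs_def] gamma_kernel''_def
    by (rule DERIV_glue_zero) (auto intro!: derivative_eq_intros simp: field_simps power2_eq_square power3_eq_cube)
  show d3: "(gamma_cdf n has_real_derivative gamma_kernel n t) (at t)" for t
    unfolding gamma_cdf_def[abs_def] gamma_kernel_def
    by (rule DERIV_glue_zero) (auto intro!: derivative_eq_intros simp: field_simps power2_eq_square power3_eq_cube)
  have "continuous_on ({..0} \<union> {0..}) (gamma_kernel'' n)"
    unfolding gamma_kernel''_def[abs_def]
    by (rule continuous_on_If) (auto intro!: continuous_intros)
  moreover have "{..0} \<union> {0..} = (UNIV :: real set)" by auto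
  ultimately show "continuous_on UNIV (gamma_kernel'' n)" by simp
  show "gamma_kernel n t = 0" "gamma_kernel' n t = 0" "gamma_cdf n t = 0" if "t \<le> 0" for t
    using that by (simp_all add: gamma_kernel_def gamma_kernel'_def gamma_cdf_def)
  show pos: "0 \<le> gamma_kernel n t" for t using n by (simp add: gamma_kernel_def)
  define E where "E k t = (n * t) ^ k * exp (- (n * t))" for k t
  have E: "0 \<le> E k t" "E k t \<le> 27" if "0 \<le> t" "k \<in> {1, 2, 3}" for k t
    using power_exp_minus_bound[of "n * t" k] that n by (auto simp: E_def)
  have np: "0 < n ^ 2" "0 < n ^ 3" using n by auto
  show "\<bar>gamma_kernel n t\<bar> \<le> 60 * (n + n ^ 2 + n ^ 3)" for t
  proof (cases "t \<le> 0")
    case False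
    have "gamma_kernel n t = n * (E 3 t / 6)" using False by (simp add: gamma_kernel_def E_def)
    moreover have "\<bar>n * (E 3 t / 6)\<bar> \<le> n * 60" unfolding abs_mult using False E[of t 3] n by (intro mult_mono) auto
    ultimately show ?thesis using n np by (smt (verit))
  qed (use n np in \<open>simp add: gamma_kernel_def\<close>)
  show "\<bar>gamma_kernel' n t\<bar> \<le> 60 * (n + n ^ 2 + n ^ 3)" for t
  proof (cases "t \<le> 0")
    case False
    have "gamma_kernel' n t = n ^ 2 * ((3 * E 2 t - E 3 t) / 6)" using False by (simp add: gamma_kernel'_def E_def algebra_simps)
    moreover have "\<bar>n ^ 2 * ((3 * E 2 t - E 3 t) / 6)\<bar> \<le> n ^ 2 * 60" unfolding abs_mult using False E[of t 2] E[of t 3] np by (intro mult_mono) auto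
    ultimately show ?thesis using n np by (smt (verit))
  qed (use n np in \<open>simp add: gamma_kernel'_def\<close>)
  show "\<bar>gamma_kernel'' n t\<bar> \<le> 60 * (n + n ^ 2 + n ^ 3)" for t
  proof (cases "t \<le> 0")
    case False
    have "gamma_kernel'' n t = n ^ 3 * ((6 * E 1 t - 6 * E 2 t + E 3 t) / 6)" using False by (simp add: gamma_kernel''_def E_def algebra_simps)
    moreover have "\<bar>n ^ 3 * ((6 * E 1 t - 6 * E 2 t + E 3 t) / 6)\<bar> \<le> n ^ 3 * 60" unfolding abs_mult using False E[of t 1] E[of t 2] E[of t 3] np by (intro mult_mono) auto
    ultimately show ?thesis using n np by (smt (verit))
  qed (use n np in \<open>simp add: gamma_kernel''_def\<close>)
  show "0 \<le> gamma_cdf n t" for t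
  proof (cases "t \<le> 0")
    case False
    have "gamma_cdf n 0 \<le> gamma_cdf n t"
      by (rule DERIV_nonneg_imp_nondecreasing) (use False d3 pos in auto)
    then show ?thesis by (simp add: gamma_cdf_def)
  qed (simp add: gamma_cdf_def)
  show "gamma_cdf n t \<le> 1" for t using n by (simp add: gamma_cdf_def)
qed

text \<open>The kernel looks into the past, so the limit from the left suffices. Substituting
  \<open>s = t - x / real (Suc n)\<close> fixes the kernel at rate 1, and dominated convergence acts
  on \<open>Z\<close> alone.\<close>

lemma gamma_kernel_tendsto:
  fixes Z :: "real \<Rightarrow> real"
  assumes [measurable]: "Z \<in> borel_measurable borel" and B: "\<And>s. \<bar>Z s\<bar> \<le> B" and c: "(Z \<longlongrightarrow> Z t) (at_left t)"
  shows "(\<lambda>n. LINT s|lborel. gamma_kernel (real (Suc n)) (t - s) * Z s) \<longlonglongrightarrow> Z t"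
proof -
  have gm [measurable]: "gamma_kernel n \<in> borel_measurable borel" for n unfolding gamma_kernel_def[abs_def] by measurable
  have hb: "has_bochner_integral lborel (\<lambda>x. gamma_kernel 1 x) 1"
  proof -
    have "has_bochner_integral lborel (\<lambda>x. (x ^ 3 * exp (- x) * indicator {0<..} x) / 6) (fact 3 / 6 :: real)"
      by (intro has_bochner_integral_divide has_bochner_integral_I0i_power_exp_m)
    moreover have "(\<lambda>x. (x ^ 3 * exp (- x) * indicator {0<..} x) / 6) = gamma_kernel 1"
      by (auto simp: gamma_kernel_def indicator_def)
    ultimately show ?thesis by (simp add: fact_numeral)
  qed
  have sub: "(LINT s|lborel. gamma_kernel (real (Suc n)) (t - s) * Z s) = (LINT x|lborel. gamma_kernel 1 x * Z (t - x / real (Suc n)))" for n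
  proof -
    have p: "0 < real (Suc n)" by simp
    have "gamma_kernel (real (Suc n)) (x / real (Suc n)) = real (Suc n) * gamma_kernel 1 x" for x
      using p by (simp add: gamma_kernel_def divide_le_0_iff)
    then show ?thesis
      using lborel_integral_real_affine[of "- 1 / real (Suc n)" "\<lambda>s. gamma_kernel (real (Suc n)) (t - s) * Z s" t] p
      by (simp add: mult.assoc del: of_nat_Suc)
  qed
  have "(\<lambda>n. LINT x|lborel. gamma_kernel 1 x * Z (t - x / real (Suc n))) \<longlonglongrightarrow> (LINT x|lborel. gamma_kernel 1 x * Z t)"
  proof (rule integral_dominated_convergence[where w = "\<lambda>x. gamma_kernel 1 x * B"])
    show "integrable lborel (\<lambda>x. gamma_kernel 1 x * B)" using hb by (auto intro: has_bochner_integral_integrable integrable.intros)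
    show "AE x in lborel. norm (gamma_kernel 1 x * Z (t - x / real (Suc n))) \<le> gamma_kernel 1 x * B" for n
      using B by (auto simp: abs_mult gamma_kernel_def intro!: mult_left_mono)
    show "AE x in lborel. (\<lambda>n. gamma_kernel 1 x * Z (t - x / real (Suc n))) \<longlonglongrightarrow> gamma_kernel 1 x * Z t"
    proof (rule AE_I2)
      fix x :: real
      show "(\<lambda>n. gamma_kernel 1 x * Z (t - x / real (Suc n))) \<longlonglongrightarrow> gamma_kernel 1 x * Z t"
      proof (cases "x \<le> 0")
        case False
        have "(\<lambda>n. t - x / real (Suc n)) \<longlonglongrightarrow> t - 0"
          by (intro tendsto_intros LIMSEQ_Suc[OF lim_const_over_n])
        moreover have "\<forall>\<^sub>F n in sequentially. t - x / real (Suc n) \<in> {..<t} \<and> t - x / real (Suc n) \<noteq> t"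
          using False by (intro always_eventually) (auto simp del: of_nat_Suc)
        ultimately have "filterlim (\<lambda>n. t - x / real (Suc n)) (at_left t) sequentially"
          unfolding filterlim_at by simp
        then show ?thesis by (intro tendsto_intros filterlim_compose[OF c])
      qed (simp add: gamma_kernel_def)
    qed
  qed measurable
  then show ?thesis unfolding sub using hb by (simp add: has_bochner_integral_integral_eq)
qed

subsection \<open>Weighted fields and null-set modifications\<close>

text \<open>With the square root of a coefficient as \<open>g\<close>, integrals over
  \<open>D\<close> with that coefficient become plain L^2 products over the whole space, to which
  the abstract estimates apply with \<open>lborel\<close>.\<close>

definition weighted :: "'a set \<Rightarrow> ('a \<Rightarrow> real) \<Rightarrow> ('a \<Rightarrow> 'b::real_vector) \<Rightarrow> 'a \<Rightarrow> 'b" where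
  "weighted D g U x = (indicator D x * g x) *\<^sub>R U x"

lemma measurable_cdot [measurable]:
  fixes f g :: "'x \<Rightarrow> complex^'n"
  assumes "f \<in> borel_measurable M" "g \<in> borel_measurable M"
  shows "(\<lambda>x. cdot (f x) (g x)) \<in> borel_measurable M"
  unfolding cdot_def
  by (intro borel_measurable_sum borel_measurable_times measurable_nth assms
      measurable_compose[OF measurable_nth borel_measurable_continuous_onI[of cnj]]) (intro continuous_intros)

lemma cmod_cdot_le: "cmod (cdot a (b :: complex^'n)) \<le> real CARD('n) * (norm a * norm b)"
proof -
  have "cmod (cdot a b) \<le> (\<Sum>i\<in>(UNIV::'n set). cmod (a $ i * cnj (b $ i)))" unfolding cdot_def by (rule norm_sum)
  also have "\<dots> \<le> (\<Sum>i\<in>(UNIV::'n set). norm a * norm b)"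
    by (intro sum_mono) (auto simp: norm_mult intro!: mult_mono Finite_Cartesian_Product.norm_nth_le)
  finally show ?thesis by simp
qed

lemma L2_space_weighted_measurable:
  assumes "U \<in> L2_space D" and [measurable]: "g \<in> borel_measurable borel"
  shows "weighted D g U \<in> borel_measurable lborel"
proof -
  have [measurable]: "(\<lambda>x. indicator D x *\<^sub>R U x) \<in> borel_measurable lborel"
    using assms(1) by (simp add: L2_space_def set_borel_measurable_def)
  have "(\<lambda>x. g x *\<^sub>R (indicator D x *\<^sub>R U x)) \<in> borel_measurable lborel" by measurable
  then show ?thesis by (simp add: weighted_def[abs_def] mult.commute)
qed

lemma norm_weighted: "(norm (weighted D g U x))\<^sup>2 = (g x)\<^sup>2 * (indicator D x *\<^sub>R (norm (U x))\<^sup>2)"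
  by (auto simp: weighted_def indicator_def power_mult_distrib)

lemma
  fixes U :: "'a::euclidean_space \<Rightarrow> complex^'n"
  assumes U: "U \<in> L2_space D" and g: "g \<in> borel_measurable borel" "\<And>x. \<bar>g x\<bar> \<le> G"
  shows sq_integrable_weighted: "sq_integrable lborel (weighted D g U)"
    and l2n_weighted_le: "l2n lborel (weighted D g U) \<le> G * L2_norm D U"
    and l2n_weighted_ge: "0 \<le> m \<Longrightarrow> (\<And>x. m \<le> g x) \<Longrightarrow> m * L2_norm D U \<le> l2n lborel (weighted D g U)"
proof -
  have G: "0 \<le> G" using g(2)[of undefined] by linarith
  have i: "integrable lborel (\<lambda>x. indicator D x *\<^sub>R (norm (U x))\<^sup>2)"
    using U by (simp add: L2_space_def set_integrable_def)
  have wm: "weighted D g U \<in> borel_measurable lborel" by (rule L2_space_weighted_measurable[OF U g(1)])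
  have up: "(norm (weighted D g U x))\<^sup>2 \<le> G\<^sup>2 * (indicator D x *\<^sub>R (norm (U x))\<^sup>2)" for x
    unfolding norm_weighted using power_mono[OF g(2)[of x] abs_ge_zero, of 2] by (intro mult_right_mono) auto
  show sq: "sq_integrable lborel (weighted D g U)" unfolding sq_integrable_def
  proof
    show "integrable lborel (\<lambda>x. (norm (weighted D g U x))\<^sup>2)"
    proof (rule Bochner_Integration.integrable_bound[OF integrable_mult_right[OF i, of "G\<^sup>2"]])
      show "(\<lambda>x. (norm (weighted D g U x))\<^sup>2) \<in> borel_measurable lborel" using wm by measurable
      show "AE x in lborel. norm ((norm (weighted D g U x))\<^sup>2) \<le> norm (G\<^sup>2 * (indicator D x *\<^sub>R (norm (U x))\<^sup>2))"
        using order_trans[OF up abs_ge_self] by (intro AE_I2) (simp only: real_norm_def abs_power2)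
    qed
  qed (rule wm)
  then have i2: "integrable lborel (\<lambda>x. (norm (weighted D g U x))\<^sup>2)" by (simp add: sq_integrable_def)
  have "(LINT x|lborel. (norm (weighted D g U x))\<^sup>2) \<le> (LINT x|lborel. G\<^sup>2 * (indicator D x *\<^sub>R (norm (U x))\<^sup>2))"
    by (intro integral_mono i2 integrable_mult_right i up)
  also have "\<dots> = G\<^sup>2 * (LINT x:D|lborel. (norm (U x))\<^sup>2)" by (simp only: integral_mult_right_zero set_lebesgue_integral_def)
  finally have "sqrt (LINT x|lborel. (norm (weighted D g U x))\<^sup>2) \<le> sqrt (G\<^sup>2 * (LINT x:D|lborel. (norm (U x))\<^sup>2))"
    by (rule real_sqrt_le_mono)
  then show "l2n lborel (weighted D g U) \<le> G * L2_norm D U"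
    unfolding l2n_def L2_norm_def real_sqrt_mult real_sqrt_abs using G by (simp only: abs_of_nonneg)
  show "m * L2_norm D U \<le> l2n lborel (weighted D g U)" if m: "0 \<le> m" "\<And>x. m \<le> g x"
  proof -
    have "m\<^sup>2 * (LINT x:D|lborel. (norm (U x))\<^sup>2) = (LINT x|lborel. m\<^sup>2 * (indicator D x *\<^sub>R (norm (U x))\<^sup>2))"
      by (simp only: integral_mult_right_zero set_lebesgue_integral_def)
    also have "\<dots> \<le> (LINT x|lborel. (norm (weighted D g U x))\<^sup>2)"
      using m by (intro integral_mono i2 integrable_mult_right i, unfold norm_weighted, intro mult_right_mono power_mono) auto
    finally have "sqrt (m\<^sup>2 * (LINT x:D|lborel. (norm (U x))\<^sup>2)) \<le> sqrt (LINT x|lborel. (norm (weighted D g U x))\<^sup>2)"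
      by (rule real_sqrt_le_mono)
    then show ?thesis
      unfolding l2n_def L2_norm_def real_sqrt_mult real_sqrt_abs using m(1) by (simp only: abs_of_nonneg)
  qed
qed

text \<open>The coefficient is distributed over the two fields: \<open>eps\<close> and the inverse
  of \<open>mu\<close> as squares, the coefficient 1 of the source as \<open>gi\<close> times
  \<open>g\<close>. In this way the field itself always carries the weight \<open>g\<close>.\<close>

lemma weighted_inner:
  fixes U W :: "'a::euclidean_space \<Rightarrow> complex^'n"
  assumes U: "U \<in> L2_space D" and W: "W \<in> L2_space D"
    and g: "g \<in> borel_measurable borel" "\<And>x. \<bar>g x\<bar> \<le> G" and k: "k \<in> borel_measurable borel" "\<And>x. \<bar>k x\<bar> \<le> L"
    and h: "h \<in> borel_measurable borel" "AE x in lborel. h x = g x * k x"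
  shows "Re (LINT x:D|lborel. h x *\<^sub>R cdot (U x) (W x)) = (LINT x|lborel. weighted D g U x \<bullet> weighted D k W x)"
proof -
  have D1: "(\<lambda>x. indicator D x *\<^sub>R U x) \<in> borel_measurable lborel" "(\<lambda>x. indicator D x *\<^sub>R W x) \<in> borel_measurable lborel"
    using U W by (simp_all add: L2_space_def set_borel_measurable_def)
  have ind: "cdot (indicator D x *\<^sub>R U x) (indicator D x *\<^sub>R W x) = indicator D x *\<^sub>R cdot (U x) (W x)" for x
    by (auto simp: indicator_def cdot_def)
  have "(\<lambda>x. h x *\<^sub>R cdot (indicator D x *\<^sub>R U x) (indicator D x *\<^sub>R W x)) \<in> borel_measurable lborel"
    using D1 h(1) by measurable
  then have m: "(\<lambda>x. indicator D x *\<^sub>R (h x *\<^sub>R cdot (U x) (W x))) \<in> borel_measurable lborel"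
    unfolding ind by (simp only: scaleR_left_commute)
  note sq = sq_integrable_weighted[OF U g] sq_integrable_weighted[OF W k]
  have sc: "cdot (c *\<^sub>R x) (d *\<^sub>R y) = (c * d) *\<^sub>R cdot x y" for c d and x y :: "complex^'n"
    unfolding cdot_def vector_scaleR_component by (simp add: scaleR_conv_of_real sum_distrib_left mult_ac)
  have I: "integrable lborel (\<lambda>x. indicator D x *\<^sub>R (h x *\<^sub>R cdot (U x) (W x)))"
  proof (rule Bochner_Integration.integrable_bound[OF integrable_mult_right[OF Cauchy_Schwarz_norm(1)[OF sq], of "real CARD('n)"] m])
    show "AE x in lborel. norm (indicator D x *\<^sub>R (h x *\<^sub>R cdot (U x) (W x))) \<le> norm (real CARD('n) * (norm (weighted D g U x) * norm (weighted D k W x)))"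
      using h(2)
    proof eventually_elim
      case (elim x)
      have "indicator D x *\<^sub>R (h x *\<^sub>R cdot (U x) (W x)) = cdot (weighted D g U x) (weighted D k W x)"
        unfolding weighted_def sc elim by (auto simp: indicator_def)
      then show ?case using cmod_cdot_le[of "weighted D g U x" "weighted D k W x"] by simp
    qed
  qed
  have "Re (LINT x:D|lborel. h x *\<^sub>R cdot (U x) (W x)) = (LINT x|lborel. Re (indicator D x *\<^sub>R (h x *\<^sub>R cdot (U x) (W x))))"
    unfolding set_lebesgue_integral_def by (rule integral_Re[OF I, symmetric])
  also have "\<dots> = (LINT x|lborel. weighted D g U x \<bullet> weighted D k W x)"
  proof (rule integral_cong_AE)
    show "AE x in lborel. Re (indicator D x *\<^sub>R (h x *\<^sub>R cdot (U x) (W x))) = weighted D g U x \<bullet> weighted D k W x"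
      using h(2)
    proof eventually_elim
      case (elim x) then show ?case by (auto simp: weighted_def Re_cdot indicator_def)
    qed
  qed (use borel_measurable_integrable[OF integrable_Re[OF I]] sq in \<open>auto simp only: sq_integrable_def intro!: borel_measurable_inner\<close>)
  finally show ?thesis .
qed

lemma weighted_inner_cong:
  assumes "AE x in lborel. x \<in> D \<longrightarrow> W x = W' x" "W \<in> L2_space D" "W' \<in> L2_space D" "k \<in> borel_measurable borel"
    and "V \<in> borel_measurable lborel"
  shows "(LINT x|lborel. V x \<bullet> weighted D k W x) = (LINT x|lborel. V x \<bullet> weighted D k W' x)"
proof (rule integral_cong_AE)
  show "AE x in lborel. V x \<bullet> weighted D k W x = V x \<bullet> weighted D k W' x"
    using assms(1) by eventually_elim (auto simp: weighted_def indicator_def)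
qed (intro borel_measurable_inner assms L2_space_weighted_measurable)+

text \<open>The source is controlled only up to \<open>T\<close>; the cut produces fields on the
  whole time line, as \<open>time_L2\<close> requires.\<close>

definition time_field :: "real \<Rightarrow> 'a set \<Rightarrow> ('a \<Rightarrow> real) \<Rightarrow> (real \<Rightarrow> 'a \<Rightarrow> 'b::real_vector) \<Rightarrow> real \<Rightarrow> 'a \<Rightarrow> 'b" where
  "time_field T D g U t = (if t \<in> {0<..<T} then weighted D g (U t) else (\<lambda>_. 0))"

lemma
  fixes U :: "real \<Rightarrow> 'a::euclidean_space \<Rightarrow> complex^'n"
  assumes U: "U \<in> L1_L2 T D" and g: "g \<in> borel_measurable borel" "\<And>x. \<bar>g x\<bar> \<le> G"
  shows time_L2_time_field: "time_L2 lborel (time_field T D g U)"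
    and integral_l2n_time_field: "(LINT t|lborel. l2n lborel (time_field T D g U t)) \<le> G * L1_L2_norm T D U"
proof -
  have meas: "(\<lambda>p. indicator ({0<..<T} \<times> D) p *\<^sub>R U (fst p) (snd p)) \<in> borel_measurable lborel2"
    and ae: "AE t in lborel. t \<in> {0<..<T} \<longrightarrow> U t \<in> L2_space D"
    and int: "integrable lborel (\<lambda>t. indicator {0<..<T} t *\<^sub>R L2_norm D (U t))"
    using U unfolding L1_L2_def bochner_L1_def bochner_measurable_def set_borel_measurable_def set_integrable_def lborel_prod by auto
  note [measurable] = g(1)
  have G: "0 \<le> G" using g(2)[of undefined] by linarith
  have eq: "time_field T D g U (fst p) (snd p) = g (snd p) *\<^sub>R (indicator ({0<..<T} \<times> D) p *\<^sub>R U (fst p) (snd p))" for p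
    by (auto simp: time_field_def weighted_def indicator_def mem_Times_iff)
  have M: "(\<lambda>p. time_field T D g U (fst p) (snd p)) \<in> borel_measurable lborel2"
    unfolding eq using meas by measurable
  have z: "l2n lborel (\<lambda>_. 0 :: complex^'n) = 0" by (simp add: l2n_def)
  have sq: "AE t in lborel. sq_integrable lborel (time_field T D g U t)"
    using ae by eventually_elim (auto simp: time_field_def intro: sq_integrable_weighted[OF _ g] simp: sq_integrable_def[of _ "\<lambda>_. 0"])
  have le: "AE t in lborel. l2n lborel (time_field T D g U t) \<le> G * (indicator {0<..<T} t *\<^sub>R L2_norm D (U t))"
    using ae
  proof eventually_elim
    case (elim t) then show ?case using l2n_weighted_le[OF _ g, of "U t" D] by (auto simp: time_field_def z)
  qed
  have lm: "(\<lambda>t. l2n lborel (time_field T D g U t)) \<in> borel_measurable lborel"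
  proof -
    have "(\<lambda>(t, x). (norm (time_field T D g U t x))\<^sup>2) \<in> borel_measurable lborel2"
      using M by (simp add: split_beta')
    from lborel.borel_measurable_lebesgue_integral[OF this] show ?thesis unfolding l2n_def by measurable
  qed
  have i: "integrable lborel (\<lambda>t. l2n lborel (time_field T D g U t))"
  proof (rule Bochner_Integration.integrable_bound[OF integrable_mult_right[OF int, of G] lm])
    show "AE t in lborel. norm (l2n lborel (time_field T D g U t)) \<le> norm (G * (indicator {0<..<T} t *\<^sub>R L2_norm D (U t)))"
      using le by eventually_elim (auto intro: order_trans[OF _ abs_ge_self])
  qed
  show "time_L2 lborel (time_field T D g U)" unfolding time_L2_def using M sq i by blast
  have "(LINT t|lborel. l2n lborel (time_field T D g U t)) \<le> (LINT t|lborel. G * (indicator {0<..<T} t *\<^sub>R L2_norm D (U t)))"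
    by (intro integral_mono_AE i integrable_mult_right int le)
  then show "(LINT t|lborel. l2n lborel (time_field T D g U t)) \<le> G * L1_L2_norm T D U"
    unfolding L1_L2_norm_def set_lebesgue_integral_def integral_mult_right_zero .
qed

section \<open>Changes on null sets and the coefficients of the outer regions\<close>

lemma test_fields_continuous:
  assumes "\<phi> \<in> test_fields D"
  shows "continuous_on UNIV \<phi>" "continuous_on UNIV (classical_curl \<phi>)"
proof -
  have C: "C_k k \<phi>" for k using assms by (simp add: test_fields_def)
  show "continuous_on UNIV \<phi>" using C[of 0] by simp
  have p: "continuous_on UNIV (partial i \<phi>)" for i
  proof -
    have "axis i (1::real) \<in> Basis" by (simp add: axis_in_Basis_iff)
    with C[of "Suc 0"] show ?thesis unfolding partial_def[abs_def] by simp
  qed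
  have v: "(vector [a, b, c] :: complex^3) = a *s axis 1 1 + b *s axis 2 1 + c *s axis 3 1" for a b c
    by (simp add: vec_eq_iff forall_3 axis_def)
  have s: "continuous_on UNIV (\<lambda>x. f x *s (w :: complex^3))" if "continuous_on UNIV f" for f :: "real^3 \<Rightarrow> complex" and w
    unfolding vector_scalar_mult_def by (intro continuous_intros that)
  show "continuous_on UNIV (classical_curl \<phi>)"
    unfolding classical_curl_def[abs_def] v by (intro continuous_intros s p)
qed

lemma set_integral_cdot_null_modify:
  fixes u c \<phi> \<psi> :: "'a::euclidean_space \<Rightarrow> complex^'n"
  assumes N: "N \<in> null_sets lborel"
    and u: "set_borel_measurable lborel D u" and c: "set_borel_measurable lborel D c"
    and \<phi>: "\<phi> \<in> borel_measurable borel" and \<psi>: "\<psi> \<in> borel_measurable borel"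
  shows "(LINT x:D|lborel. cdot (c x) (\<phi> x) - cdot (indicator (- N) x *\<^sub>R u x) (\<psi> x))
    = (LINT x:D|lborel. cdot (c x) (\<phi> x) - cdot (u x) (\<psi> x))"
  unfolding set_lebesgue_integral_def
proof (rule integral_cong_AE)
  have [measurable]: "N \<in> sets borel" using N by (auto dest: null_setsD2)
  note [measurable] = \<phi> \<psi> u[unfolded set_borel_measurable_def] c[unfolded set_borel_measurable_def]
  have i: "indicator D x *\<^sub>R (cdot a b - cdot d e) = cdot (indicator D x *\<^sub>R a) b - cdot (indicator D x *\<^sub>R d) e" for x and a b d e :: "complex^'n"
    by (auto simp: indicator_def cdot_def)
  have "(\<lambda>x. cdot (indicator D x *\<^sub>R c x) (\<phi> x) - cdot (indicator (- N) x *\<^sub>R (indicator D x *\<^sub>R u x)) (\<psi> x)) \<in> borel_measurable lborel"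
    by measurable
  then show "(\<lambda>x. indicator D x *\<^sub>R (cdot (c x) (\<phi> x) - cdot (indicator (- N) x *\<^sub>R u x) (\<psi> x))) \<in> borel_measurable lborel"
    unfolding i by (simp add: mult.commute)
  show "(\<lambda>x. indicator D x *\<^sub>R (cdot (c x) (\<phi> x) - cdot (u x) (\<psi> x))) \<in> borel_measurable lborel"
    unfolding i by measurable
  show "AE x in lborel. indicator D x *\<^sub>R (cdot (c x) (\<phi> x) - cdot (indicator (- N) x *\<^sub>R u x) (\<psi> x)) = indicator D x *\<^sub>R (cdot (c x) (\<phi> x) - cdot (u x) (\<psi> x))"
    using AE_not_in[OF N] by eventually_elim simp
qed

lemma L2_space_null_modify:
  assumes N: "N \<in> null_sets lborel" and u: "u \<in> L2_space D"
  shows "(\<lambda>x. indicator (- N) x *\<^sub>R u x) \<in> L2_space D"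
proof -
  have [measurable]: "N \<in> sets borel" using N by (auto dest: null_setsD2)
  have [measurable]: "(\<lambda>x. indicator D x *\<^sub>R u x) \<in> borel_measurable lborel" and i: "integrable lborel (\<lambda>x. indicator D x *\<^sub>R (norm (u x))\<^sup>2)"
    using u by (simp_all add: L2_space_def set_borel_measurable_def set_integrable_def)
  have "(\<lambda>x. indicator (- N) x *\<^sub>R (indicator D x *\<^sub>R u x)) \<in> borel_measurable lborel" by measurable
  moreover have "integrable lborel (\<lambda>x. indicator (- N) x *\<^sub>R (indicator D x *\<^sub>R (norm (u x))\<^sup>2))"
    by (rule integrable_mult_indicator[OF _ i]) simp
  moreover have "indicator D x *\<^sub>R (norm (indicator (- N) x *\<^sub>R u x))\<^sup>2 = indicator (- N) x *\<^sub>R (indicator D x *\<^sub>R (norm (u x))\<^sup>2)" for x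
    by (auto simp: indicator_def)
  ultimately show ?thesis
    by (simp add: L2_space_def set_borel_measurable_def set_integrable_def mult.commute del: real_scaleR_def)
qed

text \<open>Curl and tangential traces see \<open>u\<close> only through integrals. This allows test
  fields that vanish on a prescribed null set.\<close>

lemma
  assumes N: "N \<in> null_sets lborel" and c: "has_curl (slab h) u c"
  shows has_curl_null_modify: "has_curl (slab h) (\<lambda>x. indicator (- N) x *\<^sub>R u x) c"
    and tangential_traces_null_modify: "tangential_traces h u c g \<Longrightarrow> tangential_traces h (\<lambda>x. indicator (- N) x *\<^sub>R u x) c g"
proof -
  have uL: "u \<in> L2_space (slab h)" and cL: "c \<in> L2_space (slab h)" using c by (auto simp: has_curl_def)
  then have um: "set_borel_measurable lborel (slab h) u" "set_borel_measurable lborel (slab h) c"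
    by (auto simp: L2_space_def)
  have tm: "\<phi> \<in> borel_measurable borel" "classical_curl \<phi> \<in> borel_measurable borel" if "\<phi> \<in> test_fields D" for \<phi> D
    using test_fields_continuous[OF that] by (auto intro: borel_measurable_continuous_onI)
  note M = set_integral_cdot_null_modify[OF N um]
  have z: "set_borel_measurable lborel (slab h) (\<lambda>_. 0 :: complex^3)" by (simp add: set_borel_measurable_def)
  have cz: "cdot 0 y = 0" for y :: "complex^3" by (simp add: cdot_def)
  have M0: "(LINT x:slab h|lborel. cdot (indicator (- N) x *\<^sub>R u x) (classical_curl \<phi> x)) = (LINT x:slab h|lborel. cdot (u x) (classical_curl \<phi> x))"
    if "\<phi> \<in> test_fields D" for \<phi> D
    using set_integral_cdot_null_modify[OF N um(1) z tm(1)[OF that] tm(2)[OF that]]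
    by (simp add: cz set_lebesgue_integral_def)
  show "has_curl (slab h) (\<lambda>x. indicator (- N) x *\<^sub>R u x) c"
    using c L2_space_null_modify[OF N uL] unfolding has_curl_def by (auto simp: M0)
  show "tangential_traces h (\<lambda>x. indicator (- N) x *\<^sub>R u x) c g" if "tangential_traces h u c g"
    using that unfolding tangential_traces_def by (auto simp: M[OF tm])
qed

lemma Hdiv_trace_scale:
  assumes "(\<lambda>\<xi>. c *\<^sub>R g \<xi>) \<in> Hdiv_trace" "c \<noteq> 0"
  shows "g \<in> Hdiv_trace"
proof -
  have m: "(\<lambda>\<xi>. c *\<^sub>R g \<xi>) \<in> borel_measurable lborel" and i: "integrable lborel (Hdiv_trace_density (\<lambda>\<xi>. c *\<^sub>R g \<xi>))"
    using assms(1) by (auto simp: Hdiv_trace_def)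
  have "(\<lambda>\<xi>. (1 / c) *\<^sub>R (c *\<^sub>R g \<xi>)) \<in> borel_measurable lborel" using m by measurable
  then have gm: "g \<in> borel_measurable lborel" using assms(2) by simp
  have "Hdiv_trace_density (\<lambda>\<xi>. c *\<^sub>R g \<xi>) \<xi> = c\<^sup>2 * Hdiv_trace_density g \<xi>" for \<xi>
  proof -
    have "\<xi> $ 1 * (c *\<^sub>R g \<xi>) $ 1 + \<xi> $ 2 * (c *\<^sub>R g \<xi>) $ 2 = c *\<^sub>R (\<xi> $ 1 * g \<xi> $ 1 + \<xi> $ 2 * g \<xi> $ 2)"
      unfolding vector_scaleR_component by (simp add: scaleR_conv_of_real algebra_simps)
    then show ?thesis unfolding Hdiv_trace_density_def by (simp add: power_mult_distrib distrib_left mult_ac)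
  qed
  then have "Hdiv_trace_density (\<lambda>\<xi>. c *\<^sub>R g \<xi>) = (\<lambda>\<xi>. c\<^sup>2 * Hdiv_trace_density g \<xi>)" by (rule ext)
  then show ?thesis using gm i assms(2) by (simp add: Hdiv_trace_def)
qed

lemma is_C_op_AE_Hdiv:
  assumes "is_C_op e m u v"
  shows "AE t in lborel. 0 < t \<longrightarrow> v t \<in> Hdiv_trace"
proof -
  obtain \<sigma>0 where "laplace_transformable \<sigma>0 Hdiv_trace Hdiv_trace_norm v"
    using assms unfolding is_C_op_def by blast
  then have "(\<lambda>t \<xi>. exp (- (\<sigma>0 + 1) * t) *\<^sub>R v t \<xi>) \<in> bochner_L1 {0<..} UNIV Hdiv_trace Hdiv_trace_norm"
    unfolding laplace_transformable_def using less_add_one[of \<sigma>0] by blast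
  then have "AE t in lborel. t \<in> {0<..} \<longrightarrow> (\<lambda>\<xi>. exp (- (\<sigma>0 + 1) * t) *\<^sub>R v t \<xi>) \<in> Hdiv_trace"
    unfolding bochner_L1_def bochner_measurable_def by auto
  then show ?thesis
  proof eventually_elim
    case (elim t)
    show ?case
    proof
      assume "0 < t"
      with elim have "(\<lambda>\<xi>. exp (- (\<sigma>0 + 1) * t) *\<^sub>R v t \<xi>) \<in> Hdiv_trace" by simp
      then show "v t \<in> Hdiv_trace" by (rule Hdiv_trace_scale) simp
    qed
  qed
qed

text \<open>The outer region is open and nonempty, hence not a null set, so both almost-everywhere
  statements hold at a common point of it.\<close>

lemma outer_region_coefficient_ge:
  assumes "AE x in lborel. (c::real) \<le> f x \<and> P x" "AE x\<in>outer_region h j in lborel. f x = d \<and> Q x"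
  shows "c \<le> d"
proof (rule ccontr)
  assume neg: "\<not> c \<le> d"
  have "AE x in lborel. x \<notin> outer_region h j"
    using assms by eventually_elim (use neg in auto)
  moreover have o: "open (outer_region h j)" and ne: "outer_region h j \<noteq> {}"
  proof -
    show "open (outer_region h j)" unfolding outer_region_def
      by (auto intro!: open_Collect_less continuous_intros)
    have "(\<chi> i. h 1 + 1) \<in> {x::real^3. h 1 < x $ 3}" "(\<chi> i. h 2 - 1) \<in> {x::real^3. x $ 3 < h 2}" by auto
    then show "outer_region h j \<noteq> {}" unfolding outer_region_def by (metis empty_iff)
  qed
  moreover have "outer_region h j \<in> sets lborel" using o by simp
  ultimately have "outer_region h j \<in> null_sets lborel" by (simp add: AE_iff_null_sets)
  then have "negligible (outer_region h j)" by (simp add: negligible_iff_null_sets null_sets_completionI)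
  with open_not_negligible[OF o ne] show False by blast
qed

subsection \<open>The energy estimate\<close>

text \<open>The real part of the integrated equation, with the field \<open>a\<close> at time \<open>r\<close> as test function.\<close>
definition tested_equation ::
    "real \<Rightarrow> 'x measure \<Rightarrow> 'y measure \<Rightarrow> (real \<Rightarrow> 'x \<Rightarrow> 'b::euclidean_space) \<Rightarrow> (real \<Rightarrow> 'x \<Rightarrow> 'b) \<Rightarrow> (real \<Rightarrow> 'x \<Rightarrow> 'b) \<Rightarrow>
     ('x \<Rightarrow> 'b) \<Rightarrow> ('x \<Rightarrow> 'b) \<Rightarrow> nat set \<Rightarrow> (nat \<Rightarrow> real \<Rightarrow> 'y \<Rightarrow> 'c::euclidean_space) \<Rightarrow> (nat \<Rightarrow> real \<Rightarrow> 'y \<Rightarrow> 'c) \<Rightarrow> real \<Rightarrow>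
     (real \<Rightarrow> real) \<Rightarrow> (real \<Rightarrow> real) \<Rightarrow> (real \<Rightarrow> real) \<Rightarrow> bool" where
  "tested_equation T M N a c f w0 w1 J va ub r y y' q \<longleftrightarrow>
     (\<forall>t\<ge>0. (y has_real_derivative y' t) (at t within {0..}) \<and> set_integrable lborel {0..t} q \<and>
        y' t = (LINT x|M. w1 x \<bullet> a r x) + (LINT \<tau>:{0..t}|lborel. q \<tau>)) \<and>
     y 0 = (LINT x|M. w0 x \<bullet> a r x) \<and> (\<forall>s\<in>{0<..<T}. y s = cross M a a (s, r)) \<and>
     (AE s in lborel. s \<in> {0<..<T} \<longrightarrow>
        q s = - (cross M c c (s, r) + cross M f a (s, r) + (\<Sum>j\<in>J. cross N (va j) (ub j) (s, r))))"

context time_mollifier begin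

text \<open>For \<open>r\<close> outside (0,T) both sides vanish with the cut fields; otherwise this
  is \<open>mollified_second_derivative\<close>. The cut at \<open>T\<close> is invisible because
  the kernels vanish for \<open>s \<ge> t\<close> and \<open>t \<le> T\<close>.\<close>

lemma tested_equation_mollified:
  fixes a c f :: "real \<Rightarrow> 'x \<Rightarrow> 'b::euclidean_space" and va ub :: "nat \<Rightarrow> real \<Rightarrow> 'y \<Rightarrow> 'c::euclidean_space"
  assumes M: "sigma_finite_measure M" and N: "sigma_finite_measure N"
    and a: "time_L2 M a" and c: "time_L2 M c" and f: "time_L2 M f"
    and supp: "\<And>t x. t \<notin> {0<..<T} \<Longrightarrow> a t x = 0" "\<And>t x. t \<notin> {0<..<T} \<Longrightarrow> c t x = 0" "\<And>t x. t \<notin> {0<..<T} \<Longrightarrow> f t x = 0"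
      "\<And>j t x. t \<notin> {0<..<T} \<Longrightarrow> va j t x = 0" "\<And>j t x. t \<notin> {0<..<T} \<Longrightarrow> ub j t x = 0"
    and b: "\<And>j. j \<in> J \<Longrightarrow> time_L2 N (va j)" "\<And>j. j \<in> J \<Longrightarrow> time_L2 N (ub j)"
    and eqn: "\<And>r. r \<in> {0<..<T} \<Longrightarrow> \<exists>y y' q. tested_equation T M N a c f w0 w1 J va ub r y y' q"
    and t: "t \<in> {0..T}"
  shows "(LINT s|lborel. \<rho>' (t - s) * cross M a a (s, r)) =
        \<rho> t * (LINT x|M. w0 x \<bullet> a r x) + R t * (LINT x|M. w1 x \<bullet> a r x)
        - (LINT s|lborel. R (t - s) * (cross M c c (s, r) + cross M f a (s, r) + (\<Sum>j\<in>J. cross N (va j) (ub j) (s, r))))"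
proof (cases "r \<in> {0<..<T}")
  case False
  then show ?thesis by (simp add: cross_def supp)
next
  case True
  obtain y y' q where E: "tested_equation T M N a c f w0 w1 J va ub r y y' q" using eqn[OF True] by blast
  have dy: "\<And>t. 0 \<le> t \<Longrightarrow> (y has_real_derivative y' t) (at t within {0..})"
    and q: "\<And>t. 0 \<le> t \<Longrightarrow> set_integrable lborel {0..t} q"
    and y': "\<And>t. 0 \<le> t \<Longrightarrow> y' t = (LINT x|M. w1 x \<bullet> a r x) + (LINT \<tau>:{0..t}|lborel. q \<tau>)"
    and y0: "y 0 = (LINT x|M. w0 x \<bullet> a r x)" and ys: "\<And>s. s \<in> {0<..<T} \<Longrightarrow> y s = cross M a a (s, r)"
    and qs: "AE s in lborel. s \<in> {0<..<T} \<longrightarrow> q s = - (cross M c c (s, r) + cross M f a (s, r) + (\<Sum>j\<in>J. cross N (va j) (ub j) (s, r)))"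
    using E unfolding tested_equation_def by blast+
  have t0: "0 \<le> t" using t by simp
  have meas: "(\<lambda>s. X (s, r)) \<in> borel_measurable lborel" if "integrable lborel2 X" for X :: "real \<times> real \<Rightarrow> real"
    by (rule measurable_compose[OF _ borel_measurable_integrable[OF that]]) measurable
  define X where "X s = cross M c c (s, r) + cross M f a (s, r) + (\<Sum>j\<in>J. cross N (va j) (ub j) (s, r))" for s
  have Xm: "X \<in> borel_measurable lborel" unfolding X_def[abs_def]
    by (intro borel_measurable_add borel_measurable_sum meas integrable_cross M N a c f b)
  have am: "(\<lambda>s. cross M a a (s, r)) \<in> borel_measurable lborel" by (rule meas[OF integrable_cross[OF M a a]])
  have out: "cross M a a (s, r) = 0" "X s = 0" if "s \<notin> {0<..<T}" for s
    using that by (simp_all add: cross_def X_def supp)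
  have yc: "continuous_on {0..t} y"
    using dy by (intro DERIV_continuous_on[of _ _ y']) (auto intro!: DERIV_subset[OF dy])
  have iy: "set_integrable lborel {0..t} (\<lambda>s. \<rho>' (t - s) * y s)"
    by (intro borel_integrable_atLeastAtMost' continuous_on_mult yc continuous_on_compose2[OF cont'(2)[of UNIV]] continuous_intros) auto
  have "(LINT s:{0..t}|lborel. \<rho>' (t - s) * y s) = (LINT s|lborel. \<rho>' (t - s) * cross M a a (s, r))"
    unfolding set_lebesgue_integral_def
  proof (rule integral_cong_AE)
    show "(\<lambda>s. indicator {0..t} s *\<^sub>R (\<rho>' (t - s) * y s)) \<in> borel_measurable lborel"
      using iy unfolding set_integrable_def by (rule borel_measurable_integrable)
    show "(\<lambda>s. \<rho>' (t - s) * cross M a a (s, r)) \<in> borel_measurable lborel" using am by measurable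
    show "AE s in lborel. indicator {0..t} s *\<^sub>R (\<rho>' (t - s) * y s) = \<rho>' (t - s) * cross M a a (s, r)"
      \<comment> \<open>At \<open>s = 0\<close> the function \<open>y\<close> carries the initial
        datum while the cut field \<open>a\<close> is 0; a single point does not matter.\<close>
      using AE_lborel_singleton[of 0]
    proof eventually_elim
      case (elim s)
      consider "s < 0" | "0 < s" "s < t" | "t \<le> s" using elim by linarith
      then show ?case
      proof cases
        case 1 then show ?thesis using out(1)[of s] by simp
      next
        case 2 then show ?thesis using ys[of s] t by simp
      next
        case 3 then show ?thesis using zero(2)[of "t - s"] by simp
      qed
    qed
  qed
  moreover have "(LINT s:{0..t}|lborel. R (t - s) * q s) = (LINT s|lborel. - (R (t - s) * X s))"
    unfolding set_lebesgue_integral_def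
  proof (rule integral_cong_AE)
    have qm: "(\<lambda>s. indicator {0..t} s *\<^sub>R q s) \<in> borel_measurable lborel"
      using q[OF t0] unfolding set_integrable_def by (rule borel_measurable_integrable)
    have "(\<lambda>s. R (t - s) * (indicator {0..t} s *\<^sub>R q s)) \<in> borel_measurable lborel" using qm by measurable
    then show "(\<lambda>s. indicator {0..t} s *\<^sub>R (R (t - s) * q s)) \<in> borel_measurable lborel"
      by (simp add: mult.left_commute)
    show "(\<lambda>s. - (R (t - s) * X s)) \<in> borel_measurable lborel" using Xm by measurable
    show "AE s in lborel. indicator {0..t} s *\<^sub>R (R (t - s) * q s) = - (R (t - s) * X s)"
      using AE_lborel_singleton[of 0] qs
    proof eventually_elim
      case (elim s)
      consider "s < 0" | "0 < s" "s < t" | "t \<le> s" using elim by linarith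
      then show ?case
      proof cases
        case 1 then show ?thesis using out(2)[of s] by simp
      next
        case 2
        then have "q s = - X s" using elim(2) t unfolding X_def by auto
        with 2 show ?thesis by simp
      next
        case 3 then show ?thesis using zero(3)[of "t - s"] by simp
      qed
    qed
  qed
  ultimately show ?thesis
    using mollified_second_derivative[OF dy q y' t0] unfolding y0 X_def by simp
qed

end

section \<open>Removing the mollification\<close>

text \<open>Continuity of \<open>a\<close> in time is not known, but its pairing with the fixed
  field \<open>a t\<close> is continuous, because the equation tested with \<open>a t\<close>
  identifies it with the differentiable \<open>y\<close>. The mollified bound thus passes to the
  limit in this pairing, whose value at \<open>t\<close> is the square of
  \<open>l2n M (a t)\<close>, and one factor cancels.\<close>

lemma tested_energy_bound:
  fixes a c f :: "real \<Rightarrow> 'x \<Rightarrow> 'b::euclidean_space" and va ub :: "nat \<Rightarrow> real \<Rightarrow> 'y \<Rightarrow> 'c::euclidean_space"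
  assumes M: "sigma_finite_measure M" and N: "sigma_finite_measure N"
    and a: "time_L2 M a" and c: "time_L2 M c" and f: "time_L2 M f"
    and supp: "\<And>t x. t \<notin> {0<..<T} \<Longrightarrow> a t x = 0" "\<And>t x. t \<notin> {0<..<T} \<Longrightarrow> c t x = 0" "\<And>t x. t \<notin> {0<..<T} \<Longrightarrow> f t x = 0"
      "\<And>j t x. t \<notin> {0<..<T} \<Longrightarrow> va j t x = 0" "\<And>j t x. t \<notin> {0<..<T} \<Longrightarrow> ub j t x = 0"
    and w0: "sq_integrable M w0" and w1: "sq_integrable M w1"
    and b: "\<And>j. j \<in> J \<Longrightarrow> time_L2 N (va j)" "\<And>j. j \<in> J \<Longrightarrow> time_L2 N (ub j)"
    and b_pos: "\<And>\<rho> \<rho>' \<rho>'' R K j T'. time_mollifier \<rho> \<rho>' \<rho>'' R K \<Longrightarrow> j \<in> J \<Longrightarrow> T' \<le> T \<Longrightarrow>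
      0 \<le> (LINT t:{0..T'}|lborel. LINT p|lborel2. R (t - fst p) * \<rho> (t - snd p) * cross N (va j) (ub j) p)"
    and eqn: "\<And>r. r \<in> {0<..<T} \<Longrightarrow> \<exists>y y' q. tested_equation T M N a c f w0 w1 J va ub r y y' q"
    and t: "t \<in> {0<..<T}" and at: "sq_integrable M (a t)"
  shows "l2n M (a t) \<le> 2 * (l2n M w0 + T * l2n M w1 + T * (LINT s|lborel. l2n M (f s)))"
proof -
  define D where "D = 2 * (l2n M w0 + T * l2n M w1 + T * (LINT s|lborel. l2n M (f s)))"
  define Z where "Z s = (LINT x|M. a t x \<bullet> a s x)" for s
  have Zc: "Z s = cross M a a (s, t)" for s by (simp add: Z_def cross_def inner_commute)
  obtain y y' q where E: "tested_equation T M N a c f w0 w1 J va ub t y y' q" using eqn[OF t] by blast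
  have dy: "\<And>t. 0 \<le> t \<Longrightarrow> (y has_real_derivative y' t) (at t within {0..})"
    and ys: "\<And>s. s \<in> {0<..<T} \<Longrightarrow> y s = Z s"
    using E unfolding tested_equation_def Zc by blast+
  have Zm: "Z \<in> borel_measurable borel"
  proof -
    have "integrable lborel (\<lambda>s. 1 * Z s)" unfolding Z_def by (rule integrable_inner_time[OF M at a, of _ 1]) auto
    then show ?thesis by auto
  qed
  have yc: "continuous_on {0..} y" using dy by (rule DERIV_continuous_on) auto
  have "bounded (y ` {0..T})"
    by (rule compact_imp_bounded[OF compact_continuous_image[OF continuous_on_subset[OF yc]]]) auto
  then have "\<exists>B. \<forall>s\<in>{0..T}. \<bar>y s\<bar> \<le> B" unfolding bounded_iff by auto
  then obtain B where B: "\<And>s. s \<in> {0..T} \<Longrightarrow> \<bar>y s\<bar> \<le> B" by blast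
  have ZB: "\<bar>Z s\<bar> \<le> \<bar>B\<bar>" for s
  proof (cases "s \<in> {0<..<T}")
    case True then show ?thesis using B[of s] ys[OF True] by simp
  next
    case False then show ?thesis by (simp add: Z_def supp)
  qed
  have lim: "(Z \<longlongrightarrow> Z t) (at_left t)"
  proof -
    have "isCont y t"
    proof -
      have "continuous_on {0<..<T} y" by (rule continuous_on_subset[OF yc]) auto
      then show ?thesis using t by (simp add: continuous_on_eq_continuous_at)
    qed
    then have "(y \<longlongrightarrow> y t) (at_left t)" unfolding isCont_def by (rule filterlim_mono) (auto intro: at_le)
    moreover have "\<forall>\<^sub>F s in at_left t. y s = Z s"
      unfolding eventually_at_left_field using t ys by (intro exI[of _ 0]) auto
    ultimately show ?thesis unfolding ys[OF t] by (rule Lim_transform_eventually)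
  qed
  have "(LINT s|lborel. gamma_kernel (real (Suc n)) (t - s) * Z s) \<le> l2n M (a t) * D" for n
  proof -
    interpret m: time_mollifier "gamma_kernel (real (Suc n))" "gamma_kernel' (real (Suc n))" "gamma_kernel'' (real (Suc n))"
      "gamma_cdf (real (Suc n))" "60 * (real (Suc n) + real (Suc n) ^ 2 + real (Suc n) ^ 3)"
      by (rule time_mollifier_gamma) simp
    have tT: "t \<in> {0..T}" using t by simp
    have shm: "(\<lambda>s. gamma_kernel (real (Suc n)) (t - s)) \<in> borel_measurable borel" by measurable
    have "l2n M (m.mollify a t) \<le> D" unfolding D_def
    proof (rule m.energy_estimate[OF M N a c f _ _ w0 w1 b b_pos[OF m.time_mollifier_axioms] _ tT])
      show "AE r in lborel. (LINT s|lborel. gamma_kernel' (real (Suc n)) (t - s) * cross M a a (s, r)) =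
        gamma_kernel (real (Suc n)) t * (LINT x|M. w0 x \<bullet> a r x) + gamma_cdf (real (Suc n)) t * (LINT x|M. w1 x \<bullet> a r x)
        - (LINT s|lborel. gamma_cdf (real (Suc n)) (t - s) * (cross M c c (s, r) + cross M f a (s, r) + (\<Sum>j\<in>J. cross N (va j) (ub j) (s, r))))"
        if "t \<in> {0..T}" for t
        by (intro AE_I2 m.tested_equation_mollified[OF M N a c f supp b eqn that])
    qed (use supp in auto)
    moreover have "(LINT s|lborel. gamma_kernel (real (Suc n)) (t - s) * Z s) = (LINT x|M. a t x \<bullet> m.mollify a t x)"
      unfolding Z_def m.mollify_def by (rule integral_inner_time[OF M at a shm m.bound(1)])
    moreover have "(LINT x|M. a t x \<bullet> m.mollify a t x) \<le> l2n M (a t) * l2n M (m.mollify a t)"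
    proof -
      have "sq_integrable M (m.mollify a t)" unfolding m.mollify_def[abs_def]
        by (rule sq_integrable_time_integral[OF M a shm m.bound(1)])
      from Cauchy_Schwarz_inner(2)[OF at this] show ?thesis by linarith
    qed
    ultimately show ?thesis using mult_left_mono[of "l2n M (m.mollify a t)" D "l2n M (a t)"] by simp
  qed
  then have "Z t \<le> l2n M (a t) * D"
    by (intro LIMSEQ_le_const2[OF gamma_kernel_tendsto[OF Zm ZB lim]]) auto
  then have "l2n M (a t) * l2n M (a t) \<le> l2n M (a t) * D"
    using l2n_power2[of M "a t"] by (simp add: Z_def power2_eq_square)
  moreover have "0 \<le> D"
  proof -
    have "0 \<le> T" using t by simp
    moreover have "0 \<le> (LINT s|lborel. l2n M (f s))" by simp
    ultimately show ?thesis by (simp add: D_def)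
  qed
  ultimately have "l2n M (a t) \<le> D" by (cases "l2n M (a t) = 0") (auto simp: less_le)
  then show ?thesis by (simp add: D_def)
qed

section \<open>From the variational problem to the tested equation\<close>

lemma second_time_derivative_Re:
  assumes "second_time_derivative y y1 r"
  obtains y' where
    "\<And>t. 0 \<le> t \<Longrightarrow> ((\<lambda>t. Re (y t)) has_real_derivative y' t) (at t within {0..})"
    "\<And>t. 0 \<le> t \<Longrightarrow> set_integrable lborel {0..t} (\<lambda>t. Re (r t))"
    "\<And>t. 0 \<le> t \<Longrightarrow> y' t = Re y1 + (LINT \<tau>:{0..t}|lborel. Re (r \<tau>))"
proof -
  obtain y' where y': "\<And>t. 0 \<le> t \<Longrightarrow> (y has_vector_derivative y' t) (at t within {0..})"
    "\<And>t. 0 \<le> t \<Longrightarrow> set_integrable lborel {0..t} r" "\<And>t. 0 \<le> t \<Longrightarrow> y' t = y1 + (LINT \<tau>:{0..t}|lborel. r \<tau>)"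
    using assms unfolding second_time_derivative_def by blast
  have i: "integrable lborel (\<lambda>\<tau>. indicator {0..t} \<tau> *\<^sub>R r \<tau>)" if "0 \<le> t" for t
    using y'(2)[OF that] by (simp add: set_integrable_def)
  show thesis
  proof (rule that[of "\<lambda>t. Re (y' t)"])
    fix t :: real assume t: "0 \<le> t"
    show "((\<lambda>t. Re (y t)) has_real_derivative Re (y' t)) (at t within {0..})"
      using bounded_linear.has_vector_derivative[OF bounded_linear_Re y'(1)[OF t]]
      by (simp add: has_real_derivative_iff_has_vector_derivative)
    show "set_integrable lborel {0..t} (\<lambda>t. Re (r t))"
      using integrable_Re[OF i[OF t]] by (simp add: set_integrable_def)
    show "Re (y' t) = Re y1 + (LINT \<tau>:{0..t}|lborel. Re (r \<tau>))"
      using integral_Re[OF i[OF t]] unfolding y'(3)[OF t] by (simp add: set_lebesgue_integral_def)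
  qed
qed

text \<open>The test field for time \<open>r\<close> is \<open>E r\<close>, up to a null set, with
  its own curl and traces. The weights obey bounds at every point, while their relations to the
  coefficients hold almost everywhere.\<close>

lemma variational_weighted_bound:
  fixes h ej mj :: "nat \<Rightarrow> real" and eps mu g gi km :: "real^3 \<Rightarrow> real"
  assumes eps: "eps \<in> borel_measurable borel" and mu: "mu \<in> borel_measurable borel"
    and g: "g \<in> borel_measurable borel" "\<And>x. \<bar>g x\<bar> \<le> G" and gi: "gi \<in> borel_measurable borel" "\<And>x. \<bar>gi x\<bar> \<le> Gi"
    and km: "km \<in> borel_measurable borel" "\<And>x. \<bar>km x\<bar> \<le> Km"
    and weights: "AE x in lborel. eps x = g x * g x" "AE x in lborel. 1 = gi x * g x" "AE x in lborel. inverse (mu x) = km x * km x"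
    and pos: "\<And>j. j \<in> {1, 2} \<Longrightarrow> 0 < ej j" "\<And>j. j \<in> {1, 2} \<Longrightarrow> 0 < mj j"
    and E0: "E0 \<in> L2_space (slab h)" and E1: "E1 \<in> L2_space (slab h)"
    and sol: "variational_solution h eps mu ej mj E0 E1 F E"
    and F: "F \<in> L1_L2 T (slab h)" and t: "t \<in> {0<..<T}"
  shows "l2n lborel (weighted (slab h) g (E t)) \<le>
    2 * (l2n lborel (weighted (slab h) g E0) + T * l2n lborel (weighted (slab h) g E1)
      + T * (LINT s|lborel. l2n lborel (time_field T (slab h) gi F s)))"
proof -
  define D where "D = slab h"
  obtain curlE u v where curlE: "\<And>t. 0 < t \<Longrightarrow> has_curl D (E t) (curlE t)"
    and EL: "\<And>T. 0 < T \<Longrightarrow> E \<in> L1_L2 T D" and cL: "\<And>T. 0 < T \<Longrightarrow> curlE \<in> L1_L2 T D"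
    and tr: "\<And>t. 0 < t \<Longrightarrow> tangential_traces h (E t) (curlE t) (\<lambda>j. u j t)"
    and C: "\<And>j. j \<in> {1, 2} \<Longrightarrow> is_C_op (ej j) (mj j) (u j) (v j)"
    and eqn: "\<And>w curlw k. has_curl D w curlw \<Longrightarrow> tangential_traces h w curlw k \<Longrightarrow>
           second_time_derivative
             (\<lambda>t. LINT x:D|lborel. eps x *\<^sub>R cdot (E t x) (w x))
             (LINT x:D|lborel. eps x *\<^sub>R cdot (E1 x) (w x))
             (\<lambda>t. - (LINT x:D|lborel. inverse (mu x) *\<^sub>R cdot (curlE t x) (curlw x))
                  - (LINT x:D|lborel. cdot (F t x) (w x))
                  - (\<Sum>j\<in>{1, 2}. trace_pairing (v j t) (k j)))"
    using sol unfolding variational_solution_def D_def by blast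
  have init: "AE x\<in>D in lborel. E 0 x = E0 x" and FL: "AE t\<in>{0<..} in lborel. F t \<in> L2_space D"
    using sol unfolding variational_solution_def D_def by blast+
  have T: "0 < T" using t by simp
  have E2: "E t \<in> L2_space D" "curlE t \<in> L2_space D" if "0 < t" for t
    using curlE[OF that] by (auto simp: has_curl_def)
  define a where "a = time_field T D g E"
  define c where "c = time_field T D km curlE"
  define f where "f = time_field T D gi F"
  define va where "va j t \<xi> = div_weight \<xi> (time_restrict T (v j) t \<xi>)" for j t \<xi>
  define ub where "ub j t \<xi> = curl_weight \<xi> (time_restrict T (u j) t \<xi>)" for j t \<xi>
  have at: "a t = weighted D g (E t)" and ct: "c t = weighted D km (curlE t)" and ft: "f t = weighted D gi (F t)"
    if "t \<in> {0<..<T}" for t using that by (simp_all add: a_def c_def f_def time_field_def)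
  have sf: "sigma_finite_measure lborel" by (rule lborel.sigma_finite_measure_axioms)
  have wm: "weighted D k U \<in> borel_measurable lborel" if "U \<in> L2_space D" "k \<in> borel_measurable borel" for U :: "real^3 \<Rightarrow> complex^3" and k
    by (rule L2_space_weighted_measurable[OF that])
  have tested: "\<exists>y y' q. tested_equation T lborel lborel a c f (weighted D g E0) (weighted D g E1) {1, 2} va ub r y y' q"
    if r: "r \<in> {0<..<T}" for r
  proof -
    have r0: "0 < r" using r by simp
    txt \<open>\<open>E 0\<close> equals \<open>E0\<close> only off a null set \<open>N\<close>, on which it need not be Borel; a test function vanishing on \<open>N\<close> does not see this.\<close>
    obtain N where N: "N \<in> null_sets lborel" "{x. \<not> (x \<in> D \<longrightarrow> E 0 x = E0 x)} \<subseteq> N"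
      using init by (auto elim!: AE_E simp: null_sets_def)
    define w where "w x = indicator (- N) x *\<^sub>R E r x" for x
    have w: "has_curl D w (curlE r)" "tangential_traces h w (curlE r) (\<lambda>j. u j r)"
      unfolding w_def D_def using has_curl_null_modify[OF N(1) curlE[OF r0, unfolded D_def]]
        tangential_traces_null_modify[OF N(1) curlE[OF r0, unfolded D_def] tr[OF r0]] by auto
    have wL: "w \<in> L2_space D" using w(1) by (simp add: has_curl_def)
    have wE: "AE x in lborel. x \<in> D \<longrightarrow> w x = E r x"
      using AE_not_in[OF N(1)] by eventually_elim (simp add: w_def)
    \<comment> \<open>One identity serves the initial data, the second time derivative and the
      source; the weight on the test field is \<open>g\<close> each time.\<close>
    have pair: "Re (LINT x:D|lborel. k x *\<^sub>R cdot (U x) (w x)) = (LINT x|lborel. weighted D l U x \<bullet> a r x)"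
      if U: "U \<in> L2_space D" and l: "l \<in> borel_measurable borel" "\<And>x. \<bar>l x\<bar> \<le> L"
        and k: "k \<in> borel_measurable borel" "AE x in lborel. k x = l x * g x" for U k l L
      unfolding weighted_inner[OF U wL l g k] at[OF r]
      by (rule weighted_inner_cong[OF wE wL E2(1)[OF r0] g(1) wm[OF U l(1)]])
    obtain y' where y': "\<And>t. 0 \<le> t \<Longrightarrow> ((\<lambda>t. Re (LINT x:D|lborel. eps x *\<^sub>R cdot (E t x) (w x))) has_real_derivative y' t) (at t within {0..})"
      "\<And>t. 0 \<le> t \<Longrightarrow> set_integrable lborel {0..t} (\<lambda>t. Re (- (LINT x:D|lborel. inverse (mu x) *\<^sub>R cdot (curlE t x) (curlE r x))
                  - (LINT x:D|lborel. cdot (F t x) (w x)) - (\<Sum>j\<in>{1, 2}. trace_pairing (v j t) (u j r))))"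
      "\<And>t. 0 \<le> t \<Longrightarrow> y' t = Re (LINT x:D|lborel. eps x *\<^sub>R cdot (E1 x) (w x)) +
         (LINT \<tau>:{0..t}|lborel. Re (- (LINT x:D|lborel. inverse (mu x) *\<^sub>R cdot (curlE \<tau> x) (curlE r x))
                  - (LINT x:D|lborel. cdot (F \<tau> x) (w x)) - (\<Sum>j\<in>{1, 2}. trace_pairing (v j \<tau>) (u j r))))"
      using second_time_derivative_Re[OF eqn[OF w]] by blast
    have y1: "Re (LINT x:D|lborel. eps x *\<^sub>R cdot (E1 x) (w x)) = (LINT x|lborel. weighted D g E1 x \<bullet> a r x)"
      by (rule pair[OF E1[folded D_def] g eps weights(1)])
    have y0: "Re (LINT x:D|lborel. eps x *\<^sub>R cdot (E 0 x) (w x)) = (LINT x|lborel. weighted D g E0 x \<bullet> a r x)"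
    proof -
      have "indicator D x *\<^sub>R (eps x *\<^sub>R cdot (E 0 x) (w x)) = indicator D x *\<^sub>R (eps x *\<^sub>R cdot (E0 x) (w x))" for x
        using N(2) by (cases "x \<in> N") (auto simp: w_def cdot_def indicator_def)
      then show ?thesis
        using pair[OF E0[folded D_def] g eps weights(1)] by (simp only: set_lebesgue_integral_def)
    qed
    have ys: "Re (LINT x:D|lborel. eps x *\<^sub>R cdot (E s x) (w x)) = cross lborel a a (s, r)" if s: "s \<in> {0<..<T}" for s
      using pair[OF E2(1) g eps weights(1), of s] s by (simp add: cross_def at[OF s])
    have qs: "AE s in lborel. s \<in> {0<..<T} \<longrightarrow>
      Re (- (LINT x:D|lborel. inverse (mu x) *\<^sub>R cdot (curlE s x) (curlE r x)) - (LINT x:D|lborel. cdot (F s x) (w x))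
          - (\<Sum>j\<in>{1, 2}. trace_pairing (v j s) (u j r)))
      = - (cross lborel c c (s, r) + cross lborel f a (s, r) + (\<Sum>j\<in>{1, 2}. cross lborel (va j) (ub j) (s, r)))"
    proof -
      \<comment> \<open>The boundary values \<open>v j s\<close> lie in their trace space only for
        almost every \<open>s\<close>, hence the almost-everywhere form of
        \<open>qs\<close>.\<close>
      have C1: "AE s in lborel. 0 < s \<longrightarrow> v 1 s \<in> Hdiv_trace" by (rule is_C_op_AE_Hdiv[OF C]) simp
      have C2: "AE s in lborel. 0 < s \<longrightarrow> v 2 s \<in> Hdiv_trace" by (rule is_C_op_AE_Hdiv[OF C]) simp
      have one: "(\<lambda>x. 1 :: real) \<in> borel_measurable borel" by simp
      have cB: "Re (LINT x:D|lborel. cdot (F s x) (w x)) = cross lborel f a (s, r)" if "s \<in> {0<..<T}" "F s \<in> L2_space D" for s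
        using pair[OF that(2) gi one weights(2)] by (simp add: cross_def ft[OF that(1)])
      have cA: "Re (LINT x:D|lborel. inverse (mu x) *\<^sub>R cdot (curlE s x) (curlE r x)) = cross lborel c c (s, r)" if s: "s \<in> {0<..<T}" for s
      proof -
        have s0: "0 < s" using s by simp
        have "(\<lambda>x. inverse (mu x)) \<in> borel_measurable borel" using mu by measurable
        from weighted_inner[OF E2(2)[OF s0] E2(2)[OF r0] km km this weights(3)]
        show ?thesis by (simp add: cross_def ct[OF s] ct[OF r])
      qed
      have cC: "Re (trace_pairing (v j s) (u j r)) = cross lborel (va j) (ub j) (s, r)"
        if s: "s \<in> {0<..<T}" and vj: "v j s \<in> Hdiv_trace" and j: "j \<in> {1, 2}" for s j
      proof -
        have "u j r \<in> Hcurl_trace" using tr[OF r0] j unfolding tangential_traces_def by blast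
        from cross_trace_pairing[OF vj this] show ?thesis
          using s r by (simp add: cross_def va_def ub_def time_restrict_def)
      qed
      show ?thesis
        using FL C1 C2
      proof eventually_elim
        case (elim s)
        show ?case
        proof
          assume s: "s \<in> {0<..<T}"
          then have s0: "0 < s" by simp
          have "Re (\<Sum>j\<in>{1, 2}. trace_pairing (v j s) (u j r)) = (\<Sum>j\<in>{1, 2}. cross lborel (va j) (ub j) (s, r))"
            unfolding Re_sum using cC[OF s] elim(2,3) s0 by (intro sum.cong) auto
          moreover have "F s \<in> L2_space D" using elim(1) s0 by simp
          ultimately show "Re (- (LINT x:D|lborel. inverse (mu x) *\<^sub>R cdot (curlE s x) (curlE r x)) - (LINT x:D|lborel. cdot (F s x) (w x))
              - (\<Sum>j\<in>{1, 2}. trace_pairing (v j s) (u j r)))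
            = - (cross lborel c c (s, r) + cross lborel f a (s, r) + (\<Sum>j\<in>{1, 2}. cross lborel (va j) (ub j) (s, r)))"
            using cA[OF s] cB[OF s] by (simp only: minus_complex.simps uminus_complex.simps)
        qed
      qed
    qed
    show ?thesis unfolding tested_equation_def
      using y'(1,2) y'(3)[unfolded y1] y0 ys qs by blast
  qed
  have "l2n lborel (a t) \<le> 2 * (l2n lborel (weighted D g E0) + T * l2n lborel (weighted D g E1) + T * (LINT s|lborel. l2n lborel (f s)))"
  proof (rule tested_energy_bound[OF sf sf _ _ _ _ _ _ _ _ _ _ _ _ _ tested t])
    show "time_L2 lborel a" unfolding a_def by (rule time_L2_time_field[OF EL[OF T] g])
    show "time_L2 lborel c" unfolding c_def by (rule time_L2_time_field[OF cL[OF T] km])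
    show "time_L2 lborel f" unfolding f_def D_def by (rule time_L2_time_field[OF F gi])
    show "sq_integrable lborel (weighted D g E0)" "sq_integrable lborel (weighted D g E1)"
      unfolding D_def by (rule sq_integrable_weighted[OF E0 g] sq_integrable_weighted[OF E1 g])+
    show "time_L2 lborel (va j)" "time_L2 lborel (ub j)" if "j \<in> {1, 2}" for j
      unfolding va_def[abs_def] ub_def[abs_def] using is_C_op_time_L2[OF C[OF that]] by blast+
    show "0 \<le> (LINT t:{0..T'}|lborel. LINT p|lborel2. R (t - fst p) * \<rho> (t - snd p) * cross lborel (va j) (ub j) p)"
      if "time_mollifier \<rho> \<rho>' \<rho>'' R K" "j \<in> {1, 2}" "T' \<le> T" for \<rho> \<rho>' \<rho>'' R K j T'
      unfolding va_def[abs_def] ub_def[abs_def]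
      by (rule time_mollifier.boundary_nonneg[OF that(1) C[OF that(2)] pos(1)[OF that(2)] pos(2)[OF that(2)] that(3)])
    show "sq_integrable lborel (a t)" unfolding at[OF t] using t by (intro sq_integrable_weighted[OF E2(1) g]) simp
    have z: "div_weight \<xi> 0 = 0" "curl_weight \<xi> 0 = 0" for \<xi>
      using linear_0[OF bounded_linear.linear[OF weight_bounded_linear(1)]] linear_0[OF bounded_linear.linear[OF weight_bounded_linear(2)]] by auto
    show "a t x = 0" "c t x = 0" "f t x = 0" if "t \<notin> {0<..<T}" for t x
      using that by (auto simp: a_def c_def f_def time_field_def)
    show "va j t x = 0" "ub j t x = 0" if "t \<notin> {0<..<T}" for j t x
      using that by (auto simp: va_def ub_def time_restrict_def z)
  qed
  then show ?thesis unfolding at[OF t] f_def D_def .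
qed

section \<open>The explicit constant and the two norms in time\<close>

theorem theorem4p4:
  fixes h :: "nat \<Rightarrow> real"
    and eps mu :: "real^3 \<Rightarrow> real"
    and eps_min eps_max mu_min mu_max :: real
    and ej mj :: "nat \<Rightarrow> real"
  assumes "h 2 < h 1"
    and "eps \<in> borel_measurable borel" and "mu \<in> borel_measurable borel"
    and "0 < eps_min" and "AE x in lborel. eps_min \<le> eps x \<and> eps x \<le> eps_max"
    and "0 < mu_min" and "AE x in lborel. mu_min \<le> mu x \<and> mu x \<le> mu_max"
    and "\<And>j. j \<in> {1, 2} \<Longrightarrow> AE x\<in>outer_region h j in lborel. eps x = ej j \<and> mu x = mj j"
  shows "\<exists>C>0. \<forall>E0 E1 F E T.
    E0 \<in> L2_space (slab h) \<longrightarrow> E1 \<in> L2_space (slab h) \<longrightarrow>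
    variational_solution h eps mu ej mj E0 E1 F E \<longrightarrow>
    T > 0 \<longrightarrow> F \<in> L1_L2 T (slab h) \<longrightarrow>
      E \<in> Linf_L2 T (slab h) \<and>
      Linf_L2_norm T (slab h) E \<le>
        ereal (C * (L2_norm (slab h) E0 + T * L2_norm (slab h) E1 + T * L1_L2_norm T (slab h) F)) \<and>
      E \<in> L2_L2 T (slab h) \<and>
      L2_L2_norm T (slab h) E \<le>
        C * (sqrt T * (L2_norm (slab h) E0 + T * L2_norm (slab h) E1 + T * L1_L2_norm T (slab h) F))"
proof -
  define D where "D = slab h"
  \<comment> \<open>The coefficients obey their bounds off a null set, while the weights need bounds
    at every point; so the coefficients are clipped. The maximum keeps the clipping interval
    nonempty.\<close>
  define emax where "emax = max eps_min eps_max"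
  define mmax where "mmax = max mu_min mu_max"
  have em: "eps_min \<le> emax" "0 < emax" using assms(4) by (simp_all add: emax_def)
  define eps' where "eps' x = max eps_min (min emax (eps x))" for x
  define mu' where "mu' x = max mu_min (min mmax (mu x))" for x
  have [measurable]: "eps \<in> borel_measurable borel" "mu \<in> borel_measurable borel" by fact+
  have e': "eps_min \<le> eps' x" "eps' x \<le> emax" "0 < eps' x" for x
    using assms(4) em by (auto simp: eps'_def)
  have m': "mu_min \<le> mu' x" "0 < mu' x" for x using assms(6) by (auto simp: mu'_def)
  have aee: "AE x in lborel. eps x = eps' x"
    using assms(5) by eventually_elim (auto simp: eps'_def emax_def)
  have aem: "AE x in lborel. mu x = mu' x"
    using assms(7) by eventually_elim (auto simp: mu'_def mmax_def)
  define g where "g x = sqrt (eps' x)" for x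
  define gi where "gi x = 1 / sqrt (eps' x)" for x
  define km where "km x = sqrt (inverse (mu' x))" for x
  have gm: "g \<in> borel_measurable borel" "gi \<in> borel_measurable borel" "km \<in> borel_measurable borel"
    unfolding g_def[abs_def] gi_def[abs_def] km_def[abs_def] eps'_def[abs_def] mu'_def[abs_def] by measurable
  have gb: "\<bar>g x\<bar> \<le> sqrt emax" "\<bar>gi x\<bar> \<le> 1 / sqrt eps_min" "\<bar>km x\<bar> \<le> sqrt (inverse mu_min)" "sqrt eps_min \<le> g x" for x
    using e'[of x] m'[of x] assms(4,6) by (auto simp: g_def gi_def km_def intro!: divide_left_mono le_imp_inverse_le)
  have weights: "AE x in lborel. eps x = g x * g x" "AE x in lborel. 1 = gi x * g x" "AE x in lborel. inverse (mu x) = km x * km x"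
  proof -
    show "AE x in lborel. eps x = g x * g x" using aee e'(3) by (auto elim!: eventually_mono simp: g_def less_imp_le)
    have "1 = gi x * g x" for x using e'(3)[of x] by (simp add: g_def gi_def)
    then show "AE x in lborel. 1 = gi x * g x" by (rule AE_I2)
    show "AE x in lborel. inverse (mu x) = km x * km x" using aem m'(2) by (auto elim!: eventually_mono simp: km_def less_imp_le)
  qed
  \<comment> \<open>The outer constants inherit the positive lower bounds, on which the sign of the
    boundary terms rests.\<close>
  have pos: "0 < ej j" "0 < mj j" if j: "j \<in> {1, 2}" for j
  proof -
    have "eps_min \<le> ej j"
      by (rule outer_region_coefficient_ge[OF assms(5) assms(8)[OF j]])
    moreover have "mu_min \<le> mj j"
    proof (rule outer_region_coefficient_ge[OF assms(7)])
      show "AE x\<in>outer_region h j in lborel. mu x = mj j \<and> eps x = ej j"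
        using assms(8)[OF j] by (auto elim!: eventually_mono)
    qed
    ultimately show "0 < ej j" "0 < mj j" using assms(4,6) by linarith+
  qed
  \<comment> \<open>The 2 comes from the energy estimate. Passing to the weighted norm and back
    costs \<open>sqrt emax / sqrt eps_min\<close> for the initial data; for the source the factor
    \<open>1 / sqrt eps_min\<close> occurs twice, once in \<open>gi\<close> and once on the way
    back.\<close>
  define C where "C = 2 * (sqrt emax / sqrt eps_min + 1 / eps_min)"
  have C: "0 < C" "2 * sqrt emax / sqrt eps_min \<le> C" "2 / eps_min \<le> C"
    using assms(4) em by (simp_all add: C_def add_pos_pos)
  show ?thesis
  proof (intro exI[of _ C] conjI C(1) allI impI)
    fix E0 E1 F E T
    assume E0: "E0 \<in> L2_space (slab h)" and E1: "E1 \<in> L2_space (slab h)"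
      and sol: "variational_solution h eps mu ej mj E0 E1 F E" and T: "0 < T" and F: "F \<in> L1_L2 T (slab h)"
    define X where "X = L2_norm D E0 + T * L2_norm D E1 + T * L1_L2_norm T D F"
    have n0: "0 \<le> L2_norm D U" for U :: "real^3 \<Rightarrow> complex^3" by (simp add: L2_norm_def set_lebesgue_integral_def)
    have nF: "0 \<le> L1_L2_norm T D F"
      unfolding L1_L2_norm_def set_lebesgue_integral_def using n0 by (intro Bochner_Integration.integral_nonneg) simp
    have X0: "0 \<le> X" using T n0 nF by (simp add: X_def)
    have EL: "E \<in> L1_L2 T D" using sol T unfolding variational_solution_def D_def by blast
    \<comment> \<open>Holds at every time in (0,T), not just almost everywhere; both norms in time
      follow from it.\<close>
    have bound: "L2_norm D (E t) \<le> C * X" if t: "t \<in> {0<..<T}" for t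
    proof -
      have Et: "E t \<in> L2_space D" using sol t unfolding variational_solution_def Hcurl_def has_curl_def D_def by auto
      have "sqrt eps_min * L2_norm D (E t) \<le> l2n lborel (weighted D g (E t))"
        by (rule l2n_weighted_ge[OF Et gm(1) gb(1)]) (use assms(4) gb(4) in auto)
      also have "\<dots> \<le> 2 * (l2n lborel (weighted D g E0) + T * l2n lborel (weighted D g E1) + T * (LINT s|lborel. l2n lborel (time_field T D gi F s)))"
        unfolding D_def by (rule variational_weighted_bound[OF assms(2,3) gm(1) gb(1) gm(2) gb(2) gm(3) gb(3) weights pos E0 E1 sol F t])
      also have "\<dots> \<le> 2 * (sqrt emax * L2_norm D E0 + T * (sqrt emax * L2_norm D E1) + T * (1 / sqrt eps_min * L1_L2_norm T D F))"
        using T l2n_weighted_le[OF E0 gm(1) gb(1)] l2n_weighted_le[OF E1 gm(1) gb(1)] integral_l2n_time_field[OF F gm(2) gb(2)]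
        unfolding D_def by (intro mult_left_mono add_mono) auto
      finally have "L2_norm D (E t) \<le> 2 * (sqrt emax * L2_norm D E0 + T * (sqrt emax * L2_norm D E1) + T * (1 / sqrt eps_min * L1_L2_norm T D F)) / sqrt eps_min"
        using assms(4) by (simp add: pos_le_divide_eq mult.commute)
      also have "\<dots> = (2 * sqrt emax / sqrt eps_min) * L2_norm D E0 + (2 * sqrt emax / sqrt eps_min) * (T * L2_norm D E1) + 2 / (sqrt eps_min * sqrt eps_min) * (T * L1_L2_norm T D F)"
        using assms(4) by (simp add: add_divide_distrib distrib_left mult_ac)
      also have "\<dots> \<le> C * L2_norm D E0 + C * (T * L2_norm D E1) + C * (T * L1_L2_norm T D F)"
        using C(2,3) assms(4) T n0 nF by (intro add_mono mult_right_mono) auto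
      also have "\<dots> = C * X" by (simp add: X_def distrib_left)
      finally show ?thesis .
    qed
    have bm: "bochner_measurable {0<..<T} D (L2_space D) E" and int: "set_integrable lborel {0<..<T} (\<lambda>t. L2_norm D (E t))"
      using EL unfolding L1_L2_def bochner_L1_def by auto
    have nm: "(\<lambda>t. indicator {0<..<T} t *\<^sub>R L2_norm D (E t)) \<in> borel_measurable lborel"
      using int unfolding set_integrable_def by (rule borel_measurable_integrable)
    have linf: "Linf_L2_norm T D E \<le> ereal (C * X)"
      unfolding Linf_L2_norm_def
    proof (rule esssup_I)
      have "(\<lambda>t. L2_norm D (E t)) \<in> borel_measurable (restrict_space lborel {0<..<T})"
        using nm by (subst borel_measurable_restrict_space_iff) auto
      then show "(\<lambda>t. ereal (L2_norm D (E t))) \<in> borel_measurable (restrict_space lborel {0<..<T})" by measurable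
      show "AE t in restrict_space lborel {0<..<T}. ereal (L2_norm D (E t)) \<le> ereal (C * X)"
        using bound by (intro AE_I2) (auto simp: space_restrict_space)
    qed
    show "Linf_L2_norm T (slab h) E \<le> ereal (C * (L2_norm (slab h) E0 + T * L2_norm (slab h) E1 + T * L1_L2_norm T (slab h) F))"
      using linf unfolding X_def D_def .
    show "E \<in> Linf_L2 T (slab h)"
      using bm linf unfolding Linf_L2_def D_def by (auto intro: le_less_trans)
    have sq: "indicator {0<..<T} t *\<^sub>R (L2_norm D (E t))\<^sup>2 \<le> indicator {0<..<T} t * (C * X)\<^sup>2" for t
      using power_mono[OF bound[of t] n0, of 2] by (cases "t \<in> {0<..<T}") auto
    have ci: "integrable lborel (\<lambda>t. indicator {0<..<T} t * (C * X)\<^sup>2)"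
      by (intro integrable_mult_left integrable_real_indicator) (use T in auto)
    have si: "integrable lborel (\<lambda>t. indicator {0<..<T} t *\<^sub>R (L2_norm D (E t))\<^sup>2)"
    proof (rule Bochner_Integration.integrable_bound[OF ci])
      have "(\<lambda>t. (indicator {0<..<T} t *\<^sub>R L2_norm D (E t))\<^sup>2) \<in> borel_measurable lborel" using nm by (rule borel_measurable_power)
      moreover have "(indicator {0<..<T} t *\<^sub>R L2_norm D (E t))\<^sup>2 = indicator {0<..<T} t *\<^sub>R (L2_norm D (E t))\<^sup>2" for t
        by (auto simp: indicator_def)
      ultimately show "(\<lambda>t. indicator {0<..<T} t *\<^sub>R (L2_norm D (E t))\<^sup>2) \<in> borel_measurable lborel" by simp
      show "AE t in lborel. norm (indicator {0<..<T} t *\<^sub>R (L2_norm D (E t))\<^sup>2) \<le> norm (indicator {0<..<T} t * (C * X)\<^sup>2)"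
        using sq by (intro AE_I2) auto
    qed
    show "E \<in> L2_L2 T (slab h)"
      using bm si unfolding L2_L2_def set_integrable_def D_def by simp
    \<comment> \<open>Integrating the uniform bound over an interval of length \<open>T\<close>
      produces the factor \<open>sqrt T\<close>.\<close>
    have "(LINT t:{0<..<T}|lborel. (L2_norm D (E t))\<^sup>2) \<le> (LINT t|lborel. indicator {0<..<T} t * (C * X)\<^sup>2)"
      unfolding set_lebesgue_integral_def by (intro integral_mono si ci sq)
    also have "\<dots> = T * (C * X)\<^sup>2" using T by simp
    finally have "L2_L2_norm T D E \<le> sqrt (T * (C * X)\<^sup>2)"
      unfolding L2_L2_norm_def by (rule real_sqrt_le_mono)
    also have "\<dots> = C * (sqrt T * X)"
      using C(1) X0 by (simp add: real_sqrt_mult)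
    finally show "L2_L2_norm T (slab h) E \<le> C * (sqrt T * (L2_norm (slab h) E0 + T * L2_norm (slab h) E1 + T * L1_L2_norm T (slab h) F))"
      unfolding X_def D_def .
  qed
qed

end
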